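(* Let $X$ be a compact space. The following conditions are equivalent: (1) $X$ is weakly Radon-Nikodým (WRN). (2) There exists a Rosenthal family $F\subset C(X)$ for $X$ which separates the points of $X$.
   Context: Compact means compact Hausdorff; $C(X)$ is the Banach space of continuous real valued functions on $X$ with the supremum norm. A Banach space is a Rosenthal space if it does not contain an isomorphic copy of $l_1$. A compact space $X$ is weakly Radon-Nikodým (WRN) if $X$ is homeomorphic to a weak$^*$ compact subset of the dual $V^*$ of a Rosenthal Banach space $V$. A function $f:X\to\mathbb{R}$ on a topological space $X$ is fragmented if for every nonempty $A\subset X$ and every $\varepsilon>0$ there is an open $O\subset X$ with $O\cap A\ne\emptyset$ and $\operatorname{diam} f(O\cap A)\le\varepsilon$. $\mathcal{F}(X)$ denotes the set of fragmented functions $X\to\mathbb{R}$. A subset $F\subset C(X)$ is a Rosenthal family for $X$ if $F$ is norm bounded and its pointwise closure $\mathrm{cls}_p(F)$ in $\mathbb{R}^X$ satisfies $\mathrm{cls}_p(F)\subset\mathcal{F}(X)$. *)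

theory Defs
  imports "HOL-Analysis.Analysis" "HOL-Library.Function_Algebras"
begin

section \<open>Banach spaces on a carrier\<close>

text \<open>
  Real-valued functions form a real vector space under the pointwise operations.  The additive
  structure comes from \<^theory>\<open>HOL-Library.Function_Algebras\<close>.
\<close>

instantiation "fun" :: (type, real_vector) real_vector
begin

definition scaleR_fun :: "real \<Rightarrow> ('a \<Rightarrow> 'b) \<Rightarrow> 'a \<Rightarrow> 'b"
  where "scaleR_fun c f = (\<lambda>x. c *\<^sub>R f x)"

instance
  by standard (simp_all add: scaleR_fun_def fun_eq_iff scaleR_add_right scaleR_add_left)

end

text \<open>
  HOL cannot quantify existentially over types, so a Banach space is a linear subspace \<open>V\<close> of
  an arbitrary real vector space together with a norm \<open>N\<close> on \<open>V\<close>.  Neither a topology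
  on the ambient type nor the values of \<open>N\<close> outside \<open>V\<close> play any role.
\<close>

locale banach_on =
  fixes V :: "'v::real_vector set" and N :: "'v \<Rightarrow> real"
  assumes subspace: "subspace V"
    and norm_nonneg: "\<And>x. x \<in> V \<Longrightarrow> 0 \<le> N x"
    and norm_eq_0: "\<And>x. x \<in> V \<Longrightarrow> N x = 0 \<longleftrightarrow> x = 0"
    and norm_triangle: "\<And>x y. x \<in> V \<Longrightarrow> y \<in> V \<Longrightarrow> N (x + y) \<le> N x + N y"
    and norm_scaleR: "\<And>c x. x \<in> V \<Longrightarrow> N (c *\<^sub>R x) = \<bar>c\<bar> * N x"
    and complete:
      "\<And>s :: nat \<Rightarrow> 'v. (\<forall>n. s n \<in> V) \<Longrightarrow>
         (\<forall>e>0. \<exists>k. \<forall>m\<ge>k. \<forall>n\<ge>k. N (s m - s n) < e) \<Longrightarrow>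
         \<exists>l\<in>V. (\<lambda>n. N (s n - l)) \<longlonglongrightarrow> 0"

definition linear_between ::
    "'v::real_vector set \<Rightarrow> 'w::real_vector set \<Rightarrow> ('v \<Rightarrow> 'w) \<Rightarrow> bool"
  where "linear_between V W T \<longleftrightarrow>
    T ` V \<subseteq> W \<and>
    (\<forall>x\<in>V. \<forall>y\<in>V. T (x + y) = T x + T y) \<and>
    (\<forall>c. \<forall>x\<in>V. T (c *\<^sub>R x) = c *\<^sub>R T x)"

text \<open>\<open>W\<close> contains an isomorphic (i.e. linearly homeomorphic) copy of \<open>V\<close>.\<close>

definition contains_isomorphic_copy ::
    "'w::real_vector set \<Rightarrow> ('w \<Rightarrow> real) \<Rightarrow> 'v::real_vector set \<Rightarrow> ('v \<Rightarrow> real) \<Rightarrow> bool"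
  where "contains_isomorphic_copy W NW V NV \<longleftrightarrow>
    (\<exists>T c C. linear_between V W T \<and> 0 < c \<and>
       (\<forall>x\<in>V. c * NV x \<le> NW (T x) \<and> NW (T x) \<le> C * NV x))"

definition l1 :: "(nat \<Rightarrow> real) set"
  where "l1 = {a. summable (\<lambda>n. \<bar>a n\<bar>)}"

definition l1_norm :: "(nat \<Rightarrow> real) \<Rightarrow> real"
  where "l1_norm a = (\<Sum>n. \<bar>a n\<bar>)"

definition rosenthal_space :: "'v::real_vector set \<Rightarrow> ('v \<Rightarrow> real) \<Rightarrow> bool"
  where "rosenthal_space V N \<longleftrightarrow>
    banach_on V N \<and> \<not> contains_isomorphic_copy V N l1 l1_norm"


section \<open>Weakly Radon-Nikodym compacta\<close>

text \<open>
  Functionals on \<open>V\<close> are represented by functions that are \<^const>\<open>undefined\<close> outside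
  \<open>V\<close>, as for the points of \<^const>\<open>product_topology\<close>.
\<close>

definition dual :: "'v::real_vector set \<Rightarrow> ('v \<Rightarrow> real) \<Rightarrow> ('v \<Rightarrow> real) set"
  where "dual V N =
    {u \<in> extensional V. linear_between V UNIV u \<and> (\<exists>C. \<forall>x\<in>V. \<bar>u x\<bar> \<le> C * N x)}"

definition weak_star :: "'v::real_vector set \<Rightarrow> ('v \<Rightarrow> real) \<Rightarrow> ('v \<Rightarrow> real) topology"
  where "weak_star V N = subtopology (powertop_real V) (dual V N)"

text \<open>
  The first argument fixes the type in which the Banach space lives.  For a compact Hausdorff
  space \<open>X :: 'a topology\<close> the type \<^typ>\<open>'a \<Rightarrow> real\<close> is large enough to realise every
  WRN representation: if \<open>X\<close> embeds in the dual of \<open>V\<close>, then it also embeds in the dual of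
  a closed subspace of \<open>V\<close> generated by at most \<open>|X|\<^sup>2\<close> vectors, and closed subspaces
  of Rosenthal spaces are Rosenthal.
\<close>

definition WRN_in :: "'v::real_vector itself \<Rightarrow> 'a topology \<Rightarrow> bool"
  where "WRN_in (_ :: 'v itself) X \<longleftrightarrow>
    (\<exists>(V :: 'v set) N K. rosenthal_space V N \<and> compactin (weak_star V N) K \<and>
       X homeomorphic_space subtopology (weak_star V N) K)"

abbreviation WRN :: "'a topology \<Rightarrow> bool"
  where "WRN X \<equiv> WRN_in TYPE('a \<Rightarrow> real) X"


section \<open>Rosenthal families\<close>

text \<open>
  Boundedness is stated separately because \<^const>\<open>diameter\<close> is a real-valued supremum,
  hence meaningless on unbounded sets.
\<close>

definition fragmented :: "'a topology \<Rightarrow> ('a \<Rightarrow> real) \<Rightarrow> bool"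
  where "fragmented X f \<longleftrightarrow>
    (\<forall>A e. A \<subseteq> topspace X \<and> A \<noteq> {} \<and> 0 < e \<longrightarrow>
       (\<exists>U. openin X U \<and> U \<inter> A \<noteq> {} \<and>
            bounded (f ` (U \<inter> A)) \<and> diameter (f ` (U \<inter> A)) \<le> e))"

definition fragmented_functions :: "'a topology \<Rightarrow> ('a \<Rightarrow> real) set"
  where "fragmented_functions X = {f \<in> extensional (topspace X). fragmented X f}"

definition C_space :: "'a topology \<Rightarrow> ('a \<Rightarrow> real) set"
  where "C_space X = {f \<in> extensional (topspace X). continuous_map X euclideanreal f}"

text \<open>\<open>M\<close> is a bound for the supremum norms of the members of \<open>F\<close>.\<close>

definition rosenthal_family :: "'a topology \<Rightarrow> ('a \<Rightarrow> real) set \<Rightarrow> bool"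
  where "rosenthal_family X F \<longleftrightarrow>
    F \<subseteq> C_space X \<and>
    (\<exists>M. \<forall>f\<in>F. \<forall>x\<in>topspace X. \<bar>f x\<bar> \<le> M) \<and>
    powertop_real (topspace X) closure_of F \<subseteq> fragmented_functions X"

definition separates_points :: "'a topology \<Rightarrow> ('a \<Rightarrow> real) set \<Rightarrow> bool"
  where "separates_points X F \<longleftrightarrow>
    (\<forall>x\<in>topspace X. \<forall>y\<in>topspace X. x \<noteq> y \<longrightarrow> (\<exists>f\<in>F. f x \<noteq> f y))"

end

theory Submission
  imports Defs "HOL-Library.Diagonal_Subsequence"
begin

text \<open>
  Both implications turn on \<^emph>\<open>independent\<close> sequences: functions \<open>f\<^sub>0, f\<^sub>1, \<dots>\<close> and
  thresholds \<open>a < b\<close> for which every finite pattern of conditions \<open>f\<^sub>k x < a\<close> or \<open>b < f\<^sub>k x\<close> is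
  realised by a point.  A non-fragmented pointwise limit of a bounded family of continuous functions
  produces an independent sequence inside the family (\<open>not_fragmented_imp_independent\<close>).
  Conversely, on a compact space an independent sequence of continuous functions has a
  non-fragmented cluster point (\<open>independent_imp_not_fragmented\<close>).  Moreover an independent sequence
  satisfies a lower \<open>l1\<close> estimate for the supremum norm (\<open>independent_lower_estimate\<close>).

  From a representation to a family.  Let \<open>X\<close> be a weak-star compact subset of the dual of \<open>V\<close>.  The
  unit ball of \<open>V\<close>, acting on \<open>X\<close> by evaluation, separates points, and by the principle of uniform
  boundedness it is a bounded family.  If a pointwise limit of evaluations were not fragmented, the
  unit ball would contain a sequence that is independent on \<open>X\<close>.  Its lower estimate in the supremum
  norm passes to the norm of \<open>V\<close>, again because \<open>X\<close> is norm bounded, so \<open>V\<close> would contain \<open>l1\<close>.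

  From a family to a representation.  The Banach space is obtained from the family \<open>F\<close> by a variant
  of the interpolation method of Davis, Figiel, Johnson and Pelczynski, with a \<open>c\<^sub>0\<close>-sum in place of
  the \<open>l\<^sub>2\<close>-sum: with the seminorms
  \<open>p\<^sub>n v = inf {s / 2\<^sup>n + 2\<^sup>n \<parallel>v - w\<parallel>}\<close>, where \<open>w\<close> runs over the linear combinations of members
  of \<open>F\<close> whose coefficients have moduli adding up to \<open>s\<close>, let \<open>V\<close> consist of the continuous \<open>v\<close> with \<open>p\<^sub>n v \<rightarrow> 0\<close>,
  normed by \<open>sup\<^sub>n p\<^sub>n v\<close>.  Then \<open>F\<close> lies in \<open>V\<close>, point evaluations are bounded on \<open>V\<close>, and they
  embed \<open>X\<close> in the dual of \<open>V\<close>.  Suppose \<open>V\<close> contained \<open>l1\<close>.  If the supremum norm were not bounded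
  below on any tail of the unit vectors, there would be normalised blocks that are tiny in the
  supremum norm, and a gliding hump would make their sums bounded, as in \<open>c\<^sub>0\<close>
  (\<open>l1_in_null_space_imp_l1_in_base\<close>).  Hence \<open>V\<close> would contain a bounded sequence that is an
  \<open>l1\<close> sequence for the supremum norm, and approximation gives such a sequence
  consisting of combinations of \<open>F\<close> with bounded sums of moduli.

  It remains to refute the latter (\<open>no_l1_sequence_of_combinations\<close>).  This says that absolutely
  convex hulls do not create \<open>l1\<close> sequences, and it uses a mean, that is, a positive normalised
  linear functional.  An \<open>l1\<close> sequence \<open>w\<^sub>k\<close> admits a mean \<open>I\<close> for which the distances
  \<open>I \<bar>w\<^sub>k - w\<^sub>l\<bar>\<close> are bounded away from \<open>0\<close> (\<open>mean_separating_l1_sequence\<close>).  On the other hand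
  \<open>F\<close> is totally bounded for the distance \<open>I \<bar>f - g\<bar>\<close>, and therefore so is the set of these combinations, a contradiction.  Total boundedness holds since every sequence in
  \<open>F\<close> has a subsequence whose consecutive differences are eventually small at each point; otherwise
  Rosenthal's dichotomy (\<open>rosenthal_dichotomy\<close>) would supply an independent sequence in \<open>F\<close>.
  A bounded convergence theorem for means (\<open>mean_frequently_large\<close>) turns this pointwise smallness
  into smallness of some \<open>I \<bar>f\<^sub>k - f\<^sub>l\<bar>\<close>.
\<close>

section \<open>Banach spaces and copies of \<open>l1\<close>\<close>

lemma linear_betweenD:
  assumes "linear_between V W T"
  shows "x \<in> V \<Longrightarrow> y \<in> V \<Longrightarrow> T (x + y) = T x + T y"
    and "x \<in> V \<Longrightarrow> T (c *\<^sub>R x) = c *\<^sub>R T x"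
    and "x \<in> V \<Longrightarrow> T x \<in> W"
  using assms by (auto simp: linear_between_def)

lemma linear_between_diff:
  assumes "linear_between V W T" "subspace V" "x \<in> V" "y \<in> V"
  shows "T (x - y) = T x - T y"
proof -
  have "T (x + (-1) *\<^sub>R y) = T x + (-1) *\<^sub>R T y"
    using assms by (metis linear_betweenD(1,2) subspace_scale)
  then show ?thesis by simp
qed

lemma linear_between_sum:
  assumes "linear_between V W T" "subspace V" "finite A" "\<And>i. i \<in> A \<Longrightarrow> v i \<in> V"
  shows "T (\<Sum>i\<in>A. c i *\<^sub>R v i) = (\<Sum>i\<in>A. c i *\<^sub>R T (v i))"
  using assms(3,4)
proof (induction A rule: finite_induct)
  case empty
  have "T (0 *\<^sub>R 0) = 0 *\<^sub>R T 0"
    by (rule linear_betweenD(2)[OF assms(1)]) (simp add: assms(2) subspace_0)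
  then show ?case by simp
next
  case (insert i A)
  have "T (c i *\<^sub>R v i + (\<Sum>i\<in>A. c i *\<^sub>R v i)) = T (c i *\<^sub>R v i) + T (\<Sum>i\<in>A. c i *\<^sub>R v i)"
    by (rule linear_betweenD(1)[OF assms(1)])
      (use insert assms(2) in \<open>auto intro!: subspace_sum subspace_scale\<close>)
  then show ?case using insert linear_betweenD(2)[OF assms(1)] by simp
qed

lemma homogeneous_if_subhomogeneous:
  fixes q :: "'v::real_vector \<Rightarrow> real"
  assumes S: "subspace S" and x: "x \<in> S" and zero: "q 0 = 0"
    and le: "\<And>c x. x \<in> S \<Longrightarrow> c \<noteq> 0 \<Longrightarrow> q (c *\<^sub>R x) \<le> \<bar>c\<bar> * q x"
  shows "q (c *\<^sub>R x) = \<bar>c\<bar> * q x"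
proof (cases "c = 0")
  case False
  have "q (inverse c *\<^sub>R c *\<^sub>R x) \<le> \<bar>inverse c\<bar> * q (c *\<^sub>R x)"
    by (rule le[OF subspace_scale[OF S x]]) (use False in simp)
  then have "\<bar>c\<bar> * q x \<le> q (c *\<^sub>R x)" using False by (simp add: field_simps)
  then show ?thesis using le[OF x False] by simp
qed (simp add: zero)

lemma tendsto_0_if_uniformly_small:
  fixes q :: "nat \<Rightarrow> real"
  assumes "\<And>n. 0 \<le> q n" and "\<And>e. 0 < e \<Longrightarrow> \<exists>k. \<forall>m\<ge>k. q m \<le> e"
  shows "q \<longlonglongrightarrow> 0"
proof (rule LIMSEQ_I)
  fix e :: real assume "0 < e"
  then obtain k where "\<forall>m\<ge>k. q m \<le> e / 2" using assms(2)[of "e / 2"] by auto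
  then show "\<exists>k. \<forall>m\<ge>k. norm (q m - 0) < e" using assms(1) \<open>0 < e\<close> by (intro exI[of _ k]) fastforce
qed

lemma subspace_l1: "subspace l1"
  unfolding subspace_def
proof (intro conjI ballI allI)
  show "0 \<in> l1" by (simp add: l1_def)
  show "x + y \<in> l1" if "x \<in> l1" "y \<in> l1" for x y
    using summable_add[of "\<lambda>n. \<bar>x n\<bar>" "\<lambda>n. \<bar>y n\<bar>"] that unfolding l1_def
    by (auto intro: summable_comparison_test'[where N=0])
  show "r *\<^sub>R x \<in> l1" if "x \<in> l1" for r x
    using that unfolding l1_def by (simp add: scaleR_fun_def abs_mult summable_mult)
qed

context banach_on
begin

lemma norm_0: "N 0 = 0"
  using norm_eq_0 subspace subspace_0 by blast

lemma norm_minus: "x \<in> V \<Longrightarrow> N (- x) = N x"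
  using norm_scaleR[of x "-1"] by simp

lemma norm_diff_commute: "x \<in> V \<Longrightarrow> y \<in> V \<Longrightarrow> N (x - y) = N (y - x)"
  using norm_minus[of "x - y"] subspace subspace_diff by fastforce

lemma norm_triangle_sub: "x \<in> V \<Longrightarrow> y \<in> V \<Longrightarrow> N x \<le> N y + N (x - y)"
  using norm_triangle[of y "x - y"] subspace subspace_diff by fastforce

lemma norm_triangle_ineq3: "x \<in> V \<Longrightarrow> y \<in> V \<Longrightarrow> \<bar>N x - N y\<bar> \<le> N (x - y)"
  using norm_triangle_sub[of x y] norm_triangle_sub[of y x] norm_diff_commute[of x y] by linarith

lemma norm_sum_le:
  assumes "\<And>i. i \<in> A \<Longrightarrow> v i \<in> V"
  shows "N (\<Sum>i\<in>A. v i) \<le> (\<Sum>i\<in>A. N (v i))"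
  using assms
proof (induction A rule: infinite_finite_induct)
  case (insert i A)
  then show ?case
    using norm_triangle[of "v i" "\<Sum>i\<in>A. v i"] subspace_sum[OF subspace, of A v] by fastforce
qed (simp_all add: norm_0)

lemma limit_unique:
  assumes "\<And>n. s n \<in> V" "l \<in> V" "l' \<in> V"
    and "(\<lambda>n. N (s n - l)) \<longlonglongrightarrow> 0" "(\<lambda>n. N (s n - l')) \<longlonglongrightarrow> 0"
  shows "l = l'"
proof -
  have "N (l - l') \<le> N (s n - l) + N (s n - l')" for n
    using norm_triangle[of "l - s n" "s n - l'"] norm_diff_commute[of l "s n"] assms(1-3)
      subspace_diff[OF subspace] by simp
  moreover have "(\<lambda>n. N (s n - l) + N (s n - l')) \<longlonglongrightarrow> 0"
    using tendsto_add[OF assms(4,5)] by simp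
  ultimately have "N (l - l') \<le> 0"
    by (meson LIMSEQ_le_const)
  moreover have "l - l' \<in> V" using assms subspace_diff[OF subspace] by blast
  ultimately have "l - l' = 0" using norm_nonneg norm_eq_0 by (metis order_antisym)
  then show ?thesis by simp
qed

lemma norm_tendsto:
  assumes "\<And>n. s n \<in> V" "l \<in> V" "(\<lambda>n. N (s n - l)) \<longlonglongrightarrow> 0"
  shows "(\<lambda>n. N (s n)) \<longlonglongrightarrow> N l"
proof -
  have "(\<lambda>n. N (s n) - N l) \<longlonglongrightarrow> 0"
    by (rule Lim_null_comparison[OF _ assms(3)])
      (use norm_triangle_ineq3[OF assms(1,2)] in auto)
  then show ?thesis by (simp add: LIM_zero_iff)
qed

lemma series_convergent:
  assumes "\<And>k. v k \<in> V" "summable (\<lambda>k. N (v k))"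
  shows "\<exists>l\<in>V. (\<lambda>n. N ((\<Sum>k<n. v k) - l)) \<longlonglongrightarrow> 0"
proof (rule complete)
  show "\<forall>n. (\<Sum>k<n. v k) \<in> V" by (auto intro!: subspace_sum subspace assms)
  have diff: "N ((\<Sum>k<m. v k) - (\<Sum>k<n. v k)) \<le> \<bar>(\<Sum>k<m. N (v k)) - (\<Sum>k<n. N (v k))\<bar>" for m n
  proof -
    have *: "N ((\<Sum>k<m. v k) - (\<Sum>k<n. v k)) \<le> \<bar>(\<Sum>k<m. N (v k)) - (\<Sum>k<n. N (v k))\<bar>"
      if "n \<le> m" for m n
    proof -
      have e: "sum g {..<m} - sum g {..<n} = sum g {n..<m}" for g :: "nat \<Rightarrow> 'z::ab_group_add"
        using sum_diff_nat_ivl[of 0 n m g] that by (simp add: atLeast0LessThan)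
      show ?thesis unfolding e
        using norm_sum_le[of "{n..<m}" v] assms(1) by fastforce
    qed
    show ?thesis
    proof (cases "n \<le> m")
      case False
      then show ?thesis using *[of m n]
        by (subst norm_diff_commute) (auto intro!: subspace_sum subspace assms)
    qed (rule *)
  qed
  have "Cauchy (\<lambda>n. \<Sum>k<n. N (v k))"
    using assms(2) summable_iff_convergent LIMSEQ_imp_Cauchy convergent_def by blast
  then show "\<forall>e>0. \<exists>k. \<forall>m\<ge>k. \<forall>n\<ge>k. N ((\<Sum>k<m. v k) - (\<Sum>k<n. v k)) < e"
    unfolding Cauchy_def dist_real_def using diff by (meson le_less_trans)
qed

text \<open>
  The copy of \<open>l1\<close> is \<open>a \<mapsto> \<Sum> a\<^sub>k v\<^sub>k\<close>.  The series converges absolutely because the \<open>v\<^sub>k\<close> are bounded,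
  and the lower estimate for finite sums passes to the limit.
\<close>

lemma contains_l1_if_lower_estimate:
  fixes v :: "nat \<Rightarrow> 'v"
  assumes v: "\<And>k. v k \<in> V" "\<And>k. N (v k) \<le> B" and "0 < c"
    and low: "\<And>n a. c * (\<Sum>k<n. \<bar>a k\<bar>) \<le> N (\<Sum>k<n. a k *\<^sub>R v k)"
  shows "contains_isomorphic_copy V N l1 l1_norm"
proof -
  define S where "S a n = (\<Sum>k<n. a k *\<^sub>R v k)" for a :: "nat \<Rightarrow> real" and n
  have SV: "S a n \<in> V" for a n unfolding S_def by (auto intro!: subspace_sum subspace_scale subspace v)
  have up: "N (S a n) \<le> B * (\<Sum>k<n. \<bar>a k\<bar>)" for a n
  proof -
    have "N (S a n) \<le> (\<Sum>k<n. N (a k *\<^sub>R v k))" unfolding S_def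
      by (auto intro!: norm_sum_le subspace_scale subspace v)
    also have "\<dots> \<le> (\<Sum>k<n. B * \<bar>a k\<bar>)"
      using v by (intro sum_mono) (simp add: norm_scaleR mult.commute[of B] mult_left_mono)
    finally show ?thesis by (simp add: sum_distrib_left)
  qed
  have ex: "\<exists>l. l \<in> V \<and> (\<lambda>n. N (S a n - l)) \<longlonglongrightarrow> 0" if "a \<in> l1" for a
  proof -
    have "summable (\<lambda>k. B * \<bar>a k\<bar>)" using that by (simp add: l1_def summable_mult)
    then have "summable (\<lambda>k. N (a k *\<^sub>R v k))"
      by (rule summable_comparison_test'[of _ 0])
        (use v norm_nonneg in \<open>simp add: norm_scaleR mult.commute[of B] mult_left_mono\<close>)
    from series_convergent[OF _ this] show ?thesis
      unfolding S_def using subspace_scale[OF subspace v(1)] by blast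
  qed
  define T where "T a = (SOME l. l \<in> V \<and> (\<lambda>n. N (S a n - l)) \<longlonglongrightarrow> 0)" for a
  have TV: "T a \<in> V" and Tlim: "(\<lambda>n. N (S a n - T a)) \<longlonglongrightarrow> 0" if "a \<in> l1" for a
    using someI_ex[OF ex[OF that]] unfolding T_def by blast+
  have Teq: "T a = l" if "a \<in> l1" "l \<in> V" "(\<lambda>n. N (S a n - l)) \<longlonglongrightarrow> 0" for a l
    using limit_unique[OF SV TV[OF that(1)] that(2) Tlim[OF that(1)] that(3)] .
  note add_l1 = subspace_add[OF subspace_l1] and scale_l1 = subspace_scale[OF subspace_l1]
  have "linear_between l1 V T"
    unfolding linear_between_def
  proof (intro conjI ballI allI)
    show "T ` l1 \<subseteq> V" using TV by blast
    show "T (x + y) = T x + T y" if xy: "x \<in> l1" "y \<in> l1" for x y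
    proof (rule Teq[OF add_l1[OF xy] subspace_add[OF subspace TV TV]])
      have e: "S (x + y) n - (T x + T y) = (S x n - T x) + (S y n - T y)" for n
        by (simp add: S_def scaleR_left_distrib sum.distrib)
      have lim: "(\<lambda>n. N (S x n - T x) + N (S y n - T y)) \<longlonglongrightarrow> 0"
        using tendsto_add[OF Tlim Tlim] xy by fastforce
      show "(\<lambda>n. N (S (x + y) n - (T x + T y))) \<longlonglongrightarrow> 0"
        by (rule Lim_null_comparison[OF _ lim])
          (use xy SV TV norm_triangle norm_nonneg subspace_diff[OF subspace] subspace_add[OF subspace]
            in \<open>simp add: e\<close>)
    qed (use xy in auto)
    show "T (r *\<^sub>R x) = r *\<^sub>R T x" if x: "x \<in> l1" for x r
    proof (rule Teq[OF scale_l1[OF x] subspace_scale[OF subspace TV[OF x]]])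
      have "S (r *\<^sub>R x) n - r *\<^sub>R T x = r *\<^sub>R (S x n - T x)" for n
        by (simp add: S_def scaleR_fun_def scaleR_sum_right scaleR_diff_right)
      then show "(\<lambda>n. N (S (r *\<^sub>R x) n - r *\<^sub>R T x)) \<longlonglongrightarrow> 0"
        using tendsto_mult_right_zero[OF Tlim[OF x], of "\<bar>r\<bar>"] SV TV x norm_scaleR
          subspace_diff[OF subspace] by simp
    qed
  qed
  moreover have "c * l1_norm a \<le> N (T a) \<and> N (T a) \<le> B * l1_norm a" if a: "a \<in> l1" for a
  proof -
    have s: "(\<lambda>n. \<Sum>k<n. \<bar>a k\<bar>) \<longlonglongrightarrow> l1_norm a"
      using a unfolding l1_def l1_norm_def by (simp add: summable_LIMSEQ)
    have t: "(\<lambda>n. N (S a n)) \<longlonglongrightarrow> N (T a)"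
      by (rule norm_tendsto[OF SV TV[OF a] Tlim[OF a]])
    show ?thesis
      using LIMSEQ_le[OF tendsto_mult_left[OF s, of c] t] LIMSEQ_le[OF t tendsto_mult_left[OF s, of B]]
        low up unfolding S_def by blast
  qed
  ultimately show ?thesis unfolding contains_isomorphic_copy_def using \<open>0 < c\<close> by blast
qed

text \<open>
  A gliding hump argument due to Sokal:
  a functional of norm \<open>\<nu>\<close> takes values of modulus almost \<open>r \<nu>\<close> in each ball of radius \<open>r\<close>, since
  one of \<open>x + z\<close> and \<open>x - z\<close> is at least as good as \<open>z\<close>.  If the norms are unbounded, a
  Cauchy sequence built from such points has a limit at which the functionals are unbounded.
\<close>

lemma uniform_boundedness:
  assumes dual: "K \<subseteq> dual V N" and bdd: "\<And>v. v \<in> V \<Longrightarrow> \<exists>B. \<forall>u\<in>K. \<bar>u v\<bar> \<le> B"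
  shows "\<exists>C. \<forall>u\<in>K. \<forall>v\<in>V. \<bar>u v\<bar> \<le> C * N v"
proof -
  define nm where "nm u = (SUP v\<in>{v\<in>V. N v \<le> 1}. \<bar>u v\<bar>)" for u :: "'v \<Rightarrow> real"
  have ne: "{v\<in>V. N v \<le> 1} \<noteq> {}" using subspace subspace_0 norm_0 by force
  have lin: "linear_between V UNIV u" if "u \<in> K" for u using dual that by (auto simp: dual_def)
  have ba: "bdd_above ((\<lambda>v. \<bar>u v\<bar>) ` {v\<in>V. N v \<le> 1})" if u: "u \<in> K" for u
  proof -
    obtain C where C: "\<forall>x\<in>V. \<bar>u x\<bar> \<le> C * N x" using dual u by (auto simp: dual_def)
    have "\<bar>u v\<bar> \<le> \<bar>C\<bar>" if "v \<in> V" "N v \<le> 1" for v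
    proof -
      have "C * N v \<le> \<bar>C\<bar> * 1" using that norm_nonneg by (intro mult_mono) auto
      then show ?thesis using C that by force
    qed
    then show ?thesis by (auto intro!: bdd_aboveI2)
  qed
  have nm_bound: "\<bar>u v\<bar> \<le> nm u * N v" if u: "u \<in> K" and v: "v \<in> V" for u v
  proof (cases "v = 0")
    case True
    then show ?thesis using linear_between_diff[OF lin[OF u] subspace v v] norm_0 by simp
  next
    case False
    then have pos: "N v > 0" using v norm_nonneg norm_eq_0 by (metis less_eq_real_def)
    define w where "w = inverse (N v) *\<^sub>R v"
    have w: "w \<in> V" "N w \<le> 1" using v pos subspace_scale[OF subspace] by (auto simp: w_def norm_scaleR)
    have "\<bar>u w\<bar> \<le> nm u" unfolding nm_def by (rule cSUP_upper[OF _ ba[OF u]]) (use w in auto)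
    moreover have "\<bar>u w\<bar> = \<bar>u v\<bar> / N v"
      using linear_betweenD(2)[OF lin[OF u] v] pos by (simp add: w_def abs_mult divide_inverse)
    ultimately show ?thesis using pos by (simp add: divide_simps)
  qed
  have "\<exists>B. \<forall>u\<in>K. nm u \<le> B"
  proof (rule ccontr)
    assume "\<not> ?thesis"
    then have "\<forall>n. \<exists>u\<in>K. nm u > 4 ^ n" by (meson not_le)
    then obtain u where u: "\<And>n::nat. u n \<in> K" "\<And>n. nm (u n) > 4 ^ n" by metis
    have step: "\<exists>y. y \<in> V \<and> N (y - x) \<le> (1/3)^n \<and> \<bar>u n y\<bar> \<ge> 2/3 * (1/3)^n * nm (u n)"
      if x: "x \<in> V" for n x
    proof -
      have p: "nm (u n) > 0" using u(2)[of n] by (meson less_trans zero_less_power zero_less_numeral)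
      then have "2/3 * nm (u n) < nm (u n)" by simp
      then obtain z where z: "z \<in> V" "N z \<le> 1" "2/3 * nm (u n) < \<bar>u n z\<bar>"
        unfolding nm_def using less_cSUP_iff[OF ne ba[OF u(1)[of n]]] by auto
      define z' where "z' = (1/3)^n *\<^sub>R z"
      have z': "z' \<in> V" using z subspace_scale[OF subspace] by (simp add: z'_def)
      have Nz': "N z' \<le> (1/3)^n" using z by (simp add: z'_def norm_scaleR mult_left_le)
      have uz': "\<bar>u n z'\<bar> \<ge> 2/3 * (1/3)^n * nm (u n)"
      proof -
        have "(1/3)^n * (2/3 * nm (u n)) \<le> (1/3)^n * \<bar>u n z\<bar>" using z(3) by (intro mult_left_mono) auto
        then show ?thesis
          using linear_betweenD(2)[OF lin[OF u(1)[of n]] z(1)] by (simp add: z'_def abs_mult algebra_simps)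
      qed
      have "u n (x + z') = u n x + u n z'" "u n (x - z') = u n x - u n z'"
        using linear_betweenD(1)[OF lin[OF u(1)[of n]] x z'] linear_between_diff[OF lin[OF u(1)[of n]] subspace x z']
        by auto
      then have "\<bar>u n (x + z')\<bar> \<ge> \<bar>u n z'\<bar> \<or> \<bar>u n (x - z')\<bar> \<ge> \<bar>u n z'\<bar>" by linarith
      then show ?thesis
      proof
        assume "\<bar>u n (x + z')\<bar> \<ge> \<bar>u n z'\<bar>"
        then show ?thesis using uz' Nz' x z' subspace_add[OF subspace] by (intro exI[of _ "x + z'"]) auto
      next
        assume "\<bar>u n (x - z')\<bar> \<ge> \<bar>u n z'\<bar>"
        then show ?thesis using uz' Nz' x z' subspace_diff[OF subspace] norm_minus[OF z']
          by (intro exI[of _ "x - z'"]) auto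
      qed
    qed
    obtain x where x0: "\<And>n. x n \<in> V"
      and x1: "\<And>n. N (x (Suc n) - x n) \<le> (1/3)^n \<and> \<bar>u n (x (Suc n))\<bar> \<ge> 2/3 * (1/3)^n * nm (u n)"
      using dependent_nat_choice[of "\<lambda>_ x. x \<in> V" "\<lambda>n x y. N (y - x) \<le> (1/3)^n \<and> \<bar>u n y\<bar> \<ge> 2/3 * (1/3)^n * nm (u n)"]
        step subspace_0[OF subspace] by metis
    have far: "N (x (n + m) - x n) \<le> 3/2 * (1/3)^n" for n m
    proof -
      have "N (x (n + m) - x n) \<le> 3/2 * (1/3)^n * (1 - (1/3)^m)"
      proof (induction m)
        case (Suc m)
        have "N (x (n + Suc m) - x n) \<le> N (x (Suc (n + m)) - x (n + m)) + N (x (n + m) - x n)"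
          using norm_triangle[of "x (Suc (n + m)) - x (n + m)" "x (n + m) - x n"] x0 subspace_diff[OF subspace] by simp
        also have "\<dots> \<le> (1/3)^(n+m) + 3/2 * (1/3)^n * (1 - (1/3)^m)"
          using x1[of "n+m"] Suc by linarith
        also have "\<dots> = 3/2 * (1/3)^n * (1 - (1/3)^Suc m)" by (simp add: power_add field_simps)
        finally show ?case .
      qed (simp add: norm_0)
      also have "\<dots> \<le> 3/2 * (1/3)^n" by (simp add: mult_left_le)
      finally show ?thesis .
    qed
    have "summable (\<lambda>n. N (x (Suc n) - x n))"
      by (rule summable_comparison_test'[OF summable_geometric[of "1/3 :: real"], of 0])
        (use x0 x1 norm_nonneg subspace_diff[OF subspace] in auto)
    then obtain d where d: "d \<in> V" "(\<lambda>n. N ((\<Sum>k<n. x (Suc k) - x k) - d)) \<longlonglongrightarrow> 0"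
      using series_convergent[of "\<lambda>n. x (Suc n) - x n"] x0 subspace_diff[OF subspace] by blast
    define l where "l = x 0 + d"
    have l: "l \<in> V" "(\<lambda>n. N (x n - l)) \<longlonglongrightarrow> 0"
      using d x0 subspace_add[OF subspace] by (auto simp: l_def sum_lessThan_telescope algebra_simps)
    have close: "N (x n - l) \<le> 3/2 * (1/3)^n" for n
    proof (rule LIMSEQ_le_const)
      show "(\<lambda>m. 3/2 * (1/3)^n + N (x m - l)) \<longlonglongrightarrow> 3/2 * (1/3)^n" using tendsto_add[OF tendsto_const l(2)] by simp
      have "N (x n - l) \<le> 3/2 * (1/3)^n + N (x m - l)" if "m \<ge> n" for m
        using norm_triangle[of "x n - x m" "x m - l"] far[of n "m - n"] that x0 l(1) subspace_diff[OF subspace]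
          norm_diff_commute[of "x n" "x m"] by simp
      then show "\<exists>k. \<forall>m\<ge>k. N (x n - l) \<le> 3/2 * (1/3)^n + N (x m - l)" by blast
    qed
    \<comment> \<open>The norms grow like \<open>4\<^sup>n\<close> while the radii shrink only like \<open>3\<^bsup>-n\<^esup>\<close>; the constant \<open>1/6\<close> is
        \<open>2/3\<close>, gained at the step, minus \<open>1/2\<close>, lost in all later steps.\<close>
    have big: "\<bar>u n l\<bar> \<ge> (4/3)^n / 6" for n
    proof -
      have "u n (x (Suc n) - l) = u n (x (Suc n)) - u n l"
        using linear_between_diff[OF lin[OF u(1)[of n]] subspace x0 l(1)] .
      moreover have "\<bar>u n (x (Suc n) - l)\<bar> \<le> nm (u n) * (1/2 * (1/3)^n)"
      proof -
        have "\<bar>u n (x (Suc n) - l)\<bar> \<le> nm (u n) * N (x (Suc n) - l)"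
          by (rule nm_bound[OF u(1)]) (use x0 l subspace_diff[OF subspace] in blast)
        also have "\<dots> \<le> nm (u n) * (1/2 * (1/3)^n)"
          using close[of "Suc n"] less_trans[OF zero_less_power u(2)[of n]] by (intro mult_left_mono) auto
        finally show ?thesis .
      qed
      moreover define q where "q = (1/3)^n * nm (u n)"
      moreover have "\<bar>u n (x (Suc n))\<bar> \<ge> 2/3 * q" using x1[of n] by (simp add: q_def mult.assoc)
      ultimately have "\<bar>u n l\<bar> \<ge> 1/6 * q"
        using abs_triangle_ineq2[of "u n (x (Suc n))" "u n (x (Suc n)) - u n l"] by (simp add: q_def mult.commute)
      then have "\<bar>u n l\<bar> \<ge> 1/6 * (1/3)^n * nm (u n)" by (simp add: q_def algebra_simps)
      moreover have "(1/3)^n * 4^n \<le> (1/3)^n * nm (u n)" using u(2)[of n] by (intro mult_left_mono) auto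
      moreover have "(1/3)^n * 4^n = (4/3::real)^n" by (simp add: power_mult_distrib[symmetric])
      ultimately show ?thesis by simp
    qed
    obtain B where B: "\<forall>u\<in>K. \<bar>u l\<bar> \<le> B" using bdd[OF l(1)] by blast
    obtain n where "6 * B < (4/3)^n" using real_arch_pow[of "4/3" "6*B"] by auto
    then show False using big[of n] B u(1)[of n] by fastforce
  qed
  then obtain B where B: "\<forall>u\<in>K. nm u \<le> B" by blast
  have "\<bar>u v\<bar> \<le> B * N v" if "u \<in> K" "v \<in> V" for u v
    using nm_bound[OF that] mult_right_mono[OF B[rule_format, OF that(1)] norm_nonneg[OF that(2)]] by linarith
  then show ?thesis by blast
qed

end

section \<open>Independent sequences and fragmented limits\<close>

lemma sequence_by_extension:
  assumes "Q []" and "\<And>xs. Q xs \<Longrightarrow> \<exists>x. Q (xs @ [x])"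
  shows "\<exists>g. \<forall>n. Q (map g [0..<n])"
proof -
  obtain L where L: "\<And>n. Q (L n) \<and> length (L n) = n" "\<And>n. \<exists>x. L (Suc n) = L n @ [x]"
    using dependent_nat_choice[of "\<lambda>n xs. Q xs \<and> length xs = n" "\<lambda>n xs ys. \<exists>x. ys = xs @ [x]"] assms
    by (metis length_append_singleton list.size(3))
  have "L n = map (\<lambda>k. last (L (Suc k))) [0..<n]" for n
  proof (induction n)
    case (Suc n)
    then show ?case using L(2)[of n] by auto
  qed (use L(1)[of 0] in simp)
  then show ?thesis using L(1) by metis
qed

text \<open>
  A grid of mesh \<open>e / 3\<close> on \<open>[-M, M]\<close>: this reduces statements about oscillation to finitely many
  pairs of thresholds.
\<close>

lemma oscillation_thresholds:
  fixes M e :: real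
  assumes "0 < e"
  shows "\<exists>G :: (real \<times> real) set. finite G \<and> (\<forall>(a, b)\<in>G. a < b) \<and>
    (\<forall>u v. \<bar>u\<bar> \<le> M \<longrightarrow> \<bar>v\<bar> \<le> M \<longrightarrow> u + e < v \<longrightarrow> (\<exists>(a, b)\<in>G. u < a \<and> b < v))"
proof -
  define d where "d = e / 3"
  have d: "d > 0" using assms by (simp add: d_def)
  define p where "p i = (- M + real i * d, - M + real i * d + d)" for i
  define m where "m = Suc (nat \<lceil>2 * M / d\<rceil>)"
  have "\<exists>(a, b)\<in>p ` {..m}. u < a \<and> b < v" if u: "\<bar>u\<bar> \<le> M" and v: "\<bar>v\<bar> \<le> M" "u + e < v" for u v
  proof -
    define i where "i = Suc (nat \<lfloor>(u + M) / d\<rfloor>)"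
    have nn: "0 \<le> (u + M) / d" using u d by simp
    have "(u + M) / d \<le> 2 * M / d" using u d by (intro divide_right_mono) auto
    then have im: "i \<le> m" unfolding i_def m_def
      by (simp add: nat_mono floor_le_ceiling order_trans[OF floor_le_ceiling ceiling_mono])
    have r: "real i = of_int \<lfloor>(u + M) / d\<rfloor> + 1" using nn by (simp add: i_def)
    have "(u + M) / d < real i" "real i \<le> (u + M) / d + 1" unfolding r by linarith+
    then have "u + M < real i * d" "real i * d \<le> u + M + d" using d by (simp_all add: field_simps)
    then have "u < - M + real i * d \<and> - M + real i * d + d < v" using v d_def assms by auto
    then show ?thesis using im unfolding p_def by force
  qed
  then show ?thesis using d by (intro exI[of _ "p ` {..m}"]) (auto simp: p_def)
qed

text \<open>
  The set \<open>t\<close> encodes a pattern of \<open>0\<close> and \<open>1\<close>, of which only the part below \<open>n\<close> matters.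
\<close>

definition independent_on :: "'a set \<Rightarrow> (nat \<Rightarrow> 'a \<Rightarrow> real) \<Rightarrow> real \<Rightarrow> real \<Rightarrow> bool"
  where "independent_on T g a b \<longleftrightarrow>
    (\<forall>n t. \<exists>x\<in>T. \<forall>k<n. if k \<in> t then g k x < a else b < g k x)"

definition pattern_cell :: "('i \<Rightarrow> 'a \<Rightarrow> real) \<Rightarrow> real \<Rightarrow> real \<Rightarrow> 'i list \<Rightarrow> nat set \<Rightarrow> 'a set"
  where "pattern_cell val a b xs t =
    {y. \<forall>k<length xs. if k \<in> t then val (xs ! k) y < a else b < val (xs ! k) y}"

lemma pattern_cell_initial_part:
  "pattern_cell val a b xs (t \<inter> {..<length xs}) = pattern_cell val a b xs t"
  by (auto simp: pattern_cell_def)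

text \<open>
  Independent sequences are built one term at a time: it suffices that, whenever all cells of the
  terms chosen so far meet \<open>A\<close>, one further term splits all of them within \<open>A\<close>.  The predicate \<open>P\<close>
  carries side conditions on the chosen indices.
\<close>

lemma independent_selection:
  fixes val :: "'i \<Rightarrow> 'a \<Rightarrow> real"
  assumes A: "A \<subseteq> T" "A \<noteq> {}" and P: "P []"
    and step: "\<And>xs. P xs \<Longrightarrow> (\<And>t. A \<inter> pattern_cell val a b xs t \<noteq> {}) \<Longrightarrow>
      \<exists>x. P (xs @ [x]) \<and> (\<forall>t. (\<exists>y\<in>A \<inter> pattern_cell val a b xs t. val x y < a) \<and>
        (\<exists>y\<in>A \<inter> pattern_cell val a b xs t. b < val x y))"
  shows "\<exists>g. (\<forall>n. P (map g [0..<n])) \<and> independent_on T (\<lambda>k. val (g k)) a b"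
proof -
  define Q where "Q xs \<longleftrightarrow> P xs \<and> (\<forall>t. A \<inter> pattern_cell val a b xs t \<noteq> {})" for xs
  have "\<exists>x. Q (xs @ [x])" if Q: "Q xs" for xs
  proof -
    have "\<exists>x. P (xs @ [x]) \<and> (\<forall>t. (\<exists>y\<in>A \<inter> pattern_cell val a b xs t. val x y < a) \<and>
        (\<exists>y\<in>A \<inter> pattern_cell val a b xs t. b < val x y))"
      by (rule step) (use Q in \<open>auto simp: Q_def\<close>)
    then obtain x where x: "P (xs @ [x])"
      and split: "\<And>t. \<exists>y\<in>A \<inter> pattern_cell val a b xs t. val x y < a"
        "\<And>t. \<exists>y\<in>A \<inter> pattern_cell val a b xs t. b < val x y" by blast
    have "A \<inter> pattern_cell val a b (xs @ [x]) t \<noteq> {}" for t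
    proof -
      obtain y where "y \<in> A \<inter> pattern_cell val a b xs t" "if length xs \<in> t then val x y < a else b < val x y"
        using split(1)[of t] split(2)[of t] by (cases "length xs \<in> t") auto
      then have "y \<in> A \<inter> pattern_cell val a b (xs @ [x]) t"
        by (auto simp: pattern_cell_def less_Suc_eq nth_append)
      then show ?thesis by blast
    qed
    then show ?thesis using x unfolding Q_def by blast
  qed
  moreover have "Q []" using A P by (simp add: Q_def pattern_cell_def)
  ultimately obtain g where g: "\<And>n. Q (map g [0..<n])" using sequence_by_extension[of Q] by blast
  have "independent_on T (\<lambda>k. val (g k)) a b"
    unfolding independent_on_def
  proof (intro allI)
    fix n t
    obtain y where y: "y \<in> A" "y \<in> pattern_cell val a b (map g [0..<n]) t"
      using g[of n] unfolding Q_def by blast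
    have "if k \<in> t then val (g k) y < a else b < val (g k) y" if "k < n" for k
      using y(2)[unfolded pattern_cell_def mem_Collect_eq, rule_format, of k] that
      by (cases "k \<in> t") simp_all
    then show "\<exists>y\<in>T. \<forall>k<n. if k \<in> t then val (g k) y < a else b < val (g k) y"
      using y(1) A(1) by (intro bexI[of _ y]) auto
  qed
  then show ?thesis using g unfolding Q_def by blast
qed

lemma pointwise_approximation:
  assumes f: "f \<in> powertop_real T closure_of F" and S: "finite S" "S \<subseteq> T"
    and e: "\<And>x. x \<in> S \<Longrightarrow> 0 < e x"
  shows "\<exists>g\<in>F. \<forall>x\<in>S. \<bar>g x - f x\<bar> < e x"
proof -
  define U where "U x = (if x \<in> S then ball (f x) (e x) else UNIV)" for x
  have "openin (powertop_real T) (PiE T U)"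
  proof (rule product_topology_basis)
    show "openin euclideanreal (U x)" for x by (simp add: U_def)
    show "finite {x. U x \<noteq> topspace euclideanreal}"
      by (rule finite_subset[OF _ S(1)]) (auto simp: U_def)
  qed
  moreover have "f \<in> PiE T U"
    using f e unfolding in_closure_of by (auto simp: U_def PiE_iff)
  ultimately obtain g where "g \<in> F" "g \<in> PiE T U" using f unfolding in_closure_of by blast
  then show ?thesis using S(2)
    by (intro bexI[of _ g]) (auto simp: U_def PiE_iff dist_real_def abs_minus_commute split: if_splits dest!: bspec)
qed

lemma pointwise_closure_bounded:
  assumes f: "f \<in> powertop_real T closure_of F" and M: "\<forall>g\<in>F. \<forall>x\<in>T. \<bar>g x\<bar> \<le> M" and x: "x \<in> T"
  shows "\<bar>f x\<bar> \<le> M"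
proof (rule field_le_epsilon)
  fix e :: real assume "0 < e"
  then obtain g where "g \<in> F" "\<bar>g x - f x\<bar> < e"
    using pointwise_approximation[OF f, of "{x}" "\<lambda>_. e"] x by auto
  then show "\<bar>f x\<bar> \<le> M + e" using M x by fastforce
qed

lemma openin_cell:
  fixes g :: "nat \<Rightarrow> 'a \<Rightarrow> real"
  assumes "\<And>k. k < n \<Longrightarrow> continuous_map X euclideanreal (g k)"
  shows "openin X {x \<in> topspace X. \<forall>k<n. if k \<in> t then g k x < a else b < (g k x :: real)}"
  using assms
proof (induction n)
  case (Suc n)
  have "openin X {x \<in> topspace X. g n x \<in> (if n \<in> t then {..<a} else {b<..})}"
    by (rule openin_continuous_map_preimage[of X euclideanreal]) (use Suc in auto)
  moreover have "openin X {x \<in> topspace X. \<forall>k<n. if k \<in> t then g k x < a else b < g k x}"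
    by (rule Suc.IH) (use Suc.prems in simp)
  moreover have "{x \<in> topspace X. \<forall>k<Suc n. if k \<in> t then g k x < a else b < g k x} =
      {x \<in> topspace X. g n x \<in> (if n \<in> t then {..<a} else {b<..})} \<inter>
      {x \<in> topspace X. \<forall>k<n. if k \<in> t then g k x < a else b < g k x}"
    by (auto simp: less_Suc_eq)
  ultimately show ?case by (simp only: openin_Int)
qed simp

text \<open>
  Localising the failure of fragmentedness yields \<open>a < b\<close> and a set \<open>A'\<close> such that on each nonempty
  relatively open piece of \<open>A'\<close> the limit \<open>f\<close> takes values below \<open>a\<close> and values above \<open>b\<close>.  If members
  \<open>g\<^sub>0, \<dots>, g\<^bsub>n-1\<^esub>\<close> of \<open>F\<close> have been found for which all \<open>2\<^sup>n\<close> open cells meet \<open>A'\<close>, pick a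
  point of each kind in each cell; a member of \<open>F\<close> close to \<open>f\<close> at these finitely many points splits
  every cell.
\<close>

lemma not_fragmented_imp_independent:
  assumes f: "f \<in> powertop_real (topspace X) closure_of F"
    and cont: "\<And>g. g \<in> F \<Longrightarrow> continuous_map X euclideanreal g"
    and M: "\<forall>g\<in>F. \<forall>x\<in>topspace X. \<bar>g x\<bar> \<le> M"
    and nf: "\<not> fragmented X f"
  shows "\<exists>g a b. (\<forall>k. g k \<in> F) \<and> a < b \<and> independent_on (topspace X) g a b"
proof -
  note fM = pointwise_closure_bounded[OF f M]
  obtain A e where A: "A \<subseteq> topspace X" "A \<noteq> {}" and e: "0 < e"
    and osc: "\<And>U. openin X U \<Longrightarrow> U \<inter> A \<noteq> {} \<Longrightarrow> \<not> (bounded (f ` (U \<inter> A)) \<and> diameter (f ` (U \<inter> A)) \<le> e)"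
    using nf unfolding fragmented_def by metis
  have jump: "\<exists>x\<in>U \<inter> A. \<exists>y\<in>U \<inter> A. f x + e < f y" if U: "openin X U" "U \<inter> A \<noteq> {}" for U
  proof (rule ccontr)
    assume "\<not> ?thesis"
    then have le: "f y \<le> f x + e" if "x \<in> U \<inter> A" "y \<in> U \<inter> A" for x y using that by (meson not_le)
    have "diameter (f ` (U \<inter> A)) \<le> e"
    proof (rule diameter_le)
      fix u v assume "u \<in> f ` (U \<inter> A)" "v \<in> f ` (U \<inter> A)"
      then obtain x y where "x \<in> U \<inter> A" "y \<in> U \<inter> A" "u = f x" "v = f y" by blast
      then show "norm (u - v) \<le> e" using le[of x y] le[of y x] by (simp add: abs_le_iff)
    qed (use e in simp)
    moreover have "bounded (f ` (U \<inter> A))"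
      unfolding bounded_iff using fM A(1) by (intro exI[of _ M]) auto
    ultimately show False using osc[OF U] by blast
  qed
  obtain G :: "(real \<times> real) set" where G: "finite G" "\<forall>(a, b)\<in>G. a < b"
    "\<And>u v. \<bar>u\<bar> \<le> M \<Longrightarrow> \<bar>v\<bar> \<le> M \<Longrightarrow> u + e < v \<Longrightarrow> \<exists>(a, b)\<in>G. u < a \<and> b < v"
    using oscillation_thresholds[OF e, of M] by blast
  define hits where "hits U p \<longleftrightarrow> (\<exists>x\<in>U \<inter> A. f x < fst p) \<and> (\<exists>y\<in>U \<inter> A. snd p < f y)" for U p
  define all_hit where "all_hit O' p \<longleftrightarrow> (\<forall>U. openin X U \<longrightarrow> U \<inter> (O' \<inter> A) \<noteq> {} \<longrightarrow> hits (U \<inter> O') p)" for O' p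
  \<comment> \<open>Otherwise one could shrink an open set once for each pair in \<open>G\<close>, until no jump larger than \<open>e\<close>
      is left on it.\<close>
  have "\<exists>p\<in>G. \<exists>O'. openin X O' \<and> O' \<inter> A \<noteq> {} \<and> all_hit O' p"
  proof (rule ccontr)
    assume no: "\<not> ?thesis"
    have "\<exists>O'. openin X O' \<and> O' \<inter> A \<noteq> {} \<and> (\<forall>p\<in>H. \<not> hits O' p)" if "finite H" "H \<subseteq> G" for H
      using that
    proof (induction H rule: finite_induct)
      case empty
      show ?case using A by (intro exI[of _ "topspace X"]) auto
    next
      case (insert p H)
      then obtain O' where O': "openin X O'" "O' \<inter> A \<noteq> {}" "\<forall>p\<in>H. \<not> hits O' p" by blast
      have "\<not> all_hit O' p" using no O'(1,2) insert.prems by blast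
      then obtain U where U: "openin X U" "U \<inter> (O' \<inter> A) \<noteq> {}" "\<not> hits (U \<inter> O') p"
        unfolding all_hit_def by blast
      have "\<forall>p\<in>insert p H. \<not> hits (U \<inter> O') p" using O'(3) U(3) unfolding hits_def by blast
      moreover have "openin X (U \<inter> O')" "U \<inter> O' \<inter> A \<noteq> {}" using U O' by auto
      ultimately show ?case by blast
    qed
    from this[OF G(1)] obtain O' where O': "openin X O'" "O' \<inter> A \<noteq> {}" "\<forall>p\<in>G. \<not> hits O' p" by blast
    obtain x y where xy: "x \<in> O' \<inter> A" "y \<in> O' \<inter> A" "f x + e < f y" using jump[OF O'(1,2)] by blast
    have "x \<in> topspace X" "y \<in> topspace X" using xy A(1) by auto
    then obtain a b where "(a, b) \<in> G" "f x < a" "b < f y" using G(3)[OF fM fM xy(3)] by blast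
    then show False using O'(3) xy unfolding hits_def by fastforce
  qed
  then obtain p O' where "p \<in> G" and O': "openin X O'" "O' \<inter> A \<noteq> {}" and hit: "all_hit O' p" by blast
  define a b where "a = fst p" and "b = snd p"
  have ab: "a < b" using G(2) \<open>p \<in> G\<close> by (auto simp: a_def b_def)
  define A' where "A' = O' \<inter> A"
  have A': "A' \<subseteq> topspace X" "A' \<noteq> {}" using A O' by (auto simp: A'_def)
  have low: "\<exists>x\<in>U \<inter> A'. f x < a" and high: "\<exists>x\<in>U \<inter> A'. b < f x" if "openin X U" "U \<inter> A' \<noteq> {}" for U
    using hit that unfolding all_hit_def hits_def A'_def a_def b_def by blast+
  define val :: "('a \<Rightarrow> real) \<Rightarrow> 'a \<Rightarrow> real" where "val g = g" for g
  have "\<exists>g. (\<forall>n. set (map g [0..<n]) \<subseteq> F) \<and> independent_on (topspace X) (\<lambda>k. val (g k)) a b"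
  proof (rule independent_selection[OF A'])
    fix gs assume gs: "set gs \<subseteq> F" and cells: "\<And>t. A' \<inter> pattern_cell val a b gs t \<noteq> {}"
    define W where "W t = {x \<in> topspace X. \<forall>k<length gs. if k \<in> t then (gs ! k) x < a else b < (gs ! k) x}" for t
    have W_eq: "W t = topspace X \<inter> pattern_cell val a b gs t" for t
      by (auto simp: W_def pattern_cell_def val_def)
    have W: "openin X (W t)" for t
    proof -
      have "continuous_map X euclideanreal (gs ! k)" if "k < length gs" for k
        using that gs by (intro cont) auto
      then show ?thesis unfolding W_def by (rule openin_cell)
    qed
    have "W t \<inter> A' \<noteq> {}" for t using cells[of t] A'(1) unfolding W_eq by blast
    then obtain p q where p: "\<And>t. p t \<in> W t \<inter> A'" "\<And>t. f (p t) < a"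
      and q: "\<And>t. q t \<in> W t \<inter> A'" "\<And>t. b < f (q t)" using low[OF W] high[OF W] by metis
    \<comment> \<open>A pattern matters only up to the length of \<open>gs\<close>, which keeps the set \<open>S\<close> of chosen points finite.\<close>
    define S where "S = p ` Pow {..<length gs} \<union> q ` Pow {..<length gs}"
    have S: "finite S" "S \<subseteq> topspace X" using p(1) q(1) by (auto simp: S_def W_def)
    define d where "d x = (if f x < a then a - f x else if b < f x then f x - b else 1)" for x
    have "0 < d x" for x by (simp add: d_def)
    then obtain h where h: "h \<in> F" "\<And>x. x \<in> S \<Longrightarrow> \<bar>h x - f x\<bar> < d x"
      using pointwise_approximation[OF f S, of d] by blast
    have "(\<exists>y\<in>A' \<inter> pattern_cell val a b gs t. val h y < a) \<and> (\<exists>y\<in>A' \<inter> pattern_cell val a b gs t. b < val h y)" for t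
    proof -
      define t' where "t' = t \<inter> {..<length gs}"
      have "p t' \<in> S" "q t' \<in> S" by (auto simp: S_def t'_def)
      then have "h (p t') < a" "b < h (q t')"
        using ab h(2)[of "p t'"] h(2)[of "q t'"] p(2)[of t'] q(2)[of t'] by (auto simp: d_def split: if_splits)
      moreover have "W t' = W t" unfolding W_eq t'_def by (simp only: pattern_cell_initial_part)
      then have "p t' \<in> A' \<inter> pattern_cell val a b gs t" "q t' \<in> A' \<inter> pattern_cell val a b gs t"
        using p(1)[of t'] q(1)[of t'] unfolding W_eq by auto
      ultimately show ?thesis unfolding val_def by blast
    qed
    then show "\<exists>h. set (gs @ [h]) \<subseteq> F \<and> (\<forall>t. (\<exists>y\<in>A' \<inter> pattern_cell val a b gs t. val h y < a) \<and>
        (\<exists>y\<in>A' \<inter> pattern_cell val a b gs t. b < val h y))"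
      using gs h(1) by (intro exI[of _ h]) simp
  qed simp
  then obtain g where g: "\<And>n. set (map g [0..<n]) \<subseteq> F" "independent_on (topspace X) (\<lambda>k. val (g k)) a b" by blast
  have "g k \<in> F" for k using g(1)[of "Suc k"] by simp
  then show ?thesis using ab g(2) by (intro exI[of _ g] exI[of _ a] exI[of _ b]) (simp add: val_def)
qed

text \<open>
  Rosenthal's computation: choose \<open>x\<close> by the signs of the coefficients and \<open>y\<close> by the opposite signs.
  The values of the sum at \<open>x\<close> and \<open>y\<close> differ by at least \<open>b - a\<close> times the sum of the moduli, so one of them is large.
\<close>

lemma independent_lower_estimate:
  assumes ab: "a < b" and ind: "independent_on T g a b"
  shows "\<exists>x\<in>T. (b - a) / 2 * (\<Sum>k<n. \<bar>c k\<bar>) \<le> \<bar>\<Sum>k<n. c k * g k x\<bar>"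
proof -
  define t where "t = {k. c k < 0}"
  obtain x where x: "x \<in> T" "\<forall>k<n. if k \<in> t then g k x < a else b < g k x"
    using ind unfolding independent_on_def by blast
  obtain y where y: "y \<in> T" "\<forall>k<n. if k \<in> - t then g k y < a else b < g k y"
    using ind unfolding independent_on_def by blast
  have "(b - a) * (\<Sum>k<n. \<bar>c k\<bar>) \<le> (\<Sum>k<n. c k * (g k x - g k y))"
    unfolding sum_distrib_left
  proof (rule sum_mono)
    fix k assume k: "k \<in> {..<n}"
    show "(b - a) * \<bar>c k\<bar> \<le> c k * (g k x - g k y)"
    proof (cases "c k < 0")
      case True
      then have "b - a \<le> g k y - g k x" using x(2) y(2) k by (fastforce simp: t_def)
      then have "(b - a) * (- c k) \<le> (g k y - g k x) * (- c k)" using True by (intro mult_right_mono) auto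
      then show ?thesis using True by (simp add: algebra_simps)
    next
      case False
      then have "b - a \<le> g k x - g k y" using x(2) y(2) k by (fastforce simp: t_def)
      then have "(b - a) * c k \<le> (g k x - g k y) * c k" using False by (intro mult_right_mono) auto
      then show ?thesis using False by (simp add: algebra_simps)
    qed
  qed
  also have "\<dots> = (\<Sum>k<n. c k * g k x) - (\<Sum>k<n. c k * g k y)"
    by (simp add: right_diff_distrib sum_subtractf)
  finally have *: "2 * ((b - a) / 2 * (\<Sum>k<n. \<bar>c k\<bar>)) \<le> (\<Sum>k<n. c k * g k x) - (\<Sum>k<n. c k * g k y)" by simp
  show ?thesis
  proof (cases "(b - a) / 2 * (\<Sum>k<n. \<bar>c k\<bar>) \<le> \<bar>\<Sum>k<n. c k * g k x\<bar>")
    case True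
    then show ?thesis using x(1) by blast
  next
    case False
    then have "(b - a) / 2 * (\<Sum>k<n. \<bar>c k\<bar>) \<le> \<bar>\<Sum>k<n. c k * g k y\<bar>" using * by linarith
    then show ?thesis using y(1) by blast
  qed
qed

text \<open>
  For each infinite pattern \<open>t\<close> let \<open>Z t\<close> be the closed set of points that
  realise it with weak inequalities; by compactness it is nonempty. Take a minimal closed set
  \<open>Y\<close> that meets every \<open>Z t\<close>. By minimality each open set \<open>O'\<close>
  meeting \<open>Y\<close> contains the points of \<open>Y\<close> in \<open>Z t\<close> for all
  \<open>t\<close> with a certain finite initial part, in particular points with eventually small and
  points with eventually large values. At these points any cluster point of the sequence is at most
  \<open>a\<close> and at least \<open>b\<close> respectively.
\<close>

lemma independent_imp_not_fragmented:
  fixes g :: "nat \<Rightarrow> 'a \<Rightarrow> real"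
  assumes X: "compact_space X" and g: "\<And>k. g k \<in> C_space X"
    and M: "\<And>k x. x \<in> topspace X \<Longrightarrow> \<bar>g k x\<bar> \<le> M" and ab: "a < b"
    and ind: "independent_on (topspace X) g a b"
  shows "\<exists>f\<in>powertop_real (topspace X) closure_of (range g). \<not> fragmented X f"
proof -
  let ?T = "topspace X"
  have cont: "continuous_map X euclideanreal (g k)" for k using g by (auto simp: C_space_def)
  define C where "C t k = {x \<in> ?T. if k \<in> t then g k x \<le> a else b \<le> g k x}" for t k
  have C: "closedin X (C t k)" for t k
  proof -
    have "C t k = {x \<in> ?T. g k x \<in> (if k \<in> t then {..a} else {b..})}" by (auto simp: C_def)
    then show ?thesis using closedin_continuous_map_preimage[OF cont] by auto
  qed
  define Z where "Z t = (\<Inter>k. C t k)" for t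
  have Z: "closedin X (Z t)" for t unfolding Z_def using C by (auto intro!: closedin_Inter)
  have finite_stage: "\<exists>m. Y \<inter> (\<Inter>k<m. C t k) = {}" if Y: "closedin X Y" "Y \<inter> Z t = {}" for Y t
  proof -
    have "compactin X Y" using X Y(1) by (rule closedin_compact_space)
    moreover have "\<forall>U\<in>range (\<lambda>k. ?T - C t k). openin X U" using C by auto
    moreover have "Y \<subseteq> \<Union> (range (\<lambda>k. ?T - C t k))" using Y closedin_subset[OF Y(1)] by (auto simp: Z_def)
    ultimately obtain \<F> where \<F>: "finite \<F>" "\<F> \<subseteq> range (\<lambda>k. ?T - C t k)" "Y \<subseteq> \<Union>\<F>"
      unfolding compactin_def by meson
    then obtain I where I: "finite I" "\<F> = (\<lambda>k. ?T - C t k) ` I" by (meson finite_subset_image)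
    obtain m where "\<forall>k\<in>I. k < m" using I(1) finite_nat_set_iff_bounded by blast
    then show ?thesis using \<F>(3) I(2) by (intro exI[of _ m]) auto
  qed
  define good where "good Y \<longleftrightarrow> (\<forall>t. Y \<inter> Z t \<noteq> {})" for Y
  \<comment> \<open>Complements of good closed sets, so that Zorn's lemma is applied upwards.\<close>
  define \<A> where "\<A> = {U. openin X U \<and> good (?T - U)}"
  have "{} \<in> \<A>"
  proof -
    have "?T \<inter> (\<Inter>k<m. C t k) \<noteq> {}" for t m
    proof -
      obtain x where "x \<in> ?T" "\<forall>k<m. if k \<in> t then g k x < a else b < g k x"
        using ind unfolding independent_on_def by blast
      then have "x \<in> ?T \<inter> (\<Inter>k<m. C t k)" by (fastforce simp: C_def split: if_splits)
      then show ?thesis by blast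
    qed
    then have "good ?T" using finite_stage[of ?T] unfolding good_def by (metis closedin_topspace)
    then show ?thesis by (simp add: \<A>_def)
  qed
  moreover have "\<Union>\<C> \<in> \<A>" if \<C>: "\<C> \<noteq> {}" "subset.chain \<A> \<C>" for \<C>
  proof -
    have sub: "\<C> \<subseteq> \<A>" using \<C>(2) by (simp add: subset_chain_def)
    have "(?T - \<Union>\<C>) \<inter> Z t \<noteq> {}" for t
    proof
      assume "(?T - \<Union>\<C>) \<inter> Z t = {}"
      then have "Z t \<subseteq> \<Union>\<C>" using closedin_subset[OF Z] by blast
      moreover have "compactin X (Z t)" using X Z by (rule closedin_compact_space)
      moreover have "\<forall>U\<in>\<C>. openin X U" using sub by (auto simp: \<A>_def)
      ultimately obtain \<F> where \<F>: "finite \<F>" "\<F> \<subseteq> \<C>" "Z t \<subseteq> \<Union>\<F>" unfolding compactin_def by meson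
      obtain U where "U \<in> \<C>" "Z t \<subseteq> U"
      proof (cases "\<F> = {}")
        case True
        then show ?thesis using \<F>(3) \<C>(1) that by auto
      next
        case False
        have "subset.chain \<A> \<F>" using \<C>(2) \<F>(2) unfolding subset_chain_def by (meson subset_iff)
        then have "\<Union>\<F> \<in> \<F>" by (rule Union_in_chain[OF \<F>(1) False])
        then have "\<Union>\<F> \<in> \<C>" using \<F>(2) by (rule set_mp[rotated])
        then show ?thesis using \<F>(3) by (rule that)
      qed
      then show False using sub by (auto simp: \<A>_def good_def)
    qed
    then show ?thesis using sub by (auto simp: \<A>_def good_def)
  qed
  ultimately obtain U where U: "U \<in> \<A>" and max: "\<And>W. W \<in> \<A> \<Longrightarrow> U \<subseteq> W \<Longrightarrow> W = U"
    using subset_Zorn_nonempty[of \<A>] by blast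
  define Y where "Y = ?T - U"
  have Y: "closedin X Y" "good Y" using U by (auto simp: Y_def \<A>_def)
  have hit: "\<exists>m t. \<forall>t'. t' \<inter> {..<m} = t \<inter> {..<m} \<longrightarrow> O' \<inter> Y \<inter> Z t' \<noteq> {}"
    if O': "openin X O'" "O' \<inter> Y \<noteq> {}" for O'
  proof -
    \<comment> \<open>Removing \<open>O'\<close> from the minimal set \<open>Y\<close> destroys some pattern, and by compactness a finite part of it.\<close>
    have "U \<union> O' \<notin> \<A>" using max[of "U \<union> O'"] O'(2) by (auto simp: Y_def)
    then have "\<not> good (?T - (U \<union> O'))" using U O'(1) by (auto simp: \<A>_def)
    then obtain t where t: "(?T - (U \<union> O')) \<inter> Z t = {}" by (auto simp: good_def)
    have "closedin X (?T - (U \<union> O'))" using U O'(1) by (auto simp: \<A>_def)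
    from finite_stage[OF this t] obtain m where m: "(?T - (U \<union> O')) \<inter> (\<Inter>k<m. C t k) = {}" by blast
    have "O' \<inter> Y \<inter> Z t' \<noteq> {}" if t': "t' \<inter> {..<m} = t \<inter> {..<m}" for t'
    proof -
      obtain x where x: "x \<in> Y" "x \<in> Z t'" using Y(2) unfolding good_def by blast
      have "x \<in> C t k" if "k < m" for k
      proof -
        have "k \<in> t' \<longleftrightarrow> k \<in> t" using t' that by blast
        then show ?thesis using x(2) by (auto simp: Z_def C_def)
      qed
      then have "x \<in> O'" using m x(1) by (auto simp: Y_def)
      then show ?thesis using x by blast
    qed
    then show ?thesis by blast
  qed
  have "\<exists>f\<in>powertop_real ?T closure_of (range g). \<forall>m. f \<in> powertop_real ?T closure_of (g ` {m..})"
  proof -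
    define K where "K = (\<Pi>\<^sub>E x\<in>?T. {-M..M})"
    have K: "compactin (powertop_real ?T) K" unfolding K_def
      by (auto simp: compactin_PiE)
    have gK: "g k \<in> K" for k using g[of k] M[of _ k] by (auto simp: K_def C_space_def PiE_iff abs_le_iff) (smt (verit) M)+
    define \<D> where "\<D> = range (\<lambda>m. powertop_real ?T closure_of (g ` {m..}))"
    have "K \<inter> \<Inter>\<F> \<noteq> {}" if \<F>: "finite \<F>" "\<F> \<subseteq> \<D>" for \<F>
    proof -
      obtain I where I: "finite I" "\<F> = (\<lambda>m. powertop_real ?T closure_of (g ` {m..})) ` I"
        using \<F> unfolding \<D>_def by (meson finite_subset_image)
      obtain n where n: "\<forall>m\<in>I. m < n" using I(1) finite_nat_set_iff_bounded by blast
      have "g n \<in> powertop_real ?T closure_of (g ` {m..})" if "m \<in> I" for m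
      proof -
        have "g ` {m..} \<subseteq> topspace (powertop_real ?T)" using g by (auto simp: C_space_def extensional_def)
        from closure_of_subset[OF this] show ?thesis using n that by force
      qed
      then show ?thesis using gK[of n] I(2) by blast
    qed
    moreover have "\<forall>C\<in>\<D>. closedin (powertop_real ?T) C" by (auto simp: \<D>_def)
    ultimately have "K \<inter> \<Inter>\<D> \<noteq> {}" using K unfolding compactin_fip by metis
    then obtain f where f: "\<And>m. f \<in> powertop_real ?T closure_of (g ` {m..})" unfolding \<D>_def by blast
    have "f \<in> powertop_real ?T closure_of (range g)" using f[of 0] by (simp add: atLeast_0 atLeast_def)
    then show ?thesis using f by blast
  qed
  then obtain f where f: "f \<in> powertop_real ?T closure_of (range g)"
    and fm: "\<And>m. f \<in> powertop_real ?T closure_of (g ` {m..})" by blast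
  have up: "f x \<le> a" if x: "x \<in> ?T" and le: "\<And>k. k \<ge> m \<Longrightarrow> g k x \<le> a" for x m
  proof (rule field_le_epsilon)
    fix e :: real assume "0 < e"
    then obtain k where "k \<ge> m" "\<bar>g k x - f x\<bar> < e"
      using pointwise_approximation[OF fm[of m], of "{x}" "\<lambda>_. e"] x by auto
    then show "f x \<le> a + e" using le[of k] by linarith
  qed
  have low: "b \<le> f x" if x: "x \<in> ?T" and le: "\<And>k. k \<ge> m \<Longrightarrow> b \<le> g k x" for x m
  proof (rule field_le_epsilon)
    fix e :: real assume "0 < e"
    then obtain k where "k \<ge> m" "\<bar>g k x - f x\<bar> < e"
      using pointwise_approximation[OF fm[of m], of "{x}" "\<lambda>_. e"] x by auto
    then show "b \<le> f x + e" using le[of k] by linarith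
  qed
  have "\<not> fragmented X f"
  proof
    assume fr: "fragmented X f"
    have "Y \<noteq> {}" using Y(2) by (auto simp: good_def)
    moreover have "0 < (b - a) / 2" using ab by simp
    ultimately obtain O' where O': "openin X O'" "O' \<inter> Y \<noteq> {}" and bd: "bounded (f ` (O' \<inter> Y))"
      and di: "diameter (f ` (O' \<inter> Y)) \<le> (b - a) / 2"
      using fr[unfolded fragmented_def, rule_format, of Y "(b - a) / 2"] closedin_subset[OF Y(1)] by auto
    obtain m t where mt: "\<And>t'. t' \<inter> {..<m} = t \<inter> {..<m} \<Longrightarrow> O' \<inter> Y \<inter> Z t' \<noteq> {}"
      using hit[OF O'] by blast
    \<comment> \<open>Beyond \<open>m\<close> the pattern is free: ask for small values only, then for large values only.\<close>
    obtain x where x: "x \<in> O' \<inter> Y" "x \<in> Z (t \<union> {m..})" using mt[of "t \<union> {m..}"] by fastforce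
    obtain y where y: "y \<in> O' \<inter> Y" "y \<in> Z (t \<inter> {..<m})" using mt[of "t \<inter> {..<m}"] by auto
    have T: "x \<in> ?T" "y \<in> ?T" using x y closedin_subset[OF Y(1)] by auto
    have "f x \<le> a" by (rule up[OF T(1), of m]) (use x(2) in \<open>auto simp: Z_def C_def\<close>)
    moreover have "b \<le> f y"
      by (rule low[OF T(2), of m]) (use y(2) in \<open>force simp: Z_def C_def\<close>)
    moreover have "dist (f x) (f y) \<le> diameter (f ` (O' \<inter> Y))"
      by (rule diameter_bounded_bound[OF bd]) (use x y in auto)
    ultimately show False using di ab by (auto simp: dist_real_def)
  qed
  then show ?thesis using f by blast
qed

section \<open>A dichotomy for sequences of functions\<close>

lemma frequently_subseq:
  assumes "strict_mono (r :: nat \<Rightarrow> nat)" "\<exists>\<^sub>F k in sequentially. P (r k)"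
  shows "\<exists>\<^sub>F k in sequentially. P k"
  using eventually_subseq[OF assms(1), of "\<lambda>k. \<not> P k"] assms(2) unfolding frequently_def by blast

lemma frequently_obtain_subseq:
  assumes "\<exists>\<^sub>F k in sequentially. P k"
  shows "\<exists>r :: nat \<Rightarrow> nat. strict_mono r \<and> (\<forall>k. P (r k))"
proof -
  have "infinite {k. P k}" using assms
    by (simp add: frequently_sequentially infinite_nat_iff_unbounded_le)
  then show ?thesis using infinite_enumerate[of "{k. P k}"] by auto
qed

text \<open>
  Let \<open>D r\<close> be the set of points at which the subsequence \<open>r\<close> drops below \<open>a\<close> and rises above \<open>b\<close>
  infinitely often.  It shrinks when \<open>r\<close> is refined.  Suppose that no \<open>D r\<close> is empty.  Diagonalising over the countably many
  cells gives \<open>s\<close> such that a cell meeting \<open>D s\<close> still meets \<open>D (s \<circ> r)\<close> for every refinement.  For such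
  \<open>s\<close>, all but finitely many \<open>f (s k)\<close> split a given cell in both directions, and an independent
  subsequence can be selected greedily.  This replaces the usual appeal to an infinitary Ramsey theorem.
\<close>

lemma rosenthal_dichotomy:
  fixes f :: "nat \<Rightarrow> 'a \<Rightarrow> real"
  shows "(\<exists>r. strict_mono r \<and> independent_on T (f \<circ> r) a b) \<or>
    (\<exists>r. strict_mono r \<and> (\<forall>x\<in>T. \<not> ((\<exists>\<^sub>F k in sequentially. f (r k) x < a) \<and>
        (\<exists>\<^sub>F k in sequentially. b < f (r k) x))))"
proof (rule disjCI)
  define D where "D r = {x \<in> T. (\<exists>\<^sub>F k in sequentially. f (r k) x < a) \<and> (\<exists>\<^sub>F k in sequentially. b < f (r k) x)}"
    for r :: "nat \<Rightarrow> nat"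
  define cell where "cell \<sigma> = {x. \<forall>(k, \<beta>)\<in>set \<sigma>. if \<beta> then f k x < a else b < f k x}" for \<sigma> :: "(nat \<times> bool) list"
  assume "\<not> (\<exists>r. strict_mono r \<and> (\<forall>x\<in>T. \<not> ((\<exists>\<^sub>F k in sequentially. f (r k) x < a) \<and>
        (\<exists>\<^sub>F k in sequentially. b < f (r k) x))))"
  then have Dne: "D r \<noteq> {}" if "strict_mono r" for r using that unfolding D_def by blast
  have Dmono: "D (s \<circ> r) \<subseteq> D s" if "strict_mono r" for r s
    using frequently_subseq[OF that] unfolding D_def by (auto simp: o_def)
  have Dtail: "D (s \<circ> (+) n) = D s" for s n
  proof -
    have "(\<exists>\<^sub>F k in sequentially. P (s (n + k))) \<longleftrightarrow> (\<exists>\<^sub>F k in sequentially. P (s k))" for P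
      using eventually_sequentially_seg[of "\<lambda>k. \<not> P (s k)" n] unfolding frequently_def by (simp add: add.commute)
    note shift = this
    show ?thesis unfolding D_def o_def
      using shift[of "\<lambda>j. f j x < a" for x] shift[of "\<lambda>j. b < f j x" for x] by simp
  qed
  \<comment> \<open>Either the cell misses \<open>D s\<close> already, or it cannot be made to miss it by refining \<open>s\<close>.\<close>
  define P where "P n s \<longleftrightarrow> D s \<inter> cell (from_nat n) = {} \<or>
    (\<forall>r. strict_mono r \<longrightarrow> D (s \<circ> r) \<inter> cell (from_nat n) \<noteq> {})" for n s
  interpret subseqs P
  proof
    fix n and s :: "nat \<Rightarrow> nat"
    assume "strict_mono s"
    show "\<exists>r'. strict_mono r' \<and> P n (s \<circ> r')"
    proof (cases "\<exists>r. strict_mono r \<and> D (s \<circ> r) \<inter> cell (from_nat n) = {}")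
      case True
      then show ?thesis unfolding P_def by blast
    next
      case False
      then show ?thesis unfolding P_def by (intro exI[of _ "id :: nat \<Rightarrow> nat"]) (auto simp: strict_mono_def)
    qed
  qed
  have stable: "P n (s \<circ> r)" if "strict_mono r" "P n s" for r s n
    using that Dmono[OF that(1), of s] strict_mono_o[OF that(1)] unfolding P_def
    by (auto simp: comp_assoc)
  define s where "s = diagseq"
  have s: "strict_mono s" unfolding s_def by (rule subseq_diagseq)
  have persist: "D (s \<circ> r) \<inter> cell \<sigma> \<noteq> {}" if "D s \<inter> cell \<sigma> \<noteq> {}" "strict_mono r" for r \<sigma>
  proof -
    define m where "m = Suc (to_nat \<sigma>)"
    \<comment> \<open>The diagonal sequence has the property of the cell only after dropping its first \<open>m\<close> terms.\<close>
    define r' where "r' k = r (m + k) - m" for k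
    have ge: "m \<le> r (m + k)" for k
      using seq_suble[OF that(2), of "m + k"] by linarith
    have "strict_mono r'"
      unfolding strict_mono_Suc_iff r'_def
      using ge that(2) by (simp add: diff_less_mono strict_mono_less)
    moreover have "P (to_nat \<sigma>) (s \<circ> (+) m)" unfolding s_def m_def by (rule diagseq_holds[OF stable])
    ultimately have "D (s \<circ> (+) m \<circ> r') \<inter> cell \<sigma> \<noteq> {}"
      using that(1) unfolding P_def by (simp add: Dtail)
    moreover have "s \<circ> (+) m \<circ> r' = s \<circ> r \<circ> (+) m"
      using ge by (auto simp: r'_def o_def fun_eq_iff)
    ultimately show ?thesis by (simp add: Dtail)
  qed
  have split: "\<forall>\<^sub>F k in sequentially. D s \<inter> cell ((s k, \<beta>) # \<sigma>) \<noteq> {}" if \<sigma>: "D s \<inter> cell \<sigma> \<noteq> {}" for \<sigma> \<beta>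
  proof (rule ccontr)
    assume "\<not> ?thesis"
    \<comment> \<open>Persistence along the exceptional indices gives a point of the cell at which the functions
        cross the threshold infinitely often, hence at an exceptional index.\<close>
    then have "\<exists>\<^sub>F k in sequentially. D s \<inter> cell ((s k, \<beta>) # \<sigma>) = {}" by (simp add: not_eventually)
    then obtain r :: "nat \<Rightarrow> nat" where r: "strict_mono r" "\<And>k. D s \<inter> cell ((s (r k), \<beta>) # \<sigma>) = {}"
      using frequently_obtain_subseq[of "\<lambda>k. D s \<inter> cell ((s k, \<beta>) # \<sigma>) = {}"] by blast
    obtain x where x: "x \<in> D (s \<circ> r)" "x \<in> cell \<sigma>" using persist[OF \<sigma> r(1)] by blast
    have "\<exists>k. if \<beta> then f (s (r k)) x < a else b < f (s (r k)) x"
      using x(1) unfolding D_def by (auto dest: frequently_ex)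
    then obtain k where "if \<beta> then f (s (r k)) x < a else b < f (s (r k)) x" ..
    then have "x \<in> D s \<inter> cell ((s (r k), \<beta>) # \<sigma>)" using x Dmono[OF r(1), of s] by (auto simp: cell_def)
    then show False using r(2) by blast
  qed
  define val where "val k = f (s k)" for k
  have "\<exists>r. (\<forall>n. sorted_wrt (<) (map r [0..<n])) \<and> independent_on T (\<lambda>k. val (r k)) a b"
  proof (rule independent_selection[of "D s"])
    fix js :: "nat list"
    assume js: "sorted_wrt (<) js" and cells: "\<And>t. D s \<inter> pattern_cell val a b js t \<noteq> {}"
    define n where "n = length js"
    define \<sigma> where "\<sigma> t = map (\<lambda>i. (s (js ! i), i \<in> t)) [0..<n]" for t
    have cell_\<sigma>: "cell (\<sigma> t) = pattern_cell val a b js t" for t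
      by (auto simp: cell_def \<sigma>_def pattern_cell_def val_def n_def)
    have "\<forall>\<^sub>F k in sequentially. \<forall>(t, \<beta>)\<in>Pow {..<n} \<times> UNIV. D s \<inter> cell ((s k, \<beta>) # \<sigma> t) \<noteq> {}"
      by (intro eventually_ball_finite) (auto intro!: split cells[folded cell_\<sigma>])
    moreover have "\<forall>\<^sub>F k in sequentially. \<forall>j\<in>set js. j < k"
      by (intro eventually_ball_finite) (auto intro: eventually_gt_at_top)
    ultimately have "\<forall>\<^sub>F k in sequentially. (\<forall>(t, \<beta>)\<in>Pow {..<n} \<times> UNIV. D s \<inter> cell ((s k, \<beta>) # \<sigma> t) \<noteq> {}) \<and> (\<forall>j\<in>set js. j < k)"
      by (rule eventually_conj)
    then obtain k where k: "\<forall>(t, \<beta>)\<in>Pow {..<n} \<times> UNIV. D s \<inter> cell ((s k, \<beta>) # \<sigma> t) \<noteq> {}" "\<forall>j\<in>set js. j < k"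
      using eventually_happens'[OF sequentially_bot] by blast
    have "\<exists>y\<in>D s \<inter> pattern_cell val a b js t. if \<beta> then val k y < a else b < val k y" for t \<beta>
    proof -
      have "(t \<inter> {..<n}, \<beta>) \<in> Pow {..<n} \<times> UNIV" by auto
      with k(1) have "D s \<inter> cell ((s k, \<beta>) # \<sigma> (t \<inter> {..<n})) \<noteq> {}" by blast
      then obtain y where y: "y \<in> D s" "y \<in> cell ((s k, \<beta>) # \<sigma> (t \<inter> {..<n}))" by blast
      then have "y \<in> cell (\<sigma> (t \<inter> {..<n}))" "if \<beta> then val k y < a else b < val k y"
        by (auto simp: cell_def val_def)
      then show ?thesis using y(1) unfolding cell_\<sigma> n_def pattern_cell_initial_part by blast
    qed
    from this[where \<beta> = True] this[where \<beta> = False]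
    show "\<exists>k. sorted_wrt (<) (js @ [k]) \<and> (\<forall>t. (\<exists>y\<in>D s \<inter> pattern_cell val a b js t. val k y < a) \<and>
        (\<exists>y\<in>D s \<inter> pattern_cell val a b js t. b < val k y))"
      using js k(2) by (intro exI[of _ k]) (simp add: sorted_wrt_append)
  qed (use Dne[OF s] in \<open>auto simp: D_def\<close>)
  then obtain r where r: "\<And>n. sorted_wrt (<) (map r [0..<n])" "independent_on T (\<lambda>k. val (r k)) a b" by blast
  have "strict_mono r"
    unfolding strict_mono_Suc_iff
  proof
    fix n show "r n < r (Suc n)" using r(1)[of "Suc (Suc n)"] by (simp add: sorted_wrt_append)
  qed
  moreover have "f \<circ> (s \<circ> r) = (\<lambda>k. val (r k))" by (auto simp: val_def)
  ultimately show "\<exists>r. strict_mono r \<and> independent_on T (f \<circ> r) a b"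
    using strict_mono_o[OF s, of r] r(2) by (intro exI[of _ "s \<circ> r"]) simp
qed

text \<open>
  Finitely many threshold pairs detect jumps of size \<open>e\<close>.  Apply the dichotomy to each of them in turn;
  the independent alternative is excluded since the family has only fragmented limits.
\<close>

lemma rosenthal_family_small_oscillation:
  fixes f :: "nat \<Rightarrow> 'a \<Rightarrow> real"
  assumes X: "compact_space X" and F: "rosenthal_family X F" and f: "\<And>k. f k \<in> F" and e: "0 < e"
  shows "\<exists>r. strict_mono r \<and> (\<forall>x\<in>topspace X. \<forall>\<^sub>F k in sequentially. \<bar>f (r k) x - f (r (Suc k)) x\<bar> \<le> e)"
proof -
  obtain M where M: "\<And>g x. g \<in> F \<Longrightarrow> x \<in> topspace X \<Longrightarrow> \<bar>g x\<bar> \<le> M"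
    using F unfolding rosenthal_family_def by blast
  have no_ind: "\<not> independent_on (topspace X) (f \<circ> r) a b" if ab: "a < b" for r a b
  proof
    assume "independent_on (topspace X) (f \<circ> r) a b"
    then obtain h where h: "h \<in> powertop_real (topspace X) closure_of (range (f \<circ> r))" "\<not> fragmented X h"
      using independent_imp_not_fragmented[OF X _ _ ab, of "f \<circ> r" M] f M F
      unfolding rosenthal_family_def by (metis (no_types, lifting) comp_apply subset_eq)
    have "range (f \<circ> r) \<subseteq> F" using f by auto
    then have "h \<in> powertop_real (topspace X) closure_of F" using h(1) closure_of_mono by blast
    then show False using F h(2) by (auto simp: rosenthal_family_def fragmented_functions_def)
  qed
  obtain G :: "(real \<times> real) set" where G: "finite G" "\<forall>(a, b)\<in>G. a < b"
    "\<And>u v. \<bar>u\<bar> \<le> M \<Longrightarrow> \<bar>v\<bar> \<le> M \<Longrightarrow> u + e < v \<Longrightarrow> \<exists>(a, b)\<in>G. u < a \<and> b < v"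
    using oscillation_thresholds[OF e, of M] by blast
  define osc where "osc r x a b \<longleftrightarrow> (\<exists>\<^sub>F k in sequentially. f (r k) x < a) \<and> (\<exists>\<^sub>F k in sequentially. b < f (r k) x)" for r x a b
  define quiet where "quiet r p \<longleftrightarrow> (\<forall>x\<in>topspace X. \<not> osc r x (fst p) (snd p))" for r p
  have "\<exists>r. strict_mono r \<and> (\<forall>p\<in>H. quiet r p)" if "finite H" "H \<subseteq> G" for H
    using that
  proof (induction H rule: finite_induct)
    case empty
    have "strict_mono (id :: nat \<Rightarrow> nat)" by (simp add: strict_mono_def)
    then show ?case by blast
  next
    case (insert p H)
    then obtain r where r: "strict_mono r" "\<forall>p\<in>H. quiet r p" by blast
    have ab: "fst p < snd p" using G(2) insert.prems by auto
    obtain r' where r': "strict_mono r'" "quiet (r \<circ> r') p"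
      using rosenthal_dichotomy[of "topspace X" "f \<circ> r" "fst p" "snd p"] no_ind[OF ab]
      unfolding quiet_def osc_def by (auto simp: comp_assoc)
    have "osc r x a b" if "osc (r \<circ> r') x a b" for x a b
      using that frequently_subseq[OF r'(1)] unfolding osc_def by (auto simp: o_def)
    then have "\<forall>p\<in>H. quiet (r \<circ> r') p" using r(2) unfolding quiet_def by blast
    then show ?case using r'(2) strict_mono_o[OF r(1) r'(1)] by blast
  qed
  from this[OF G(1)] obtain r where r: "strict_mono r" "\<And>p. p \<in> G \<Longrightarrow> quiet r p" by blast
  have "\<forall>\<^sub>F k in sequentially. \<bar>f (r k) x - f (r (Suc k)) x\<bar> \<le> e" if x: "x \<in> topspace X" for x
  proof -
    define below above where "below a k \<longleftrightarrow> f (r k) x < a" and "above b k \<longleftrightarrow> b < f (r k) x" for a b k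
    have "\<forall>\<^sub>F k in sequentially. \<not> (below a k \<and> above b (Suc k)) \<and> \<not> (below a (Suc k) \<and> above b k)"
      if ab: "(a, b) \<in> G" for a b
    proof -
      have "\<not> osc r x a b" using r(2)[OF ab] x by (simp add: quiet_def)
      then have "(\<forall>\<^sub>F k in sequentially. \<not> below a k) \<or> (\<forall>\<^sub>F k in sequentially. \<not> above b k)"
        unfolding osc_def below_def above_def frequently_def by blast
      then show ?thesis
      proof
        assume *: "\<forall>\<^sub>F k in sequentially. \<not> below a k"
        then have "\<forall>\<^sub>F k in sequentially. \<not> below a (Suc k)"
          using eventually_sequentially_Suc[of "\<lambda>k. \<not> below a k"] by blast
        with * show ?thesis by eventually_elim blast
      next
        assume *: "\<forall>\<^sub>F k in sequentially. \<not> above b k"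
        then have "\<forall>\<^sub>F k in sequentially. \<not> above b (Suc k)"
          using eventually_sequentially_Suc[of "\<lambda>k. \<not> above b k"] by blast
        with * show ?thesis by eventually_elim blast
      qed
    qed
    then have "\<forall>\<^sub>F k in sequentially. \<forall>p\<in>G. \<not> (below (fst p) k \<and> above (snd p) (Suc k)) \<and> \<not> (below (fst p) (Suc k) \<and> above (snd p) k)"
      using G(1) by (intro eventually_ball_finite) auto
    then show ?thesis
    proof eventually_elim
      case (elim k)
      have b: "\<bar>f (r k) x\<bar> \<le> M" for k using M[OF f x] .
      show ?case
      proof (rule ccontr)
        assume "\<not> ?case"
        then consider "f (r k) x + e < f (r (Suc k)) x" | "f (r (Suc k)) x + e < f (r k) x" by linarith
        then show False
        proof cases
          case 1
          then show False using G(3)[OF b b 1] elim unfolding below_def above_def by fastforce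
        next
          case 2
          then show False using G(3)[OF b b 2] elim unfolding below_def above_def by fastforce
        qed
      qed
    qed
  qed
  then show ?thesis using r(1) by blast
qed

section \<open>Linear functionals below a sublinear one\<close>

definition sublinear_on :: "'v::real_vector set \<Rightarrow> ('v \<Rightarrow> real) \<Rightarrow> bool"
  where "sublinear_on S q \<longleftrightarrow> (\<forall>x\<in>S. \<forall>y\<in>S. q (x + y) \<le> q x + q y) \<and>
    (\<forall>x\<in>S. \<forall>t>0. q (t *\<^sub>R x) \<le> t * q x)"

lemma sublinear_onD:
  assumes "sublinear_on S q"
  shows "x \<in> S \<Longrightarrow> y \<in> S \<Longrightarrow> q (x + y) \<le> q x + q y" and "x \<in> S \<Longrightarrow> 0 < t \<Longrightarrow> q (t *\<^sub>R x) \<le> t * q x"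
  using assms by (auto simp: sublinear_on_def)

lemma sublinear_on_0:
  assumes "sublinear_on S q" "subspace S"
  shows "q 0 = 0"
  using sublinear_onD(2)[OF assms(1) subspace_0[OF assms(2)], of 2]
    sublinear_onD(2)[OF assms(1) subspace_0[OF assms(2)], of "1/2"] by simp

lemma sublinear_on_minus:
  assumes "sublinear_on S q" "subspace S" "x \<in> S"
  shows "- q (- x) \<le> q x"
  using sublinear_onD(1)[OF assms(1) assms(3) subspace_neg[OF assms(2,3)]] sublinear_on_0[OF assms(1,2)] by simp

lemma sublinear_on_scale:
  assumes "sublinear_on S q" "subspace S" "x \<in> S" "0 < t"
  shows "q (t *\<^sub>R x) = t * q x"
proof (rule antisym)
  show "q (t *\<^sub>R x) \<le> t * q x" using sublinear_onD(2)[OF assms(1,3,4)] .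
  have "q (inverse t *\<^sub>R t *\<^sub>R x) \<le> inverse t * q (t *\<^sub>R x)"
    using assms subspace_scale by (intro sublinear_onD(2)[OF assms(1)]) auto
  then show "t * q x \<le> q (t *\<^sub>R x)" using assms(4) by (simp add: field_simps)
qed

text \<open>
  This functional lies below \<open>q\<close>, so it equals \<open>q\<close> when \<open>q\<close> is minimal.  The
  last inequality then gives superadditivity of \<open>q\<close> in the direction \<open>y\<close>.
\<close>

lemma sublinear_shift:
  assumes q: "sublinear_on S q" and S: "subspace S" and y: "y \<in> S"
  defines "r \<equiv> \<lambda>x. INF t\<in>{0..}. q (x + t *\<^sub>R y) - t * q y"
  shows "sublinear_on S r" and "\<And>x. x \<in> S \<Longrightarrow> r x \<le> q x" and "\<And>x. x \<in> S \<Longrightarrow> r x \<le> q (x + y) - q y"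
proof -
  have bdd: "bdd_below ((\<lambda>t. q (x + t *\<^sub>R y) - t * q y) ` {0..})" if x: "x \<in> S" for x
  proof (rule bdd_belowI2)
    fix t :: real assume t: "t \<in> {0..}"
    have ty: "q (t *\<^sub>R y) = t * q y"
      using t sublinear_on_scale[OF q S y, of t] sublinear_on_0[OF q S] by (cases "t = 0") auto
    have "q ((x + t *\<^sub>R y) + (- x)) \<le> q (x + t *\<^sub>R y) + q (- x)"
      by (intro sublinear_onD(1)[OF q] subspace_add subspace_scale subspace_neg S x y)
    then show "- q (- x) \<le> q (x + t *\<^sub>R y) - t * q y" using ty by simp
  qed
  have r_le: "r x \<le> q (x + t *\<^sub>R y) - t * q y" if "x \<in> S" "0 \<le> t" for x t
    unfolding r_def by (rule cINF_lower[OF bdd]) (use that in auto)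
  have r_near: "\<exists>t\<ge>0. q (x + t *\<^sub>R y) - t * q y < r x + e" if "x \<in> S" "0 < e" for x e
  proof -
    show ?thesis using cINF_less_iff[OF _ bdd[OF that(1)], of "r x + e"] that(2) unfolding r_def by fastforce
  qed
  show "r x \<le> q x" if "x \<in> S" for x using r_le[OF that, of 0] by simp
  show "r x \<le> q (x + y) - q y" if "x \<in> S" for x using r_le[OF that, of 1] by simp
  show "sublinear_on S r"
    unfolding sublinear_on_def
  proof (intro conjI ballI allI impI)
    fix x x' assume x: "x \<in> S" "x' \<in> S"
    show "r (x + x') \<le> r x + r x'"
    proof (rule field_le_epsilon)
      fix e :: real assume "0 < e"
      then obtain t t' where t: "0 \<le> t" "q (x + t *\<^sub>R y) - t * q y < r x + e/2"
        and t': "0 \<le> t'" "q (x' + t' *\<^sub>R y) - t' * q y < r x' + e/2"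
        using r_near[OF x(1), of "e/2"] r_near[OF x(2), of "e/2"] by auto
      have "r (x + x') \<le> q ((x + x') + (t + t') *\<^sub>R y) - (t + t') * q y"
        using x t t' S by (intro r_le subspace_add) auto
      also have "(x + x') + (t + t') *\<^sub>R y = (x + t *\<^sub>R y) + (x' + t' *\<^sub>R y)" by (simp add: algebra_simps)
      also have "q \<dots> \<le> q (x + t *\<^sub>R y) + q (x' + t' *\<^sub>R y)"
        by (intro sublinear_onD(1)[OF q] subspace_add subspace_scale S x y)
      finally show "r (x + x') \<le> r x + r x' + e" using t t' by (simp add: algebra_simps)
    qed
  next
    fix x and c :: real assume x: "x \<in> S" and c: "0 < c"
    have "r (c *\<^sub>R x) / c \<le> r x"
    proof (rule field_le_epsilon)
      fix e :: real assume "0 < e"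
      then obtain t where t: "0 \<le> t" "q (x + t *\<^sub>R y) - t * q y < r x + e" using r_near[OF x] by auto
      have "r (c *\<^sub>R x) \<le> q (c *\<^sub>R x + (c * t) *\<^sub>R y) - c * t * q y"
        using c t subspace_scale[OF S x] by (intro r_le) auto
      also have "c *\<^sub>R x + (c * t) *\<^sub>R y = c *\<^sub>R (x + t *\<^sub>R y)" by (simp add: algebra_simps)
      also have "q \<dots> \<le> c * q (x + t *\<^sub>R y)"
        by (intro sublinear_onD(2)[OF q] subspace_add subspace_scale S x y c)
      finally have "r (c *\<^sub>R x) \<le> c * (q (x + t *\<^sub>R y) - t * q y)" by (simp add: algebra_simps)
      then have "r (c *\<^sub>R x) / c \<le> q (x + t *\<^sub>R y) - t * q y" using c by (simp add: field_simps)
      then show "r (c *\<^sub>R x) / c \<le> r x + e" using t by simp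
    qed
    then show "r (c *\<^sub>R x) \<le> c * r x" using c by (simp add: field_simps)
  qed
qed

text \<open>
  A minimal sublinear functional below \<open>p\<close>, which exists by Zorn's lemma, is linear.
\<close>

lemma hahn_banach_dominated:
  fixes p :: "'v::real_vector \<Rightarrow> real"
  assumes S: "subspace S" and p: "sublinear_on S p"
  shows "\<exists>I. linear_between S UNIV I \<and> (\<forall>x\<in>S. I x \<le> p x)"
proof -
  define A where "A = {q. sublinear_on S q \<and> (\<forall>x\<in>S. q x \<le> p x) \<and> (\<forall>x. x \<notin> S \<longrightarrow> q x = 0)}"
  define P where "P q r \<longleftrightarrow> (\<forall>x. r x \<le> q x)" for q r :: "'v \<Rightarrow> real"
  have sub: "sublinear_on S (\<lambda>x. if x \<in> S then q x else 0)" if "sublinear_on S q" for q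
    using that S unfolding sublinear_on_def by (simp add: subspace_add subspace_scale)
  have po: "partial_order_on A (relation_of P A)"
    by (rule partial_order_on_relation_ofI) (auto simp: P_def fun_eq_iff intro: order_trans antisym)
  have "\<exists>m\<in>A. \<forall>q\<in>A. P m q \<longrightarrow> q = m"
  proof (rule predicate_Zorn[OF po])
    fix C assume C: "C \<in> Chains (relation_of P A)"
    have CA: "C \<subseteq> A" using C unfolding Chains_def relation_of_def by blast
    have tot: "(\<forall>x. q x \<le> r x) \<or> (\<forall>x. r x \<le> q x)" if "q \<in> C" "r \<in> C" for q r
      using C that unfolding Chains_def relation_of_def P_def by blast
    show "\<exists>u\<in>A. \<forall>q\<in>C. P q u"
    proof (cases "C = {}")
      case True
      have "(\<lambda>x. if x \<in> S then p x else 0) \<in> A" using sub[OF p] by (simp add: A_def)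
      then show ?thesis using True by blast
    next
      case False
      define u where "u x = (INF q\<in>C. q x)" for x
      have bdd: "bdd_below ((\<lambda>q. q x) ` C)" if x: "x \<in> S" for x
      proof (rule bdd_belowI2)
        fix q assume "q \<in> C"
        then have q: "sublinear_on S q" "\<forall>x\<in>S. q x \<le> p x" using CA by (auto simp: A_def)
        show "- p (- x) \<le> q x"
          using sublinear_on_minus[OF q(1) S x] q(2) subspace_neg[OF S x] by fastforce
      qed
      have u_le: "u x \<le> q x" if "x \<in> S" "q \<in> C" for x q unfolding u_def by (rule cINF_lower[OF bdd]) (use that in auto)
      have u_near: "\<exists>q\<in>C. q x < u x + e" if "x \<in> S" "0 < e" for x e
      proof -
  show ?thesis using cINF_less_iff[OF False bdd[OF that(1)], of "u x + e"] that(2) unfolding u_def by simp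
      qed
      have "sublinear_on S u"
        unfolding sublinear_on_def
      proof (intro conjI ballI allI impI)
        fix x y assume x: "x \<in> S" "y \<in> S"
        show "u (x + y) \<le> u x + u y"
        proof (rule field_le_epsilon)
          fix e :: real assume "0 < e"
          then obtain q r where q: "q \<in> C" "q x < u x + e/2" and r: "r \<in> C" "r y < u y + e/2"
            using u_near[OF x(1), of "e/2"] u_near[OF x(2), of "e/2"] by auto
          obtain m where m: "m \<in> C" "m x \<le> q x" "m y \<le> r y" using tot[OF q(1) r(1)] q(1) r(1) by blast
          have "sublinear_on S m" using m(1) CA by (auto simp: A_def)
          from sublinear_onD(1)[OF this x] show "u (x + y) \<le> u x + u y + e"
            using u_le[OF subspace_add[OF S x] m(1)] m q r by linarith
        qed
      next
        fix x and t :: real assume x: "x \<in> S" and t: "0 < t"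
        have "u (t *\<^sub>R x) / t \<le> q x" if "q \<in> C" for q
        proof -
          have "sublinear_on S q" using that CA by (auto simp: A_def)
          from sublinear_onD(2)[OF this x t] have "u (t *\<^sub>R x) \<le> t * q x"
            using u_le[OF subspace_scale[OF S x] that] by (rule order_trans[rotated])
          then show ?thesis using t by (simp add: field_simps)
        qed
        then have "u (t *\<^sub>R x) / t \<le> u x" unfolding u_def[of x] by (intro cINF_greatest False)
        then show "u (t *\<^sub>R x) \<le> t * u x" using t by (simp add: field_simps)
      qed
      moreover obtain q0 where q0: "q0 \<in> C" using False by blast
      have "u x \<le> p x" if "x \<in> S" for x using u_le[OF that q0] q0 CA that by (force simp: A_def)
      ultimately have "(\<lambda>x. if x \<in> S then u x else 0) \<in> A" using sub by (simp add: A_def)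
      moreover have "P q (\<lambda>x. if x \<in> S then u x else 0)" if "q \<in> C" for q
        using u_le that CA by (auto simp: P_def A_def)
      ultimately show ?thesis by blast
    qed
  qed
  then obtain q where qA: "q \<in> A" and min: "\<And>r. r \<in> A \<Longrightarrow> (\<And>x. r x \<le> q x) \<Longrightarrow> r = q" unfolding P_def by blast
  have q: "sublinear_on S q" and qp: "\<And>x. x \<in> S \<Longrightarrow> q x \<le> p x" and q0: "\<And>x. x \<notin> S \<Longrightarrow> q x = 0"
    using qA by (auto simp: A_def)
  have add: "q (x + y) = q x + q y" if x: "x \<in> S" and y: "y \<in> S" for x y
  proof (rule antisym)
    show "q (x + y) \<le> q x + q y" using sublinear_onD(1)[OF q x y] .
    define r where "r x = (INF t\<in>{0..}. q (x + t *\<^sub>R y) - t * q y)" for x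
    note r = sublinear_shift[OF q S y, folded r_def]
    have "(\<lambda>x. if x \<in> S then r x else 0) = q"
    proof (rule min)
      show "(\<lambda>x. if x \<in> S then r x else 0) \<in> A"
        using sub[OF r(1)] r(2) qp by (force simp: A_def)
      show "(if x \<in> S then r x else 0) \<le> q x" for x using r(2) q0 by simp
    qed
    from fun_cong[OF this, of x] have "r x = q x" using x by simp
    then show "q x + q y \<le> q (x + y)" using r(3)[OF x] by simp
  qed
  have neg: "q (- x) = - q x" if "x \<in> S" for x
    using add[OF that subspace_neg[OF S that]] sublinear_on_0[OF q S] by simp
  have "q (c *\<^sub>R x) = c * q x" if x: "x \<in> S" for c x
  proof -
    consider "c = 0" | "c > 0" | "c < 0" by linarith
    then show ?thesis
    proof cases
      case 3
      then have "q ((- c) *\<^sub>R x) = (- c) * q x" using sublinear_on_scale[OF q S x, of "- c"] by simp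
      then show ?thesis using neg[OF subspace_scale[OF S x, of c]] by simp
    qed (use sublinear_on_0[OF q S] sublinear_on_scale[OF q S x] in auto)
  qed
  then have "linear_between S UNIV q" using add unfolding linear_between_def by simp
  then show ?thesis using qp by blast
qed

section \<open>Means separating an \<open>l1\<close> sequence\<close>

definition bounded_on :: "'a set \<Rightarrow> ('a \<Rightarrow> real) set"
  where "bounded_on T = {g. \<exists>M. \<forall>x\<in>T. \<bar>g x\<bar> \<le> M}"

definition mean_on :: "'a set \<Rightarrow> (('a \<Rightarrow> real) \<Rightarrow> real) \<Rightarrow> bool"
  where "mean_on T I \<longleftrightarrow> linear_between (bounded_on T) UNIV I \<and>
    (\<forall>g\<in>bounded_on T. \<forall>c. (\<forall>x\<in>T. g x \<le> c) \<longrightarrow> I g \<le> c)"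

lemma bounded_on_const: "(\<lambda>x. c) \<in> bounded_on T" by (auto simp: bounded_on_def)

lemma bounded_on_add: "g \<in> bounded_on T \<Longrightarrow> h \<in> bounded_on T \<Longrightarrow> (\<lambda>x. g x + h x) \<in> bounded_on T"
  unfolding bounded_on_def by clarify (metis abs_triangle_ineq add_mono order_trans)

lemma bounded_on_cmult: "g \<in> bounded_on T \<Longrightarrow> (\<lambda>x. c * g x) \<in> bounded_on T"
  unfolding bounded_on_def by clarify (metis abs_ge_zero abs_mult mult_left_mono)

lemma bounded_on_diff: "g \<in> bounded_on T \<Longrightarrow> h \<in> bounded_on T \<Longrightarrow> (\<lambda>x. g x - h x) \<in> bounded_on T"
  using bounded_on_add[of g T "\<lambda>x. (-1) * h x"] bounded_on_cmult[of h T "-1"] by simp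

lemma bounded_on_abs: "g \<in> bounded_on T \<Longrightarrow> (\<lambda>x. \<bar>g x\<bar>) \<in> bounded_on T"
  by (auto simp: bounded_on_def)

lemma bounded_on_sum:
  "(\<And>i. i \<in> A \<Longrightarrow> g i \<in> bounded_on T) \<Longrightarrow> (\<lambda>x. \<Sum>i\<in>A. g i x) \<in> bounded_on T"
  by (induction A rule: infinite_finite_induct) (auto intro: bounded_on_const bounded_on_add)

lemma subspace_bounded_on: "subspace (bounded_on T)"
  unfolding subspace_def plus_fun_def scaleR_fun_def zero_fun_def
  by (auto intro: bounded_on_const bounded_on_add bounded_on_cmult)

context
  fixes T :: "'a set" and I
  assumes I: "mean_on T I"
begin

lemma mean_upper: "g \<in> bounded_on T \<Longrightarrow> (\<And>x. x \<in> T \<Longrightarrow> g x \<le> c) \<Longrightarrow> I g \<le> c"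
  using I by (auto simp: mean_on_def)

lemma mean_add:
  assumes "g \<in> bounded_on T" "h \<in> bounded_on T"
  shows "I (\<lambda>x. g x + h x) = I g + I h"
proof -
  have "I (g + h) = I g + I h" using I assms by (auto simp: mean_on_def linear_between_def)
  then show ?thesis by (simp add: plus_fun_def)
qed

lemma mean_cmult:
  assumes "g \<in> bounded_on T"
  shows "I (\<lambda>x. c * g x) = c * I g"
proof -
  have "I (c *\<^sub>R g) = c * I g" using I assms by (auto simp: mean_on_def linear_between_def)
  then show ?thesis by (simp add: scaleR_fun_def)
qed

lemma mean_diff:
  assumes "g \<in> bounded_on T" "h \<in> bounded_on T"
  shows "I (\<lambda>x. g x - h x) = I g - I h"
  using mean_add[OF assms(1) bounded_on_cmult[OF assms(2), of "-1"]] mean_cmult[OF assms(2), of "-1"] by simp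

lemma mean_mono:
  assumes "g \<in> bounded_on T" "h \<in> bounded_on T" "\<And>x. x \<in> T \<Longrightarrow> g x \<le> h x"
  shows "I g \<le> I h"
  using mean_upper[OF bounded_on_diff[OF assms(1,2)], of 0] mean_diff[OF assms(1,2)] assms(3) by simp

lemma mean_const: "I (\<lambda>x. c) = c"
proof (rule antisym)
  show "I (\<lambda>x. c) \<le> c" by (rule mean_upper) (auto intro: bounded_on_const)
  have "I (\<lambda>x. - c) \<le> - c" by (rule mean_upper) (auto intro: bounded_on_const)
  then show "c \<le> I (\<lambda>x. c)" using mean_cmult[OF bounded_on_const[of c], of "-1"] by simp
qed

lemma mean_sum:
  "finite A \<Longrightarrow> (\<And>i. i \<in> A \<Longrightarrow> g i \<in> bounded_on T) \<Longrightarrow> I (\<lambda>x. \<Sum>i\<in>A. g i x) = (\<Sum>i\<in>A. I (g i))"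
  by (induction A rule: finite_induct) (auto simp: mean_const mean_add bounded_on_sum)

end

text \<open>
  The sublinear functional \<open>p g = inf\<^bsub>u\<in>C\<^esub> sup (g + u)\<close> is finite because no member of \<open>C\<close> is bounded
  above by a negative number.  A linear functional below \<open>p\<close> is a mean, and \<open>p (- u) \<le> 0\<close> for \<open>u \<in> C\<close>.
\<close>

lemma mean_nonneg_on_cone:
  fixes C :: "('a \<Rightarrow> real) set"
  assumes CB: "C \<subseteq> bounded_on T" and zero: "(\<lambda>x. 0) \<in> C"
    and add: "\<And>u v. u \<in> C \<Longrightarrow> v \<in> C \<Longrightarrow> (\<lambda>x. u x + v x) \<in> C"
    and scale: "\<And>u t. u \<in> C \<Longrightarrow> 0 < t \<Longrightarrow> (\<lambda>x. t * u x) \<in> C"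
    and nonneg: "\<And>u e. u \<in> C \<Longrightarrow> 0 < e \<Longrightarrow> \<exists>x\<in>T. - e < u x"
  shows "\<exists>I. mean_on T I \<and> (\<forall>u\<in>C. 0 \<le> I u)"
proof -
  define D where "D g = {c. \<exists>u\<in>C. \<forall>x\<in>T. g x + u x \<le> c}" for g
  define p where "p g = Inf (D g)" for g
  have ne: "D g \<noteq> {}" if "g \<in> bounded_on T" for g
    using that zero unfolding D_def bounded_on_def by (force simp: abs_le_iff)
  have bdd: "bdd_below (D g)" if g: "g \<in> bounded_on T" for g
  proof -
    obtain M where M: "\<forall>x\<in>T. \<bar>g x\<bar> \<le> M" using g by (auto simp: bounded_on_def)
    have "- M - 1 \<le> c" if c: "c \<in> D g" for c
    proof -
      obtain u where u: "u \<in> C" "\<forall>x\<in>T. g x + u x \<le> c" using c by (auto simp: D_def)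
      obtain x where "x \<in> T" "- 1 < u x" using nonneg[OF u(1), of 1] by auto
      then show ?thesis using u(2) M by (smt (verit))
    qed
    then show ?thesis by (auto simp: bdd_below_def)
  qed
  have p_le: "p g \<le> c" if "g \<in> bounded_on T" "c \<in> D g" for g c
    unfolding p_def by (rule cInf_lower[OF that(2) bdd[OF that(1)]])
  have p_near: "\<exists>c\<in>D g. c < p g + e" if "g \<in> bounded_on T" "0 < e" for g e
    using cInf_less_iff[OF ne bdd, OF that(1) that(1), of "p g + e"] that(2) unfolding p_def by simp
  have "sublinear_on (bounded_on T) p"
    unfolding sublinear_on_def
  proof (intro conjI ballI allI impI)
    fix g h :: "'a \<Rightarrow> real" assume gh: "g \<in> bounded_on T" "h \<in> bounded_on T"
    show "p (g + h) \<le> p g + p h"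
    proof (rule field_le_epsilon)
      fix e :: real assume "0 < e"
      then obtain c d where c: "c \<in> D g" "c < p g + e/2" and d: "d \<in> D h" "d < p h + e/2"
        using p_near[OF gh(1), of "e/2"] p_near[OF gh(2), of "e/2"] by auto
      obtain u v where u: "u \<in> C" "\<forall>x\<in>T. g x + u x \<le> c" and v: "v \<in> C" "\<forall>x\<in>T. h x + v x \<le> d"
        using c d by (auto simp: D_def)
      have "c + d \<in> D (g + h)" unfolding D_def
        using add[OF u(1) v(1)] u(2) v(2) by (auto intro!: bexI[of _ "\<lambda>x. u x + v x"]) (smt (verit))
      then have "p (g + h) \<le> c + d" by (rule p_le[OF subspace_add[OF subspace_bounded_on gh]])
      then show "p (g + h) \<le> p g + p h + e" using c d by simp
    qed
  next
    fix g :: "'a \<Rightarrow> real" and t :: real assume g: "g \<in> bounded_on T" and t: "0 < t"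
    have "p (t *\<^sub>R g) / t \<le> p g"
    proof (rule field_le_epsilon)
      fix e :: real assume "0 < e"
      then obtain c where c: "c \<in> D g" "c < p g + e" using p_near[OF g] by auto
      obtain u where u: "u \<in> C" "\<forall>x\<in>T. g x + u x \<le> c" using c by (auto simp: D_def)
      have "t * g x + t * u x \<le> t * c" if "x \<in> T" for x
        using mult_left_mono[OF u(2)[rule_format, OF that], of t] t by (simp add: distrib_left)
      then have "t * c \<in> D (t *\<^sub>R g)" unfolding D_def
        using scale[OF u(1) t] by (auto simp: scaleR_fun_def intro!: bexI[of _ "\<lambda>x. t * u x"])
      then have "p (t *\<^sub>R g) \<le> t * c" by (rule p_le[OF subspace_scale[OF subspace_bounded_on g]])
      then have "p (t *\<^sub>R g) / t \<le> c" using t by (simp add: field_simps)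
      then show "p (t *\<^sub>R g) / t \<le> p g + e" using c by simp
    qed
    then show "p (t *\<^sub>R g) \<le> t * p g" using t by (simp add: field_simps)
  qed
  from hahn_banach_dominated[OF subspace_bounded_on this]
  obtain I where I: "linear_between (bounded_on T) UNIV I" "\<And>g. g \<in> bounded_on T \<Longrightarrow> I g \<le> p g" by blast
  have "I g \<le> c" if g: "g \<in> bounded_on T" "\<forall>x\<in>T. g x \<le> c" for g c
  proof -
    have "c \<in> D g" unfolding D_def using g(2) by (auto intro!: bexI[OF _ zero])
    then show ?thesis using p_le[OF g(1)] I(2)[OF g(1)] by fastforce
  qed
  then have m: "mean_on T I" using I(1) by (simp add: mean_on_def)
  have "0 \<le> I u" if u: "u \<in> C" for u
  proof -
    have uB: "u \<in> bounded_on T" using u CB by blast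
    have uB': "(\<lambda>x. (-1) * u x) \<in> bounded_on T" by (rule bounded_on_cmult[OF uB])
    have "0 \<in> D (\<lambda>x. (-1) * u x)" using u by (auto simp: D_def)
    then have "I (\<lambda>x. (-1) * u x) \<le> 0" using p_le[OF uB'] I(2)[OF uB'] by fastforce
    then show ?thesis using mean_cmult[OF m uB, of "-1"] by simp
  qed
  then show ?thesis using m by blast
qed

text \<open>
  A greedy cut: of the two signs for the next vertex one cuts at least half of its edges to the
  earlier vertices.  On a cut edge \<open>\<bar>s k - s l\<bar>\<close> is \<open>2\<close>, which makes up for the half.
\<close>

lemma max_cut_at_least_half:
  fixes wt :: "nat \<Rightarrow> nat \<Rightarrow> real"
  assumes "\<And>k l. 0 \<le> wt k l"
  shows "\<exists>s :: nat \<Rightarrow> real. (\<forall>k. s k = 1 \<or> s k = -1) \<and>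
    (\<Sum>k<n. \<Sum>l<k. wt k l) \<le> (\<Sum>k<n. \<Sum>l<k. wt k l * \<bar>s k - s l\<bar>)"
proof (induction n)
  case 0
  show ?case by (intro exI[of _ "\<lambda>_. 1"]) simp
next
  case (Suc n)
  then obtain s :: "nat \<Rightarrow> real" where s: "\<And>k. s k = 1 \<or> s k = -1"
    and le: "(\<Sum>k<n. \<Sum>l<k. wt k l) \<le> (\<Sum>k<n. \<Sum>l<k. wt k l * \<bar>s k - s l\<bar>)" by blast
  have "(\<Sum>l<n. wt n l * \<bar>1 - s l\<bar>) + (\<Sum>l<n. wt n l * \<bar>-1 - s l\<bar>) = (\<Sum>l<n. 2 * wt n l)"
    unfolding sum.distrib[symmetric]
  proof (intro sum.cong refl)
    fix l show "wt n l * \<bar>1 - s l\<bar> + wt n l * \<bar>-1 - s l\<bar> = 2 * wt n l" using s[of l] by auto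
  qed
  then have "(\<Sum>l<n. wt n l) \<le> (\<Sum>l<n. wt n l * \<bar>1 - s l\<bar>) \<or> (\<Sum>l<n. wt n l) \<le> (\<Sum>l<n. wt n l * \<bar>-1 - s l\<bar>)"
    by (simp add: sum_distrib_left[symmetric]) linarith
  then obtain r :: real where r: "r = 1 \<or> r = -1" "(\<Sum>l<n. wt n l) \<le> (\<Sum>l<n. wt n l * \<bar>r - s l\<bar>)" by blast
  have "(\<Sum>k<n. \<Sum>l<k. wt k l * \<bar>(s(n := r)) k - (s(n := r)) l\<bar>) = (\<Sum>k<n. \<Sum>l<k. wt k l * \<bar>s k - s l\<bar>)"
    by (intro sum.cong refl) auto
  moreover have "(\<Sum>l<n. wt n l * \<bar>(s(n := r)) n - (s(n := r)) l\<bar>) = (\<Sum>l<n. wt n l * \<bar>r - s l\<bar>)"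
    by (intro sum.cong refl) auto
  ultimately have "(\<Sum>k<Suc n. \<Sum>l<k. wt k l) \<le> (\<Sum>k<Suc n. \<Sum>l<k. wt k l * \<bar>(s(n := r)) k - (s(n := r)) l\<bar>)"
    using le r(2) by simp
  then show ?case using s r(1) by (intro exI[of _ "s(n := r)"]) auto
qed

lemma sum_differences_as_combination:
  fixes \<mu> :: "nat \<Rightarrow> nat \<Rightarrow> real"
  shows "\<exists>c. \<forall>y :: nat \<Rightarrow> real. (\<Sum>k<n. \<Sum>l<k. \<mu> k l * (y k - y l)) = (\<Sum>k<n. c k * y k)"
proof (induction n)
  case (Suc n)
  then obtain c where c: "\<And>y :: nat \<Rightarrow> real. (\<Sum>k<n. \<Sum>l<k. \<mu> k l * (y k - y l)) = (\<Sum>k<n. c k * y k)" by blast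
  define c' where "c' k = (if k = n then (\<Sum>l<n. \<mu> n l) else c k - \<mu> n k)" for k
  have "(\<Sum>k<Suc n. \<Sum>l<k. \<mu> k l * (y k - y l)) = (\<Sum>k<Suc n. c' k * y k)" for y :: "nat \<Rightarrow> real"
  proof -
    have "(\<Sum>k<n. c' k * y k) = (\<Sum>k<n. c k * y k - \<mu> n k * y k)"
      by (intro sum.cong) (auto simp: c'_def left_diff_distrib)
    then show ?thesis using c[of y]
      by (simp add: c'_def sum_subtractf sum_distrib_right right_diff_distrib)
  qed
  then show ?case by blast
qed simp

text \<open>
  By the preceding construction of means it suffices that for weights \<open>wt \<ge> 0\<close> the weighted average of
  the functions \<open>\<bar>w\<^sub>k - w\<^sub>l\<bar>\<close> is somewhere almost as large as \<open>\<delta>\<close>.  It dominates the modulus of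
  \<open>\<Sum> wt\<^bsub>kl\<^esub> (s\<^sub>k - s\<^sub>l) / 2 (w\<^sub>k - w\<^sub>l)\<close> for every choice of signs \<open>s\<close>.  Written as a combination of
  the \<open>w\<^sub>k\<close>, this has coefficients whose moduli add up to at least twice the weight of the cut given by \<open>s\<close>,
  so for a good cut the \<open>l1\<close> estimate suffices.
\<close>

lemma mean_separating_l1_sequence:
  fixes w :: "nat \<Rightarrow> 'a \<Rightarrow> real"
  assumes M: "\<And>k x. x \<in> T \<Longrightarrow> \<bar>w k x\<bar> \<le> M" and \<delta>: "0 < \<delta>"
    and low: "\<And>n c e. 0 < e \<Longrightarrow> \<exists>x\<in>T. \<delta> * (\<Sum>k<n. \<bar>c k\<bar>) - e < \<bar>\<Sum>k<n. c k * w k x\<bar>"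
  shows "\<exists>I. mean_on T I \<and> (\<forall>k. \<forall>l<k. \<delta> \<le> I (\<lambda>x. \<bar>w k x - w l x\<bar>))"
proof -
  have wB: "w k \<in> bounded_on T" for k using M by (auto simp: bounded_on_def)
  define U where "U n wt x = (\<Sum>k<n. \<Sum>l<k. wt k l * (\<bar>w k x - w l x\<bar> - \<delta>))" for n wt x
  define C where "C = {u. \<exists>n wt. (\<forall>k l. 0 \<le> wt k l) \<and> u = U n wt}"
  have CI: "u \<in> C" if "u = U n wt" "\<forall>k l. 0 \<le> wt k l" for u n wt
    unfolding C_def using that by blast
  have UB: "U n wt \<in> bounded_on T" for n wt
    unfolding U_def by (intro bounded_on_sum bounded_on_cmult bounded_on_diff bounded_on_abs bounded_on_const wB)
  have pad: "\<exists>wt'. (\<forall>k l. 0 \<le> wt' k l) \<and> U n wt = U m wt'" if "n \<le> m" "\<forall>k l. 0 \<le> wt k l" for n m wt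
  proof -
    have "U n wt x = U m (\<lambda>k l. if k < n then wt k l else 0) x" for x
      unfolding U_def by (rule sum.mono_neutral_cong_left) (use that(1) in auto)
    then show ?thesis using that(2) by (intro exI[of _ "\<lambda>k l. if k < n then wt k l else 0"]) auto
  qed
  have nonneg: "\<exists>x\<in>T. - e < U n wt x" if wt: "\<forall>k l. 0 \<le> wt k l" and e: "0 < e" for n wt e
  proof -
    obtain s :: "nat \<Rightarrow> real" where s: "\<And>k. s k = 1 \<or> s k = -1"
      and cut: "(\<Sum>k<n. \<Sum>l<k. wt k l) \<le> (\<Sum>k<n. \<Sum>l<k. wt k l * \<bar>s k - s l\<bar>)"
      using max_cut_at_least_half[of wt n] wt by blast
    obtain c where c: "\<And>y :: nat \<Rightarrow> real. (\<Sum>k<n. \<Sum>l<k. wt k l * (s k - s l) / 2 * (y k - y l)) = (\<Sum>k<n. c k * y k)"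
      using sum_differences_as_combination[of "\<lambda>k l. wt k l * (s k - s l) / 2" n] by blast
    have "(\<Sum>k<n. \<Sum>l<k. wt k l * \<bar>s k - s l\<bar>) = (\<Sum>k<n. \<Sum>l<k. wt k l * (s k - s l) / 2 * (s k - s l))"
    proof (intro sum.cong refl)
      fix k l
      have "\<bar>s k - s l\<bar> = (s k - s l) / 2 * (s k - s l)" using s[of k] s[of l] by auto
      then show "wt k l * \<bar>s k - s l\<bar> = wt k l * (s k - s l) / 2 * (s k - s l)" by simp
    qed
    also have "\<dots> = (\<Sum>k<n. c k * s k)" by (rule c)
    also have "\<dots> \<le> (\<Sum>k<n. \<bar>c k\<bar>)"
    proof (intro sum_mono)
      fix k show "c k * s k \<le> \<bar>c k\<bar>" using s[of k] by auto
    qed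
    finally have "\<delta> * (\<Sum>k<n. \<Sum>l<k. wt k l) \<le> \<delta> * (\<Sum>k<n. \<bar>c k\<bar>)" using cut \<delta> by simp
    moreover obtain x where x: "x \<in> T" "\<delta> * (\<Sum>k<n. \<bar>c k\<bar>) - e < \<bar>\<Sum>k<n. c k * w k x\<bar>" using low[OF e] by blast
    moreover have "\<bar>\<Sum>k<n. c k * w k x\<bar> \<le> (\<Sum>k<n. \<Sum>l<k. wt k l * \<bar>w k x - w l x\<bar>)"
    proof -
      have "\<bar>\<Sum>k<n. c k * w k x\<bar> = \<bar>\<Sum>k<n. \<Sum>l<k. wt k l * (s k - s l) / 2 * (w k x - w l x)\<bar>"
        using c[of "\<lambda>k. w k x"] by simp
      also have "\<dots> \<le> (\<Sum>k<n. \<Sum>l<k. \<bar>wt k l * (s k - s l) / 2 * (w k x - w l x)\<bar>)"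
        by (intro order_trans[OF sum_abs] sum_mono sum_abs)
      also have "\<dots> \<le> (\<Sum>k<n. \<Sum>l<k. wt k l * \<bar>w k x - w l x\<bar>)"
      proof (intro sum_mono)
        fix k l
        have "\<bar>(s k - s l) / 2\<bar> \<le> 1" using s[of k] s[of l] by auto
        then have "wt k l * \<bar>(s k - s l) / 2\<bar> * \<bar>w k x - w l x\<bar> \<le> wt k l * 1 * \<bar>w k x - w l x\<bar>"
          using wt by (intro mult_right_mono mult_left_mono) auto
        then show "\<bar>wt k l * (s k - s l) / 2 * (w k x - w l x)\<bar> \<le> wt k l * \<bar>w k x - w l x\<bar>"
          using wt by (simp add: abs_mult)
      qed
      finally show ?thesis .
    qed
    moreover have "U n wt x = (\<Sum>k<n. \<Sum>l<k. wt k l * \<bar>w k x - w l x\<bar>) - \<delta> * (\<Sum>k<n. \<Sum>l<k. wt k l)"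
      unfolding U_def by (simp add: right_diff_distrib sum_subtractf sum_distrib_left mult.commute)
    ultimately show ?thesis by (intro bexI[of _ x]) linarith+
  qed
  have "\<exists>I. mean_on T I \<and> (\<forall>u\<in>C. 0 \<le> I u)"
  proof (rule mean_nonneg_on_cone)
    show "C \<subseteq> bounded_on T" using UB by (auto simp: C_def)
    show "(\<lambda>x. 0) \<in> C" unfolding C_def by (auto simp: U_def intro!: exI[of _ 0] exI[of _ "\<lambda>_ _. 0"])
    show "(\<lambda>x. u x + v x) \<in> C" if uv: "u \<in> C" "v \<in> C" for u v
    proof -
      obtain n wt n' wt' where 1: "\<forall>k l. 0 \<le> wt k l" "u = U n wt" "\<forall>k l. 0 \<le> wt' k l" "v = U n' wt'"
        using uv by (auto simp: C_def)
      obtain wu where wu: "\<forall>k l. 0 \<le> wu k l" "u = U (max n n') wu" using pad[of n "max n n'" wt] 1 by auto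
      obtain wu' where wu': "\<forall>k l. 0 \<le> wu' k l" "v = U (max n n') wu'" using pad[of n' "max n n'" wt'] 1 by auto
      have "(\<lambda>x. u x + v x) = U (max n n') (\<lambda>k l. wu k l + wu' k l)"
        unfolding wu(2) wu'(2) U_def by (simp only: sum.distrib distrib_right)
      moreover have "\<forall>k l. 0 \<le> wu k l + wu' k l" using wu(1) wu'(1) by simp
      ultimately show ?thesis by (rule CI)
    qed
    show "(\<lambda>x. t * u x) \<in> C" if u: "u \<in> C" "0 < t" for u t
    proof -
      obtain n wt where 1: "\<forall>k l. 0 \<le> wt k l" "u = U n wt" using u by (auto simp: C_def)
      have "(\<lambda>x. t * u x) = U n (\<lambda>k l. t * wt k l)" unfolding 1(2) U_def by (simp only: sum_distrib_left mult.assoc)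
      moreover have "\<forall>k l. 0 \<le> t * wt k l" using 1 u(2) by simp
      ultimately show ?thesis by (rule CI)
    qed
    show "\<exists>x\<in>T. - e < u x" if "u \<in> C" "0 < e" for u e using nonneg that by (auto simp: C_def)
  qed
  then obtain I where I: "mean_on T I" "\<And>u. u \<in> C \<Longrightarrow> 0 \<le> I u" by blast
  have "\<delta> \<le> I (\<lambda>x. \<bar>w k x - w l x\<bar>)" if "l < k" for k l
  proof -
    have B: "(\<lambda>x. \<bar>w k x - w l x\<bar>) \<in> bounded_on T" by (intro bounded_on_diff bounded_on_abs wB)
    define wt :: "nat \<Rightarrow> nat \<Rightarrow> real" where "wt k' l' = (if k' = k \<and> l' = l then 1 else 0)" for k' l'
    have "U (Suc k) wt x = \<bar>w k x - w l x\<bar> - \<delta>" for x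
    proof -
      have "(\<Sum>l'<k. wt k l' * (\<bar>w k x - w l' x\<bar> - \<delta>)) = (\<Sum>l'<k. if l' = l then \<bar>w k x - w l x\<bar> - \<delta> else 0)"
        by (intro sum.cong) (auto simp: wt_def)
      then show ?thesis using that by (simp add: U_def wt_def)
    qed
    then have "(\<lambda>x. \<bar>w k x - w l x\<bar> - \<delta>) = U (Suc k) wt" by auto
    moreover have "\<forall>k l. 0 \<le> wt k l" by (simp add: wt_def)
    ultimately have "(\<lambda>x. \<bar>w k x - w l x\<bar> - \<delta>) \<in> C" by (rule CI)
    from I(2)[OF this] show ?thesis
      using mean_diff[OF I(1) B bounded_on_const, of \<delta>] mean_const[OF I(1), of \<delta>] by simp
  qed
  then show ?thesis using I(1) by blast
qed

section \<open>Bounded convergence for means\<close>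

primrec running_max :: "(nat \<Rightarrow> 'a \<Rightarrow> real) \<Rightarrow> nat \<Rightarrow> nat \<Rightarrow> 'a \<Rightarrow> real"
  where "running_max h j 0 = h j"
  | "running_max h j (Suc m) = (\<lambda>x. max (running_max h j m x) (h (j + Suc m) x))"

lemma running_max_ge: "i \<le> m \<Longrightarrow> h (j + i) x \<le> running_max h j m x"
  by (induction m) (auto simp: le_Suc_eq le_max_iff_disj)

lemma running_max_mono: "m \<le> n \<Longrightarrow> running_max h j m x \<le> running_max h j n x"
  by (induction n) (auto simp: le_Suc_eq le_max_iff_disj)

lemma running_max_attained: "\<exists>i\<ge>j. running_max h j m x = h i x"
proof (induction m)
  case (Suc m)
  then obtain i where i: "i \<ge> j" "running_max h j m x = h i x" by blast
  show ?case
  proof (cases "h i x \<le> h (j + Suc m) x")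
    case True
    then show ?thesis using i by (intro exI[of _ "j + Suc m"]) (simp add: max_def)
  next
    case False
    then show ?thesis using i by (intro exI[of _ i]) (simp add: max_def)
  qed
qed auto

lemma running_max_abs_le: "(\<And>k. \<bar>h k x\<bar> \<le> M) \<Longrightarrow> \<bar>running_max h j m x\<bar> \<le> M"
  using running_max_attained[of j h m x] by metis

lemma running_max_continuous:
  "(\<And>k. continuous_map X euclideanreal (h k)) \<Longrightarrow> continuous_map X euclideanreal (running_max h j m)"
  by (induction m) (auto intro: continuous_map_real_max)

text \<open>
  The bounded convergence theorem without measures.  Finite maxima \<open>G\<^sub>j\<close> of \<open>h\<^sub>j, h\<^bsub>j+1\<^esub>, \<dots>\<close>
  whose mean is within \<open>e / 2\<^bsup>j+1\<^esup>\<close> of the supremum of all such means are all at least \<open>\<eta>'\<close> at a common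
  point, first for finitely many \<open>j\<close> by comparing means and then for all \<open>j\<close> by compactness.
\<close>

lemma mean_frequently_large:
  fixes h :: "nat \<Rightarrow> 'a \<Rightarrow> real"
  assumes X: "compact_space X" and I: "mean_on (topspace X) I"
    and cont: "\<And>k. continuous_map X euclideanreal (h k)"
    and M: "\<And>k x. x \<in> topspace X \<Longrightarrow> \<bar>h k x\<bar> \<le> M"
    and large: "\<And>k. \<eta> \<le> I (h k)" and \<eta>': "\<eta>' < \<eta>"
  shows "\<exists>x\<in>topspace X. \<exists>\<^sub>F k in sequentially. \<eta>' \<le> h k x"
proof -
  let ?T = "topspace X" and ?B = "bounded_on (topspace X)"
  define R where "R = running_max h"
  have hB: "h k \<in> ?B" for k using M by (auto simp: bounded_on_def)
  have RM: "\<bar>R j m x\<bar> \<le> M" if "x \<in> ?T" for j m x unfolding R_def by (rule running_max_abs_le) (rule M[OF that])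
  have RB: "R j m \<in> ?B" for j m using RM by (auto simp: bounded_on_def)
  define e where "e = \<eta> - \<eta>'"
  have e: "0 < e" using \<eta>' by (simp add: e_def)
  have "\<exists>m. \<forall>n. I (R j n) \<le> I (R j m) + e / 2 ^ Suc j" for j
  proof -
    have bdd: "bdd_above (range (\<lambda>m. I (R j m)))"
      by (rule bdd_aboveI2, rule mean_upper[OF I RB, where c = M]) (use RM in \<open>auto simp: abs_le_iff\<close>)
    have "(SUP m. I (R j m)) - e / 2 ^ Suc j < (SUP m. I (R j m))" using e by simp
    then obtain m where m: "(SUP m. I (R j m)) - e / 2 ^ Suc j < I (R j m)"
      using less_cSUP_iff[OF _ bdd] by auto
    have "I (R j n) \<le> (SUP m. I (R j m))" for n by (rule cSUP_upper[OF _ bdd]) simp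
    then show ?thesis using m by (intro exI[of _ m]) (smt (verit))
  qed
  then obtain m where m: "\<And>j n. I (R j n) \<le> I (R j (m j)) + e / 2 ^ Suc j" by metis
  define G where "G j = R j (m j)" for j
  have stage: "\<exists>x\<in>?T. \<forall>j<n. \<eta>' \<le> G j x" for n
  proof (rule ccontr)
    assume no: "\<not> ?thesis"
    \<comment> \<open>An index beyond all the maxima involved in \<open>G\<^sub>0, \<dots>, G\<^bsub>n-1\<^esub>\<close>.\<close>
    define p where "p = n + (\<Sum>j<n. m j)"
    have mp: "m j \<le> p - j" if "j < n" for j
    proof -
      have "m j \<le> (\<Sum>j<n. m j)" using that by (intro member_le_sum) auto
      then show ?thesis using that by (simp add: p_def)
    qed
    have gap: "0 \<le> R j (p - j) x - G j x" if "j < n" for j x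
      using running_max_mono[OF mp[OF that], of h j x] by (simp add: R_def G_def)
    \<comment> \<open>Where some \<open>G\<^sub>j\<close> is below \<open>\<eta>'\<close>, the function \<open>h\<^sub>p\<close> exceeds \<open>\<eta>'\<close> by no more than the increase from
        \<open>G\<^sub>j\<close> to a longer maximum, and these increases have small means.\<close>
    have le: "h p x \<le> \<eta>' + (\<Sum>j<n. R j (p - j) x - G j x)" if x: "x \<in> ?T" for x
    proof -
      obtain j where j: "j < n" "G j x < \<eta>'" using no x by (meson not_le)
      have "h p x \<le> R j (p - j) x"
        using running_max_ge[of "p - j" "p - j" h j x] j(1) by (simp add: R_def p_def)
      moreover have "R j (p - j) x - G j x \<le> (\<Sum>j<n. R j (p - j) x - G j x)"
        using j(1) gap by (intro member_le_sum) auto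
      ultimately show ?thesis using j(2) by linarith
    qed
    have dB: "(\<lambda>x. R j (p - j) x - G j x) \<in> ?B" for j unfolding G_def by (intro bounded_on_diff RB)
    have "I (h p) \<le> I (\<lambda>x. \<eta>' + (\<Sum>j<n. R j (p - j) x - G j x))"
      by (rule mean_mono[OF I hB bounded_on_add[OF bounded_on_const bounded_on_sum[OF dB]] le])
    also have "\<dots> = \<eta>' + (\<Sum>j<n. I (R j (p - j)) - I (G j))"
      using mean_add[OF I bounded_on_const bounded_on_sum[OF dB], of \<eta>' "\<lambda>j. j" "{..<n}"]
        mean_const[OF I, of \<eta>'] mean_sum[OF I finite_lessThan dB, of "\<lambda>j. j" n]
        mean_diff[OF I RB, of "G _"] RB unfolding G_def by simp
    also have "(\<Sum>j<n. I (R j (p - j)) - I (G j)) \<le> (\<Sum>j<n. e / 2 ^ Suc j)"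
      using m by (intro sum_mono) (simp add: G_def algebra_simps)
    also have "(\<Sum>j<n. e / 2 ^ Suc j) = e * (1 - 1 / 2 ^ n)"
      by (induction n) (auto simp: field_simps)
    also have "\<dots> < e" using e by (simp add: field_simps)
    finally show False using large[of p] by (simp add: e_def)
  qed
  have closed: "closedin X {x \<in> ?T. \<eta>' \<le> G j x}" for j
  proof -
    have "continuous_map X euclideanreal (G j)"
      unfolding G_def R_def by (rule running_max_continuous[OF cont])
    from closedin_continuous_map_preimage[OF this, of "{\<eta>'..}"] show ?thesis by simp
  qed
  have "?T \<inter> \<Inter>(range (\<lambda>j. {x \<in> ?T. \<eta>' \<le> G j x})) \<noteq> {}"
  proof (rule compactin_fip[THEN iffD1, THEN conjunct2, rule_format])
    show "compactin X ?T" using X by (simp add: compact_space_def)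
    show "(\<forall>C\<in>range (\<lambda>j. {x \<in> ?T. \<eta>' \<le> G j x}). closedin X C) \<and>
      (\<forall>\<F>. finite \<F> \<and> \<F> \<subseteq> range (\<lambda>j. {x \<in> ?T. \<eta>' \<le> G j x}) \<longrightarrow> ?T \<inter> \<Inter>\<F> \<noteq> {})"
    proof (intro conjI ballI allI impI)
      fix \<F> assume "finite \<F> \<and> \<F> \<subseteq> range (\<lambda>j. {x \<in> ?T. \<eta>' \<le> G j x})"
      then obtain J where J: "finite J" "\<F> = (\<lambda>j. {x \<in> ?T. \<eta>' \<le> G j x}) ` J" by (meson finite_subset_image)
      obtain n where "\<forall>j\<in>J. j < n" using J(1) finite_nat_set_iff_bounded by blast
      then show "?T \<inter> \<Inter>\<F> \<noteq> {}" using stage[of n] J(2) by auto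
    qed (use closed in auto)
  qed
  then obtain x where x: "x \<in> ?T" "\<And>j. \<eta>' \<le> G j x" by auto
  have "\<exists>i\<ge>j. \<eta>' \<le> h i x" for j
    using running_max_attained[of j h "m j" x] x(2)[of j] unfolding G_def R_def by metis
  then show ?thesis using x(1) by (auto simp: frequently_sequentially)
qed

section \<open>Bounded combinations of a family with small oscillation\<close>

text \<open>
  The weight \<open>s\<close> belongs to a representation of \<open>w\<close>, not to \<open>w\<close> itself.  The inductive form makes
  sums of combinations a plain induction, without merging index sets.
\<close>

inductive combination :: "'v::real_vector set \<Rightarrow> real \<Rightarrow> 'v \<Rightarrow> bool" for F
  where zero: "combination F 0 0"
  | step: "combination F s w \<Longrightarrow> f \<in> F \<Longrightarrow> combination F (s + \<bar>c\<bar>) (w + c *\<^sub>R f)"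

lemma combination_nonneg: "combination F s w \<Longrightarrow> 0 \<le> s"
  by (induction rule: combination.induct) auto

lemma combination_add:
  assumes "combination F s v" "combination F t w"
  shows "combination F (s + t) (v + w)"
  using assms(2)
proof (induction rule: combination.induct)
  case (step t w f c)
  from combination.step[OF step.IH step.hyps(2), of c] show ?case by (simp add: add.assoc)
qed (simp add: assms(1))

lemma combination_scale:
  assumes "combination F s w"
  shows "combination F (\<bar>r\<bar> * s) (r *\<^sub>R w)"
  using assms
proof (induction rule: combination.induct)
  case (step s w f c)
  from combination.step[OF step.IH step.hyps(2), of "r * c"] show ?case
    by (simp add: abs_mult distrib_left scaleR_add_right)
qed (use combination.zero in simp)

lemma combination_bound:
  assumes "combination F s w" "\<And>f. f \<in> F \<Longrightarrow> \<bar>f x\<bar> \<le> M"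
  shows "\<bar>w x\<bar> \<le> s * M"
  using assms(1)
proof (induction rule: combination.induct)
  case (step s w f c)
  have "\<bar>(w + c *\<^sub>R f) x\<bar> \<le> \<bar>w x\<bar> + \<bar>c\<bar> * \<bar>f x\<bar>" by (simp add: scaleR_fun_def abs_mult[symmetric] abs_triangle_ineq)
  also have "\<dots> \<le> s * M + \<bar>c\<bar> * M" using step.IH assms(2)[OF step.hyps(2)] by (intro add_mono mult_left_mono) auto
  finally show ?case by (simp add: distrib_right)
qed simp

text \<open>
  Replace each \<open>f\<close> in the combination by a nearby member of the finite net \<open>A\<close>.
\<close>

lemma combination_approximation:
  assumes I: "mean_on T I" and FB: "F \<subseteq> bounded_on T" and A: "finite A" "A \<subseteq> F"
    and net: "\<And>f. f \<in> F \<Longrightarrow> \<exists>g\<in>A. I (\<lambda>x. \<bar>f x - g x\<bar>) \<le> \<eta>" and w: "combination F s w"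
  shows "w \<in> bounded_on T \<and> (\<exists>c. (\<Sum>g\<in>A. \<bar>c g\<bar>) \<le> s \<and> I (\<lambda>x. \<bar>w x - (\<Sum>g\<in>A. c g * g x)\<bar>) \<le> s * \<eta>)"
  using w
proof (induction rule: combination.induct)
  case zero
  show ?case
  proof (intro conjI exI[of _ "\<lambda>_. 0"])
    show "0 \<in> bounded_on T" by (rule subspace_0[OF subspace_bounded_on])
  qed (simp_all add: mean_const[OF I])
next
  case (step s w f a)
  then obtain c where c: "(\<Sum>g\<in>A. \<bar>c g\<bar>) \<le> s" "I (\<lambda>x. \<bar>w x - (\<Sum>g\<in>A. c g * g x)\<bar>) \<le> s * \<eta>" by blast
  obtain g where g: "g \<in> A" "I (\<lambda>x. \<bar>f x - g x\<bar>) \<le> \<eta>" using net[OF step.hyps(2)] by blast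
  have B: "w \<in> bounded_on T" "f \<in> bounded_on T" "g \<in> bounded_on T" "\<And>g. g \<in> A \<Longrightarrow> g \<in> bounded_on T"
    using step FB A g by auto
  define c' where "c' = c(g := c g + a)"
  have c'_sum: "(\<Sum>h\<in>A. c' h * y h) = (\<Sum>h\<in>A. c h * y h) + a * y g" for y :: "('a \<Rightarrow> real) \<Rightarrow> real"
  proof -
    have "(\<Sum>h\<in>A. c' h * y h) = (\<Sum>h\<in>A. c h * y h + (if h = g then a * y g else 0))"
      by (intro sum.cong) (auto simp: c'_def distrib_right)
    then show ?thesis using g(1) A(1) by (simp add: sum.distrib)
  qed
  have "(\<Sum>h\<in>A. \<bar>c' h\<bar>) \<le> (\<Sum>h\<in>A. \<bar>c h\<bar> + (if h = g then \<bar>a\<bar> else 0))"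
    by (intro sum_mono) (auto simp: c'_def)
  then have "(\<Sum>h\<in>A. \<bar>c' h\<bar>) \<le> s + \<bar>a\<bar>" using c(1) g(1) A(1) by (simp add: sum.distrib)
  moreover have "I (\<lambda>x. \<bar>(w + a *\<^sub>R f) x - (\<Sum>h\<in>A. c' h * h x)\<bar>) \<le> (s + \<bar>a\<bar>) * \<eta>"
  proof -
    have B1: "(\<lambda>x. \<bar>w x - (\<Sum>h\<in>A. c h * h x)\<bar>) \<in> bounded_on T"
      by (intro bounded_on_abs bounded_on_diff bounded_on_sum bounded_on_cmult B)
    have B2: "(\<lambda>x. \<bar>f x - g x\<bar>) \<in> bounded_on T" by (intro bounded_on_abs bounded_on_diff B)
    have B3: "(\<lambda>x. \<bar>(w + a *\<^sub>R f) x - (\<Sum>h\<in>A. c' h * h x)\<bar>) \<in> bounded_on T"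
      unfolding plus_fun_def scaleR_fun_def real_scaleR_def
      by (intro bounded_on_abs bounded_on_diff bounded_on_add bounded_on_sum bounded_on_cmult B)
    have "I (\<lambda>x. \<bar>(w + a *\<^sub>R f) x - (\<Sum>h\<in>A. c' h * h x)\<bar>)
        \<le> I (\<lambda>x. \<bar>w x - (\<Sum>h\<in>A. c h * h x)\<bar> + \<bar>a\<bar> * \<bar>f x - g x\<bar>)"
    proof (rule mean_mono[OF I B3 bounded_on_add[OF B1 bounded_on_cmult[OF B2]]])
      fix x
      have "(w + a *\<^sub>R f) x - (\<Sum>h\<in>A. c' h * h x) = (w x - (\<Sum>h\<in>A. c h * h x)) + a * (f x - g x)"
        using c'_sum[of "\<lambda>h. h x"] by (simp add: scaleR_fun_def algebra_simps)
      then show "\<bar>(w + a *\<^sub>R f) x - (\<Sum>h\<in>A. c' h * h x)\<bar> \<le> \<bar>w x - (\<Sum>h\<in>A. c h * h x)\<bar> + \<bar>a\<bar> * \<bar>f x - g x\<bar>"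
        by (simp only: abs_mult[symmetric] abs_triangle_ineq)
    qed
    also have "\<dots> = I (\<lambda>x. \<bar>w x - (\<Sum>h\<in>A. c h * h x)\<bar>) + \<bar>a\<bar> * I (\<lambda>x. \<bar>f x - g x\<bar>)"
      using mean_add[OF I B1 bounded_on_cmult[OF B2]] mean_cmult[OF I B2] by simp
    also have "\<dots> \<le> s * \<eta> + \<bar>a\<bar> * \<eta>" using c(2) g(2) by (intro add_mono mult_left_mono) auto
    finally show ?thesis by (simp add: distrib_right)
  qed
  moreover have "w + a *\<^sub>R f \<in> bounded_on T"
    by (intro subspace_add subspace_scale subspace_bounded_on B)
  ultimately show ?case by blast
qed

text \<open>
  Pigeonhole principle on a grid of mesh \<open>\<tau>\<close>.
\<close>

lemma close_coefficients:
  fixes c :: "nat \<Rightarrow> 'b \<Rightarrow> real"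
  assumes A: "finite A" and S: "\<And>k g. g \<in> A \<Longrightarrow> \<bar>c k g\<bar> \<le> S" and \<tau>: "0 < \<tau>"
  shows "\<exists>k. \<exists>l<k. \<forall>g\<in>A. \<bar>c k g - c l g\<bar> \<le> \<tau>"
proof -
  define \<phi> where "\<phi> k = restrict (\<lambda>g. \<lfloor>c k g / \<tau>\<rfloor>) A" for k
  have "\<phi> k \<in> (\<Pi>\<^sub>E g\<in>A. {\<lfloor>- S / \<tau>\<rfloor>..\<lfloor>S / \<tau>\<rfloor>})" for k
  proof -
    have "\<lfloor>- S / \<tau>\<rfloor> \<le> \<lfloor>c k g / \<tau>\<rfloor> \<and> \<lfloor>c k g / \<tau>\<rfloor> \<le> \<lfloor>S / \<tau>\<rfloor>" if "g \<in> A" for g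
      using S[OF that, of k] \<tau> by (intro conjI floor_mono divide_right_mono) auto
    then show ?thesis by (auto simp: \<phi>_def)
  qed
  then have "finite (range \<phi>)" using A by (meson finite_PiE finite_atLeastAtMost_int finite_subset image_subsetI)
  then have "\<not> inj \<phi>" using finite_imageD infinite_UNIV_nat by blast
  then obtain k l where kl: "k \<noteq> l" "\<phi> k = \<phi> l" by (auto simp: inj_def)
  have close: "\<bar>c k g - c l g\<bar> \<le> \<tau>" if "g \<in> A" for g
  proof -
    have e: "\<lfloor>c k g / \<tau>\<rfloor> = \<lfloor>c l g / \<tau>\<rfloor>" using fun_cong[OF kl(2), of g] that by (simp add: \<phi>_def)
    have "\<bar>c k g / \<tau> - c l g / \<tau>\<bar> \<le> 1" using floor_correct[of "c k g / \<tau>"] floor_correct[of "c l g / \<tau>"] e by linarith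
    moreover have "c k g / \<tau> - c l g / \<tau> = (c k g - c l g) / \<tau>" by (simp add: diff_divide_distrib)
    ultimately show ?thesis using \<tau> by (simp add: abs_divide)
  qed
  show ?thesis
  proof (cases "l < k")
    case True
    then show ?thesis using close by blast
  next
    case False
    then have "k < l" using kl(1) by simp
    then show ?thesis using close by (metis abs_minus_commute)
  qed
qed

definition small_oscillation_on :: "'a set \<Rightarrow> ('a \<Rightarrow> real) set \<Rightarrow> bool"
  where "small_oscillation_on T F \<longleftrightarrow> (\<forall>f :: nat \<Rightarrow> 'a \<Rightarrow> real. \<forall>e>0. (\<forall>k. f k \<in> F) \<longrightarrow>
    (\<exists>r. strict_mono r \<and> (\<forall>x\<in>T. \<forall>\<^sub>F k in sequentially. \<bar>f (r k) x - f (r (Suc k)) x\<bar> \<le> e)))"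

text \<open>
  Otherwise there is an infinite sequence in \<open>F\<close> with mutual distances above \<open>\<eta>\<close>.  Its consecutive
  differences along a suitable subsequence are eventually small at every point, although their means
  are not.
\<close>

lemma mean_totally_bounded:
  assumes X: "compact_space X" and cont: "\<And>f. f \<in> F \<Longrightarrow> continuous_map X euclideanreal f"
    and M: "\<And>f x. f \<in> F \<Longrightarrow> x \<in> topspace X \<Longrightarrow> \<bar>f x\<bar> \<le> M"
    and osc: "small_oscillation_on (topspace X) F"
    and I: "mean_on (topspace X) I" and \<eta>: "0 < \<eta>"
  shows "\<exists>A. finite A \<and> A \<subseteq> F \<and> (\<forall>f\<in>F. \<exists>g\<in>A. I (\<lambda>x. \<bar>f x - g x\<bar>) \<le> \<eta>)"
proof (rule ccontr)
  assume no: "\<not> ?thesis"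
  define far where "far g f \<longleftrightarrow> \<eta> < I (\<lambda>x. \<bar>f x - g x\<bar>)" for f g
  define Q where "Q fs \<longleftrightarrow> set fs \<subseteq> F \<and> sorted_wrt far fs" for fs
  have "\<exists>f. Q (fs @ [f])" if fs: "Q fs" for fs
  proof -
    have "finite (set fs)" "set fs \<subseteq> F" using fs by (auto simp: Q_def)
    then have "\<not> (\<forall>f\<in>F. \<exists>g\<in>set fs. I (\<lambda>x. \<bar>f x - g x\<bar>) \<le> \<eta>)" using no by blast
    then obtain f where "f \<in> F" "\<forall>g\<in>set fs. far g f" unfolding far_def by (meson not_le)
    then show ?thesis using fs by (intro exI[of _ f]) (auto simp: Q_def sorted_wrt_append)
  qed
  moreover have "Q []" by (simp add: Q_def)
  ultimately obtain f where f: "\<And>n. Q (map f [0..<n])" using sequence_by_extension[of Q] by blast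
  have fF: "f k \<in> F" for k using f[of "Suc k"] by (simp add: Q_def)
  have ff: "far (f k) (f l)" if "k < l" for k l
  proof -
    have "sorted_wrt far (map f [0..<Suc l])" using f[of "Suc l"] unfolding Q_def by blast
    from sorted_wrt_nth_less[OF this, of k l] show ?thesis using that by (simp del: upt_Suc)
  qed
  obtain r where r: "strict_mono r" "\<And>x. x \<in> topspace X \<Longrightarrow> \<forall>\<^sub>F k in sequentially. \<bar>f (r k) x - f (r (Suc k)) x\<bar> \<le> \<eta> / 4"
    using osc[unfolded small_oscillation_on_def, rule_format, of "\<eta> / 4" f] fF \<eta> by auto
  define h where "h k x = \<bar>f (r (Suc k)) x - f (r k) x\<bar>" for k x
  have "\<exists>x\<in>topspace X. \<exists>\<^sub>F k in sequentially. \<eta> / 2 \<le> h k x"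
  proof (rule mean_frequently_large[OF X I])
    show "continuous_map X euclideanreal (h k)" for k
      unfolding h_def by (intro continuous_map_real_abs continuous_map_diff cont fF)
    show "\<bar>h k x\<bar> \<le> M + M" if "x \<in> topspace X" for k x
      using M[OF fF that, of "r k"] M[OF fF that, of "r (Suc k)"] by (simp add: h_def)
    show "\<eta> \<le> I (h k)" for k
      using ff[of "r k" "r (Suc k)"] r(1) by (simp add: strict_mono_less far_def h_def[abs_def])
  qed (use \<eta> in simp)
  then obtain x where x: "x \<in> topspace X" "\<exists>\<^sub>F k in sequentially. \<eta> / 2 \<le> h k x" by blast
  have "\<forall>\<^sub>F k in sequentially. \<not> \<eta> / 2 \<le> h k x"
    using r(2)[OF x(1)] by eventually_elim (use \<eta> in \<open>simp add: h_def abs_minus_commute\<close>)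
  then show False using x(2) by (simp add: frequently_def)
qed

text \<open>
  An \<open>l1\<close> sequence would be separated by a mean \<open>I\<close>.  Approximating its members by combinations of a
  finite \<open>I\<close>-net of \<open>F\<close> and comparing coefficients produces two members that are too close.
\<close>

lemma no_l1_sequence_of_combinations:
  fixes w :: "nat \<Rightarrow> 'a \<Rightarrow> real"
  assumes X: "compact_space X" and cont: "\<And>f. f \<in> F \<Longrightarrow> continuous_map X euclideanreal f"
    and M: "\<And>f x. f \<in> F \<Longrightarrow> x \<in> topspace X \<Longrightarrow> \<bar>f x\<bar> \<le> M"
    and osc: "small_oscillation_on (topspace X) F"
    and w: "\<And>k. combination F (s k) (w k)" and S: "\<And>k. s k \<le> S" and \<delta>: "0 < \<delta>"
  shows "\<exists>n c e. 0 < e \<and> (\<forall>x\<in>topspace X. \<bar>\<Sum>k<n. c k * w k x\<bar> \<le> \<delta> * (\<Sum>k<n. \<bar>c k\<bar>) - e)"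
proof (rule ccontr)
  assume no: "\<not> ?thesis"
  let ?T = "topspace X"
  define M' where "M' = \<bar>M\<bar> + 1"
  have M': "0 < M'" "\<And>f x. f \<in> F \<Longrightarrow> x \<in> ?T \<Longrightarrow> \<bar>f x\<bar> \<le> M'" using M by (auto simp: M'_def) (smt (verit) M)
  have S0: "0 \<le> S" using combination_nonneg[OF w[of 0]] S[of 0] by simp
  have FB: "F \<subseteq> bounded_on ?T" using M by (auto simp: bounded_on_def)
  have "\<exists>I. mean_on ?T I \<and> (\<forall>k. \<forall>l<k. \<delta> \<le> I (\<lambda>x. \<bar>w k x - w l x\<bar>))"
  proof (rule mean_separating_l1_sequence[OF _ \<delta>])
    show "\<bar>w k x\<bar> \<le> S * M'" if "x \<in> ?T" for k x
    proof -
      have "\<bar>w k x\<bar> \<le> s k * M'" by (rule combination_bound[OF w]) (rule M'(2)[OF _ that])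
      also have "\<dots> \<le> S * M'" using S M'(1) by (intro mult_right_mono) auto
      finally show ?thesis .
    qed
    show "\<exists>x\<in>?T. \<delta> * (\<Sum>k<n. \<bar>c k\<bar>) - e < \<bar>\<Sum>k<n. c k * w k x\<bar>" if "0 < e" for n c e
      using no that by (meson not_le)
  qed
  then obtain I where I: "mean_on ?T I" and sep: "\<And>k l. l < k \<Longrightarrow> \<delta> \<le> I (\<lambda>x. \<bar>w k x - w l x\<bar>)" by blast
  \<comment> \<open>Each of the two approximation errors and the difference of the approximations is allotted \<open>\<delta> / 4\<close>.\<close>
  define \<eta> where "\<eta> = \<delta> / (4 * (S + 1))"
  have \<eta>: "0 < \<eta>" using \<delta> S0 by (simp add: \<eta>_def)
  have "\<exists>A. finite A \<and> A \<subseteq> F \<and> (\<forall>f\<in>F. \<exists>g\<in>A. I (\<lambda>x. \<bar>f x - g x\<bar>) \<le> \<eta>)"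
    by (rule mean_totally_bounded[OF X _ _ osc I \<eta>]) (fact cont, fact M)
  then obtain A where A: "finite A" "A \<subseteq> F" "\<And>f. f \<in> F \<Longrightarrow> \<exists>g\<in>A. I (\<lambda>x. \<bar>f x - g x\<bar>) \<le> \<eta>"
    by blast
  have wB: "w k \<in> bounded_on ?T" for k using combination_approximation[OF I FB A w] by blast
  obtain c where c: "\<And>k. (\<Sum>g\<in>A. \<bar>c k g\<bar>) \<le> s k"
    "\<And>k. I (\<lambda>x. \<bar>w k x - (\<Sum>g\<in>A. c k g * g x)\<bar>) \<le> s k * \<eta>"
  proof -
    have "\<forall>k. \<exists>c. (\<Sum>g\<in>A. \<bar>c g\<bar>) \<le> s k \<and> I (\<lambda>x. \<bar>w k x - (\<Sum>g\<in>A. c g * g x)\<bar>) \<le> s k * \<eta>"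
      using combination_approximation[OF I FB A w] by blast
    from choice[OF this] show ?thesis using that by blast
  qed
  have cS: "\<bar>c k g\<bar> \<le> S" if "g \<in> A" for k g
  proof -
    have "\<bar>c k g\<bar> \<le> (\<Sum>g\<in>A. \<bar>c k g\<bar>)" using that A(1) by (intro member_le_sum) auto
    then show ?thesis using c(1)[of k] S[of k] by linarith
  qed
  define K where "K = real (card A) + 1"
  have K: "0 < K" "real (card A) \<le> K" by (auto simp: K_def)
  define \<tau> where "\<tau> = \<delta> / (4 * K * M')"
  have \<tau>: "0 < \<tau>" using \<delta> M'(1) K by (simp add: \<tau>_def)
  have "\<exists>k. \<exists>l<k. \<forall>g\<in>A. \<bar>c k g - c l g\<bar> \<le> \<tau>"
    by (rule close_coefficients[OF A(1) _ \<tau>]) (fact cS)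
  then obtain k l where kl: "l < k" "\<forall>g\<in>A. \<bar>c k g - c l g\<bar> \<le> \<tau>" by (elim exE conjE)
  define d where "d k x = \<bar>w k x - (\<Sum>g\<in>A. c k g * g x)\<bar>" for k x
  have gB: "g \<in> bounded_on ?T" if "g \<in> A" for g using that A(2) FB by blast
  have dB: "d k \<in> bounded_on ?T" for k
    unfolding d_def by (intro bounded_on_abs bounded_on_diff bounded_on_sum bounded_on_cmult wB gB)
  have dI: "I (d k) \<le> \<delta> / 4" for k
  proof -
    have "I (d k) \<le> s k * \<eta>" using c(2)[of k] by (simp add: d_def[abs_def])
    also have "\<dots> \<le> (S + 1) * \<eta>" using S[of k] \<eta> by (intro mult_right_mono) auto
    also have "\<dots> = \<delta> / 4" using S0 by (simp add: \<eta>_def divide_simps)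
    finally show ?thesis .
  qed
  have "I (\<lambda>x. \<bar>w k x - w l x\<bar>) \<le> I (\<lambda>x. (d k x + d l x) + \<delta> / 4)"
  proof (rule mean_mono[OF I])
    show "(\<lambda>x. \<bar>w k x - w l x\<bar>) \<in> bounded_on ?T" by (intro bounded_on_abs bounded_on_diff wB)
    show "(\<lambda>x. (d k x + d l x) + \<delta> / 4) \<in> bounded_on ?T" by (intro bounded_on_add bounded_on_const dB)
    fix x assume x: "x \<in> ?T"
    have "\<bar>\<Sum>g\<in>A. (c k g - c l g) * g x\<bar> \<le> (\<Sum>g\<in>A. \<tau> * M')"
    proof (rule order_trans[OF sum_abs], rule sum_mono)
      fix g assume g: "g \<in> A"
      then show "\<bar>(c k g - c l g) * g x\<bar> \<le> \<tau> * M'"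
        unfolding abs_mult using kl(2)[rule_format, of g] M'(2)[of g x] A(2) x \<tau> by (intro mult_mono) auto
    qed
    also have "\<dots> = real (card A) * (\<tau> * M')" by simp
    also have "\<dots> \<le> K * (\<tau> * M')" using \<tau> M'(1) K(2) by (intro mult_right_mono) auto
    also have "\<dots> = \<delta> / 4"
      using M'(1) K(1) by (simp add: \<tau>_def)
    finally have "\<bar>(\<Sum>g\<in>A. c k g * g x) - (\<Sum>g\<in>A. c l g * g x)\<bar> \<le> \<delta> / 4"
      by (simp add: left_diff_distrib sum_subtractf)
    then show "\<bar>w k x - w l x\<bar> \<le> (d k x + d l x) + \<delta> / 4" unfolding d_def by linarith
  qed
  also have "\<dots> = I (d k) + I (d l) + \<delta> / 4"
    using mean_add[OF I bounded_on_add[OF dB dB] bounded_on_const, of k l "\<delta> / 4"]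
      mean_add[OF I dB dB, of k l] mean_const[OF I, of "\<delta> / 4"] by simp
  also have "\<dots> < \<delta>" using dI[of k] dI[of l] \<delta> by linarith
  finally show False using sep[OF kl(1)] by simp
qed

section \<open>Spaces of null sequences of seminorms\<close>

text \<open>
  The bounds \<open>C n\<close> may grow, so that the norm \<open>sup\<^sub>n p\<^sub>n\<close>, finite where \<open>p\<^sub>n\<close> tends to \<open>0\<close>, is in
  general stronger than \<open>N\<close>.  That \<open>p\<^sub>0\<close> is equivalent to \<open>N\<close> makes it complete.
\<close>

locale seminormed_banach_on = banach_on V N for V :: "'v::real_vector set" and N +
  fixes p :: "nat \<Rightarrow> 'v \<Rightarrow> real" and C :: "nat \<Rightarrow> real" and L :: real
  assumes p_triangle: "\<And>n x y. x \<in> V \<Longrightarrow> y \<in> V \<Longrightarrow> p n (x + y) \<le> p n x + p n y"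
    and p_scaleR: "\<And>n c x. x \<in> V \<Longrightarrow> p n (c *\<^sub>R x) = \<bar>c\<bar> * p n x"
    and p_nonneg: "\<And>n x. x \<in> V \<Longrightarrow> 0 \<le> p n x"
    and p_upper: "\<And>n x. x \<in> V \<Longrightarrow> p n x \<le> C n * N x"
    and p_lower: "\<And>x. x \<in> V \<Longrightarrow> N x \<le> L * p 0 x"
begin

definition null_space :: "'v set"
  where "null_space = {x \<in> V. (\<lambda>n. p n x) \<longlonglongrightarrow> 0}"

definition sup_norm :: "'v \<Rightarrow> real"
  where "sup_norm x = (SUP n. p n x)"

lemma null_spaceD: "x \<in> null_space \<Longrightarrow> x \<in> V" "x \<in> null_space \<Longrightarrow> (\<lambda>n. p n x) \<longlonglongrightarrow> 0"
  by (auto simp: null_space_def)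

lemma bdd_above_null: "x \<in> null_space \<Longrightarrow> bdd_above (range (\<lambda>n. p n x))"
  by (intro Bseq_bdd_above convergent_imp_Bseq convergentI[of _ 0] null_spaceD(2))

lemma p_le_sup_norm: "x \<in> null_space \<Longrightarrow> p n x \<le> sup_norm x"
  unfolding sup_norm_def by (rule cSUP_upper[OF _ bdd_above_null]) auto

lemma sup_norm_le: "(\<And>n. p n x \<le> B) \<Longrightarrow> sup_norm x \<le> B"
  unfolding sup_norm_def by (rule cSUP_least) auto

lemma p_zero: "p n 0 = 0"
  using p_scaleR[of 0 n 0] subspace_0[OF subspace] by simp

lemma p_minus: "x \<in> V \<Longrightarrow> p n (- x) = p n x"
  using p_scaleR[of x n "-1"] by simp

lemma p_sum_le: "(\<And>i. i \<in> A \<Longrightarrow> v i \<in> V) \<Longrightarrow> p n (\<Sum>i\<in>A. v i) \<le> (\<Sum>i\<in>A. p n (v i))"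
proof (induction A rule: infinite_finite_induct)
  case (insert i A)
  then show ?case
    using p_triangle[of "v i" "\<Sum>i\<in>A. v i" n] subspace_sum[OF subspace, of A v] by fastforce
qed (simp_all add: p_zero)

lemma subspace_null_space: "subspace null_space"
  unfolding subspace_def
proof (intro conjI ballI allI)
  show "0 \<in> null_space" by (simp add: null_space_def p_zero subspace_0[OF subspace])
  show "x + y \<in> null_space" if "x \<in> null_space" "y \<in> null_space" for x y
  proof -
    note d = null_spaceD[OF that(1)] null_spaceD[OF that(2)]
    have V: "x + y \<in> V" using d subspace_add[OF subspace] by blast
    have lim: "(\<lambda>n. p n x + p n y) \<longlonglongrightarrow> 0" using tendsto_add[OF d(2,4)] by simp
    have "(\<lambda>n. p n (x + y)) \<longlonglongrightarrow> 0"
      by (rule Lim_null_comparison[OF _ lim]) (use p_triangle[OF d(1,3)] p_nonneg[OF V] in simp)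
    then show ?thesis using V by (simp add: null_space_def)
  qed
  show "c *\<^sub>R x \<in> null_space" if "x \<in> null_space" for c x
    using null_spaceD[OF that] subspace_scale[OF subspace, of x c] tendsto_mult_right_zero[of "\<lambda>n. p n x" _ "\<bar>c\<bar>"]
    by (simp add: null_space_def p_scaleR)
qed

text \<open>
  A Cauchy sequence converges in the given norm, hence in every seminorm \<open>p\<^sub>j\<close>, and the Cauchy
  condition makes this uniform in \<open>j\<close>.
\<close>

lemma banach_on_null_space: "banach_on null_space sup_norm"
proof
  show "subspace null_space" by (rule subspace_null_space)
  show nonneg: "0 \<le> sup_norm x" if "x \<in> null_space" for x
    using p_le_sup_norm[OF that, of 0] p_nonneg[of x 0] null_spaceD(1)[OF that] by linarith
  have base: "N x \<le> \<bar>L\<bar> * sup_norm x" if "x \<in> null_space" for x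
  proof -
    have "N x \<le> L * p 0 x" by (rule p_lower[OF null_spaceD(1)[OF that]])
    also have "\<dots> \<le> \<bar>L\<bar> * sup_norm x"
      using p_le_sup_norm[OF that] p_nonneg[OF null_spaceD(1)[OF that]] by (intro mult_mono) auto
    finally show ?thesis .
  qed
  show "sup_norm x = 0 \<longleftrightarrow> x = 0" if x: "x \<in> null_space" for x
  proof
    assume "sup_norm x = 0"
    then have "N x \<le> 0" using base[OF x] by simp
    then show "x = 0" using norm_nonneg norm_eq_0 null_spaceD(1)[OF x] by (metis order_antisym)
  qed (simp add: sup_norm_def p_zero)
  show "sup_norm (x + y) \<le> sup_norm x + sup_norm y" if "x \<in> null_space" "y \<in> null_space" for x y
    by (rule sup_norm_le)
      (use p_triangle[OF null_spaceD(1)[OF that(1)] null_spaceD(1)[OF that(2)]]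
        p_le_sup_norm[OF that(1)] p_le_sup_norm[OF that(2)] in \<open>meson add_mono order_trans\<close>)
  have scale_le: "sup_norm (c *\<^sub>R x) \<le> \<bar>c\<bar> * sup_norm x" if "x \<in> null_space" for c x
    by (rule sup_norm_le)
      (use p_scaleR[OF null_spaceD(1)[OF that]] p_le_sup_norm[OF that] in \<open>simp add: mult_left_mono\<close>)
  show "sup_norm (c *\<^sub>R x) = \<bar>c\<bar> * sup_norm x" if "x \<in> null_space" for c x
    by (rule homogeneous_if_subhomogeneous[OF subspace_null_space that])
      (use scale_le in \<open>auto simp: sup_norm_def p_zero\<close>)
  fix s :: "nat \<Rightarrow> 'v"
  assume s: "\<forall>n. s n \<in> null_space"
    and cau: "\<forall>e>0. \<exists>k. \<forall>m\<ge>k. \<forall>n\<ge>k. sup_norm (s m - s n) < e"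
  have sd: "s m - s n \<in> null_space" for m n using s subspace_diff[OF subspace_null_space] by blast
  have sV: "s n \<in> V" for n using s null_spaceD(1) by blast
  have "\<exists>l\<in>V. (\<lambda>n. N (s n - l)) \<longlonglongrightarrow> 0"
  proof (rule complete)
    show "\<forall>n. s n \<in> V" using sV by blast
    show "\<forall>e>0. \<exists>k. \<forall>m\<ge>k. \<forall>n\<ge>k. N (s m - s n) < e"
    proof (intro allI impI)
      fix e :: real assume e: "0 < e"
      obtain k where k: "\<forall>m\<ge>k. \<forall>n\<ge>k. sup_norm (s m - s n) < e / (\<bar>L\<bar> + 1)"
        using cau e by (meson abs_ge_zero add_nonneg_pos divide_pos_pos zero_less_one)
      have "N (s m - s n) < e" if "m \<ge> k" "n \<ge> k" for m n
      proof -
        have "N (s m - s n) \<le> (\<bar>L\<bar> + 1) * sup_norm (s m - s n)"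
          using base[OF sd, of m n] nonneg[OF sd, of m n] by (simp add: distrib_right)
        also have "\<dots> < e" using k that by (simp add: pos_less_divide_eq mult.commute add_nonneg_pos)
        finally show ?thesis .
      qed
      then show "\<exists>k. \<forall>m\<ge>k. \<forall>n\<ge>k. N (s m - s n) < e" by blast
    qed
  qed
  then obtain l where l: "l \<in> V" and lim: "(\<lambda>n. N (s n - l)) \<longlonglongrightarrow> 0" by blast
  have dV: "s n - l \<in> V" for n using sV l subspace_diff[OF subspace] by blast
  have unif: "\<exists>k. \<forall>m\<ge>k. \<forall>j. p j (s m - l) \<le> e" if e: "0 < e" for e
  proof -
    obtain k where k: "\<forall>m\<ge>k. \<forall>n\<ge>k. sup_norm (s m - s n) < e" using cau e by blast
    have "p j (s m - l) \<le> e" if m: "m \<ge> k" for m j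
    proof (rule LIMSEQ_le_const)
      show "(\<lambda>n. e + C j * N (s n - l)) \<longlonglongrightarrow> e"
        using tendsto_add[OF tendsto_const tendsto_mult_right_zero[OF lim, of "C j"]] by simp
      have "p j (s m - l) \<le> e + C j * N (s n - l)" if n: "n \<ge> k" for n
      proof -
        have "p j (s m - l) \<le> p j (s m - s n) + p j (s n - l)"
          using p_triangle[of "s m - s n" "s n - l" j] dV null_spaceD(1)[OF sd] by simp
        then show ?thesis using p_le_sup_norm[OF sd, of j m n] k m n p_upper[OF dV, of j n] by fastforce
      qed
      then show "\<exists>k. \<forall>n\<ge>k. p j (s m - l) \<le> e + C j * N (s n - l)" by blast
    qed
    then show ?thesis by blast
  qed
  have "(\<lambda>j. p j l) \<longlonglongrightarrow> 0"
  proof (rule LIMSEQ_I)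
    fix e :: real assume e: "0 < e"
    obtain k where k: "\<And>j. p j (s k - l) \<le> e / 2" using unif[of "e / 2"] e by auto
    obtain j0 where j0: "\<forall>j\<ge>j0. \<bar>p j (s k)\<bar> < e / 2"
      using LIMSEQ_D[OF null_spaceD(2)[OF s[rule_format, of k]], of "e / 2"] e by auto
    have "norm (p j l - 0) < e" if "j \<ge> j0" for j
    proof -
      have "p j l \<le> p j (s k) + p j (l - s k)"
        using p_triangle[of "s k" "l - s k" j] sV l subspace_diff[OF subspace] by simp
      also have "p j (l - s k) = p j (s k - l)" using p_minus[OF dV, of j k] by simp
      finally show ?thesis using k[of j] j0 that p_nonneg[OF l, of j] by fastforce
    qed
    then show "\<exists>j0. \<forall>j\<ge>j0. norm (p j l - 0) < e" by blast
  qed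
  then have ln: "l \<in> null_space" using l by (simp add: null_space_def)
  have "(\<lambda>n. sup_norm (s n - l)) \<longlonglongrightarrow> 0"
  proof (rule tendsto_0_if_uniformly_small)
    show "0 \<le> sup_norm (s n - l)" for n using s ln subspace_diff[OF subspace_null_space] by (blast intro: nonneg)
    show "\<exists>k. \<forall>m\<ge>k. sup_norm (s m - l) \<le> e" if e: "0 < e" for e
      using unif[OF e] by (elim ex_forward) (auto intro!: sup_norm_le)
  qed
  then show "\<exists>l\<in>null_space. (\<lambda>n. sup_norm (s n - l)) \<longlonglongrightarrow> 0" using ln by blast
qed

text \<open>
  For each \<open>j\<close> at most one of the disjoint intervals \<open>[J\<^sub>i, J\<^bsub>i+1\<^esub>)\<close> contains \<open>j\<close>, so all terms but
  one are dominated by the geometric series.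
\<close>

lemma gliding_hump_bounded:
  assumes u: "\<And>i. u i \<in> null_space" "\<And>i. sup_norm (u i) \<le> B" and J: "mono J"
    and small: "\<And>i j. j < J i \<or> J (Suc i) \<le> j \<Longrightarrow> p j (u i) \<le> (1/2) ^ i"
  shows "sup_norm (\<Sum>i<n. u i) \<le> 2 + B"
proof (rule sup_norm_le)
  fix j
  have B: "0 \<le> B" using p_le_sup_norm[OF u(1), of 0 0] u(2)[of 0] p_nonneg[OF null_spaceD(1)[OF u(1)], of 0 0] by linarith
  define ex where "ex i = (if J i \<le> j \<and> j < J (Suc i) then B else 0)" for i
  have "p j (\<Sum>i<n. u i) \<le> (\<Sum>i<n. p j (u i))" using u(1) null_spaceD(1) by (intro p_sum_le) blast
  also have "\<dots> \<le> (\<Sum>i<n. (1/2) ^ i + ex i)"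
  proof (rule sum_mono)
    fix i
    have "p j (u i) \<le> B" using p_le_sup_norm[OF u(1), of j i] u(2)[of i] by linarith
    then show "p j (u i) \<le> (1/2) ^ i + ex i" using small[of j i] B by (auto simp: ex_def intro: add_increasing)
  qed
  also have "\<dots> = (\<Sum>i<n. (1/2) ^ i) + (\<Sum>i<n. ex i)" by (rule sum.distrib)
  also have "(\<Sum>i<n. (1/2 :: real) ^ i) = 2 - 2 * (1/2) ^ n"
    by (induction n) auto
  also have "(\<Sum>i<n. ex i) = (if J 0 \<le> j \<and> j < J n then B else 0)"
  proof (induction n)
    case (Suc n)
    have "J 0 \<le> J n" "J n \<le> J (Suc n)" using J by (auto simp: mono_def)
    then show ?case using Suc by (auto simp: ex_def)
  qed simp
  finally have "p j (\<Sum>i<n. u i) \<le> 2 - 2 * (1/2) ^ n + (if J 0 \<le> j \<and> j < J n then B else 0)" .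
  moreover have "0 \<le> (1/2 :: real) ^ n" by simp
  ultimately show "p j (\<Sum>i<n. u i) \<le> 2 + B" using B by (smt (verit))
qed

text \<open>
  If the given norm is not bounded below on the span of any tail of the unit vectors of the copy,
  there are successive blocks \<open>u\<^sub>i\<close>, normalised in \<open>l1\<close>, that are as small as desired in the given
  norm.  Then \<open>p\<^sub>j u\<^sub>i\<close> is small for small \<open>j\<close> by continuity of \<open>p\<^sub>j\<close>, and for large \<open>j\<close> because \<open>u\<^sub>i\<close> belongs
  to the null space.  The sums of \<open>n\<close> blocks stay bounded although their norms in \<open>l1\<close> are \<open>n\<close>.
\<close>

lemma l1_in_null_space_imp_l1_in_base:
  assumes "contains_isomorphic_copy null_space sup_norm l1 l1_norm"
  shows "\<exists>(v :: nat \<Rightarrow> 'v) B \<delta>. 0 < \<delta> \<and> (\<forall>k. v k \<in> null_space \<and> sup_norm (v k) \<le> B) \<and>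
    (\<forall>n a. \<delta> * (\<Sum>k<n. \<bar>a k\<bar>) \<le> N (\<Sum>k<n. a k *\<^sub>R v k))"
  (is ?claim)
proof (rule ccontr)
  assume no: "\<not> ?claim"
  interpret null: banach_on null_space sup_norm by (rule banach_on_null_space)
  obtain T c B where T: "linear_between l1 null_space T" and c: "0 < c"
    and bounds: "\<And>x. x \<in> l1 \<Longrightarrow> c * l1_norm x \<le> sup_norm (T x)" "\<And>x. x \<in> l1 \<Longrightarrow> sup_norm (T x) \<le> B * l1_norm x"
    using assms unfolding contains_isomorphic_copy_def by blast
  define unit :: "nat \<Rightarrow> nat \<Rightarrow> real" where "unit k = (\<lambda>i. if i = k then 1 else 0)" for k
  have comb: "(\<Sum>k<n. a k *\<^sub>R unit k) = (\<lambda>i. if i < n then a i else 0)" for n a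
    by (induction n) (auto simp: fun_eq_iff scaleR_fun_def unit_def less_Suc_eq)
  have fin: "(\<lambda>i. \<bar>if i < n then a i else 0\<bar>) sums (\<Sum>k<n. \<bar>a k\<bar>)" for n and a :: "nat \<Rightarrow> real"
    using sums_finite[of "{..<n}" "\<lambda>i. \<bar>if i < n then a i else 0\<bar>"] by simp
  have comb_l1: "(\<Sum>k<n. a k *\<^sub>R unit k) \<in> l1" "l1_norm (\<Sum>k<n. a k *\<^sub>R unit k) = (\<Sum>k<n. \<bar>a k\<bar>)" for n a
    unfolding comb l1_def l1_norm_def using fin[of n a] by (auto simp: sums_iff)
  have unit_l1: "unit k \<in> l1" "l1_norm (unit k) = 1" for k
  proof -
    have "unit k = (\<Sum>i<Suc k. unit k i *\<^sub>R unit i)" unfolding comb by (auto simp: unit_def)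
    then have "unit k \<in> l1 \<and> l1_norm (unit k) = (\<Sum>i<Suc k. \<bar>unit k i\<bar>)" using comb_l1[of "unit k" "Suc k"] by simp
    moreover have "(\<Sum>i<Suc k. \<bar>unit k i\<bar>) = 1" by (simp add: unit_def)
    ultimately show "unit k \<in> l1" "l1_norm (unit k) = 1" by auto
  qed
  define v where "v k = T (unit k)" for k
  have v: "v k \<in> null_space" "sup_norm (v k) \<le> B" for k
    using linear_betweenD(3)[OF T unit_l1(1)] bounds(2)[OF unit_l1(1)[of k]] unit_l1(2) by (auto simp: v_def)
  have low: "c * (\<Sum>k<n. \<bar>a k\<bar>) \<le> sup_norm (\<Sum>k<n. a k *\<^sub>R v k)" for n a
    using bounds(1)[OF comb_l1(1)[of a n]] comb_l1(2)[of a n]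
      linear_between_sum[OF T subspace_l1 finite_lessThan, of n unit a] unit_l1 by (simp add: v_def)
  have blocks_null: "(\<Sum>k\<in>A. a k *\<^sub>R v k) \<in> null_space" for A a
    using v by (intro subspace_sum subspace_scale subspace_null_space)
  have block: "\<exists>m'\<ge>m. \<exists>a. (\<Sum>k\<in>{m..<m'}. \<bar>a k\<bar>) = 1 \<and> N (\<Sum>k\<in>{m..<m'}. a k *\<^sub>R v k) \<le> \<delta>" if \<delta>: "0 < \<delta>" for \<delta> m
  proof -
    have "\<not> (\<forall>n a. \<delta> * (\<Sum>k<n. \<bar>a k\<bar>) \<le> N (\<Sum>k<n. a k *\<^sub>R v (m + k)))"
    proof
      assume a: "\<forall>n a. \<delta> * (\<Sum>k<n. \<bar>a k\<bar>) \<le> N (\<Sum>k<n. a k *\<^sub>R v (m + k))"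
      have ?claim
        by (rule exI[of _ "\<lambda>k. v (m + k)"], rule exI[of _ B], rule exI[of _ \<delta>]) (use a \<delta> v in simp)
      then show False using no by contradiction
    qed
    then obtain n a where na: "N (\<Sum>k<n. a k *\<^sub>R v (m + k)) < \<delta> * (\<Sum>k<n. \<bar>a k\<bar>)" by (meson not_le)
    define t where "t = (\<Sum>k<n. \<bar>a k\<bar>)"
    have "0 \<le> N (\<Sum>k<n. a k *\<^sub>R v (m + k))"
      using v null_spaceD(1) by (intro norm_nonneg subspace_sum subspace_scale subspace) blast
    then have "0 < \<delta> * t" using na unfolding t_def by linarith
    then have t: "0 < t" using \<delta> by (simp add: zero_less_mult_iff)
    define b where "b k = a (k - m) / t" for k
    have shift: "(\<Sum>k\<in>{m..<m+n}. g k) = (\<Sum>k<n. g (m + k))" for g :: "nat \<Rightarrow> 'z::comm_monoid_add"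
      using sum.shift_bounds_nat_ivl[of g 0 m n] by (simp add: atLeast0LessThan add.commute)
    have "(\<Sum>k\<in>{m..<m+n}. \<bar>b k\<bar>) = (\<Sum>k<n. \<bar>a k\<bar>) / t"
      unfolding shift b_def using t by (simp add: abs_divide sum_divide_distrib)
    then have 1: "(\<Sum>k\<in>{m..<m+n}. \<bar>b k\<bar>) = 1" using t by (simp add: t_def[symmetric])
    have "(\<Sum>k\<in>{m..<m+n}. b k *\<^sub>R v k) = inverse t *\<^sub>R (\<Sum>k<n. a k *\<^sub>R v (m + k))"
      unfolding shift b_def by (simp add: scaleR_sum_right divide_inverse mult.commute)
    moreover have "(\<Sum>k<n. a k *\<^sub>R v (m + k)) \<in> V"
      using v null_spaceD(1) by (intro subspace_sum subspace_scale subspace) blast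
    ultimately have "N (\<Sum>k\<in>{m..<m+n}. b k *\<^sub>R v k) = inverse t * N (\<Sum>k<n. a k *\<^sub>R v (m + k))"
      using t by (simp add: norm_scaleR)
    also have "\<dots> \<le> \<delta>" using na t by (simp add: t_def[symmetric] field_simps)
    finally show ?thesis using 1 by (intro exI[of _ "m + n"]) auto
  qed
  \<comment> \<open>A state holds the end of the last block in the unit vectors and an index beyond which all earlier
      blocks are small.\<close>
  define R where "R i x y \<longleftrightarrow> fst x \<le> fst y \<and> snd x \<le> snd y \<and>
    (\<exists>a. (\<Sum>k\<in>{fst x..<fst y}. \<bar>a k\<bar>) = 1 \<and>
      (\<forall>j. j < snd x \<or> snd y \<le> j \<longrightarrow> p j (\<Sum>k\<in>{fst x..<fst y}. a k *\<^sub>R v k) \<le> (1/2) ^ i))"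
    for i :: nat and x y :: "nat \<times> nat"
  have "\<exists>y. R i x y" for i x
  proof -
    \<comment> \<open>A common bound for the continuity constants of the seminorms that the next block must not see.\<close>
    define D where "D = 1 + (\<Sum>j<snd x. \<bar>C j\<bar>)"
    have D: "0 < D" by (simp add: D_def add_pos_nonneg sum_nonneg)
    obtain m' a where m': "m' \<ge> fst x" "(\<Sum>k\<in>{fst x..<m'}. \<bar>a k\<bar>) = 1"
      "N (\<Sum>k\<in>{fst x..<m'}. a k *\<^sub>R v k) \<le> (1/2) ^ i / D"
      using block[of "(1/2) ^ i / D" "fst x"] D by auto
    define u where "u = (\<Sum>k\<in>{fst x..<m'}. a k *\<^sub>R v k)"
    have u: "u \<in> null_space" unfolding u_def by (rule blocks_null)
    obtain J where J: "\<forall>j\<ge>J. \<bar>p j u\<bar> < (1/2) ^ i"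
      using LIMSEQ_D[OF null_spaceD(2)[OF u], of "(1/2) ^ i"] by auto
    have "p j u \<le> (1/2) ^ i" if "j < snd x" for j
    proof -
      have "\<bar>C j\<bar> \<le> (\<Sum>j<snd x. \<bar>C j\<bar>)" using that by (intro member_le_sum) auto
      then have CD: "C j \<le> D" by (simp add: D_def)
      have "p j u \<le> C j * N u" by (rule p_upper[OF null_spaceD(1)[OF u]])
      also have "\<dots> \<le> D * N u" using CD norm_nonneg[OF null_spaceD(1)[OF u]] by (rule mult_right_mono)
      also have "\<dots> \<le> (1/2) ^ i" using m'(3) D by (simp add: u_def field_simps)
      finally show ?thesis .
    qed
    moreover have "p j u \<le> (1/2) ^ i" if "max J (snd x) \<le> j" for j
      using J that by fastforce
    ultimately have "R i x (m', max J (snd x))" using m' unfolding R_def u_def by auto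
    then show ?thesis ..
  qed
  then obtain st where st: "\<And>i. R i (st i) (st (Suc i))"
    using dependent_nat_choice[of "\<lambda>_ _. True" R] by blast
  define m J where "m i = fst (st i)" and "J i = snd (st i)" for i
  have mono_m: "m i \<le> m (Suc i)" and mono_J: "J i \<le> J (Suc i)" for i
    using st[of i] by (auto simp: R_def m_def J_def)
  obtain a where a: "\<And>i. (\<Sum>k\<in>{m i..<m (Suc i)}. \<bar>a i k\<bar>) = 1"
    "\<And>i j. j < J i \<or> J (Suc i) \<le> j \<Longrightarrow> p j (\<Sum>k\<in>{m i..<m (Suc i)}. a i k *\<^sub>R v k) \<le> (1/2) ^ i"
  proof -
    have "\<forall>i. \<exists>a. (\<Sum>k\<in>{m i..<m (Suc i)}. \<bar>a k\<bar>) = 1 \<and>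
      (\<forall>j. j < J i \<or> J (Suc i) \<le> j \<longrightarrow> p j (\<Sum>k\<in>{m i..<m (Suc i)}. a k *\<^sub>R v k) \<le> (1/2) ^ i)"
      using st unfolding R_def m_def J_def by blast
    from choice[OF this] show ?thesis using that by blast
  qed
  define u where "u i = (\<Sum>k\<in>{m i..<m (Suc i)}. a i k *\<^sub>R v k)" for i
  have u: "u i \<in> null_space" for i unfolding u_def by (rule blocks_null)
  have uB: "sup_norm (u i) \<le> B" for i
  proof -
    have "sup_norm (u i) \<le> (\<Sum>k\<in>{m i..<m (Suc i)}. sup_norm (a i k *\<^sub>R v k))"
      unfolding u_def using v by (intro null.norm_sum_le subspace_scale subspace_null_space)
    also have "\<dots> \<le> (\<Sum>k\<in>{m i..<m (Suc i)}. \<bar>a i k\<bar> * B)"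
      using v by (intro sum_mono) (simp add: null.norm_scaleR mult_left_mono)
    also have "\<dots> = B" using a(1)[of i] by (simp add: sum_distrib_right[symmetric])
    finally show ?thesis .
  qed
  have up: "sup_norm (\<Sum>i<n. u i) \<le> 2 + B" for n
    by (rule gliding_hump_bounded[OF u uB, of J])
      (use mono_J a(2) in \<open>auto simp: u_def intro: incseq_SucI\<close>)
  have "\<exists>b. (\<Sum>i<n. u i) = (\<Sum>k<m n. b k *\<^sub>R v k) \<and> real n \<le> (\<Sum>k<m n. \<bar>b k\<bar>)" for n
  proof (induction n)
    case 0
    show ?case by (intro exI[of _ "\<lambda>_. 0"]) simp
  next
    case (Suc n)
    then obtain b where b: "(\<Sum>i<n. u i) = (\<Sum>k<m n. b k *\<^sub>R v k)" "real n \<le> (\<Sum>k<m n. \<bar>b k\<bar>)" by blast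
    define b' where "b' k = (if k < m n then b k else a n k)" for k
    have split: "(\<Sum>k<m (Suc n). g k) = (\<Sum>k<m n. g k) + (\<Sum>k\<in>{m n..<m (Suc n)}. g k)" for g :: "nat \<Rightarrow> 'z::comm_monoid_add"
      using sum.atLeastLessThan_concat[of 0 "m n" "m (Suc n)" g] mono_m[of n] by (simp add: atLeast0LessThan)
    have 1: "(\<Sum>k<m n. b' k *\<^sub>R v k) = (\<Sum>k<m n. b k *\<^sub>R v k)" "(\<Sum>k<m n. \<bar>b' k\<bar>) = (\<Sum>k<m n. \<bar>b k\<bar>)"
      by (auto intro!: sum.cong simp: b'_def)
    have 2: "(\<Sum>k\<in>{m n..<m (Suc n)}. b' k *\<^sub>R v k) = u n" "(\<Sum>k\<in>{m n..<m (Suc n)}. \<bar>b' k\<bar>) = 1"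
      using a(1)[of n] by (auto intro!: sum.cong simp: b'_def u_def)
    show ?case using b by (intro exI[of _ b']) (simp add: split 1 2)
  qed
  then have "c * real n \<le> 2 + B" for n
  proof -
    obtain b where b: "(\<Sum>i<n. u i) = (\<Sum>k<m n. b k *\<^sub>R v k)" "real n \<le> (\<Sum>k<m n. \<bar>b k\<bar>)"
      using \<open>\<And>n. \<exists>b. (\<Sum>i<n. u i) = (\<Sum>k<m n. b k *\<^sub>R v k) \<and> real n \<le> (\<Sum>k<m n. \<bar>b k\<bar>)\<close> by blast
    have "c * real n \<le> c * (\<Sum>k<m n. \<bar>b k\<bar>)" using b(2) c by simp
    then show ?thesis using low[where n = "m n" and a = b] up[of n] b(1) by simp
  qed
  moreover obtain n :: nat where "2 + B < real n * c" using reals_Archimedean3[OF c] by blast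
  ultimately show False by (metis mult.commute not_le)
qed

end

section \<open>Interpolation between a bounded set and its Banach space\<close>

context banach_on
begin

text \<open>
  This is equivalent to the Minkowski functional of \<open>2\<^sup>n W + 2\<^bsup>-n\<^esup> B\<close>, where \<open>W\<close> is the absolutely
  convex hull of \<open>F\<close> and \<open>B\<close> the unit ball, and it is a seminorm by construction.
\<close>

definition interp :: "'v set \<Rightarrow> nat \<Rightarrow> 'v \<Rightarrow> real"
  where "interp F n v = Inf {(1/2) ^ n * s + 2 ^ n * N (v - w) |s w. combination F s w}"

context
  fixes F :: "'v set" and M :: real
  assumes F: "F \<subseteq> V" and M: "\<And>f. f \<in> F \<Longrightarrow> N f \<le> M" and M0: "0 \<le> M"
begin

lemma combination_mem: "combination F s w \<Longrightarrow> w \<in> V"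
  by (induction rule: combination.induct)
    (use F subspace_0[OF subspace] subspace_add[OF subspace] subspace_scale[OF subspace] in auto)

lemma combination_norm: "combination F s w \<Longrightarrow> N w \<le> s * M"
proof (induction rule: combination.induct)
  case (step s w f c)
  have "f \<in> V" using F step.hyps by blast
  then have "N (w + c *\<^sub>R f) \<le> N w + \<bar>c\<bar> * N f"
    using norm_triangle[OF combination_mem[OF step.hyps(1)] subspace_scale[OF subspace], of f c] by (simp add: norm_scaleR)
  also have "\<dots> \<le> s * M + \<bar>c\<bar> * M" using step.IH M[OF step.hyps(2)] by (intro add_mono mult_left_mono) auto
  finally show ?case by (simp add: distrib_right)
qed (simp add: norm_0)

lemma interp_term_nonneg:
  assumes "v \<in> V" "combination F s w"
  shows "0 \<le> (1/2) ^ n * s + 2 ^ n * N (v - w)"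
  using combination_nonneg[OF assms(2)] norm_nonneg[OF subspace_diff[OF subspace assms(1) combination_mem[OF assms(2)]]]
  by (intro add_nonneg_nonneg mult_nonneg_nonneg) auto

lemma interp_le:
  assumes "v \<in> V" "combination F s w"
  shows "interp F n v \<le> (1/2) ^ n * s + 2 ^ n * N (v - w)"
  unfolding interp_def
proof (rule cInf_lower)
  show "bdd_below {(1/2) ^ n * s + 2 ^ n * N (v - w) |s w. combination F s w}"
  proof (rule bdd_belowI[of _ 0])
    fix r assume "r \<in> {(1/2) ^ n * s + 2 ^ n * N (v - w) |s w. combination F s w}"
    then obtain s w where "r = (1/2) ^ n * s + 2 ^ n * N (v - w)" "combination F s w" by blast
    then show "0 \<le> r" using interp_term_nonneg[OF assms(1)] by simp
  qed
qed (use assms(2) in blast)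

lemma interp_greatest:
  assumes "\<And>s w. combination F s w \<Longrightarrow> B \<le> (1/2) ^ n * s + 2 ^ n * N (v - w)"
  shows "B \<le> interp F n v"
  unfolding interp_def by (rule cInf_greatest) (use assms combination.zero in blast)+

lemma interp_near:
  assumes "interp F n v < B"
  shows "\<exists>s w. combination F s w \<and> (1/2) ^ n * s + 2 ^ n * N (v - w) < B"
  using interp_greatest[of B n v] assms by (meson not_le)

lemma seminormed_interpolation: "seminormed_banach_on V N (interp F) (\<lambda>n. 2 ^ n) (M + 1)"
proof
  fix n
  show nonneg: "0 \<le> interp F n v" if "v \<in> V" for v
    by (rule interp_greatest) (rule interp_term_nonneg[OF that])
  show "interp F n (x + y) \<le> interp F n x + interp F n y" if x: "x \<in> V" and y: "y \<in> V" for x y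
  proof (rule field_le_epsilon)
    fix e :: real assume "0 < e"
    then obtain s w t z where s: "combination F s w" "(1/2) ^ n * s + 2 ^ n * N (x - w) < interp F n x + e/2"
      and t: "combination F t z" "(1/2) ^ n * t + 2 ^ n * N (y - z) < interp F n y + e/2"
      using interp_near[of n x "interp F n x + e/2"] interp_near[of n y "interp F n y + e/2"] by auto
    have "interp F n (x + y) \<le> (1/2) ^ n * (s + t) + 2 ^ n * N ((x + y) - (w + z))"
      by (rule interp_le[OF subspace_add[OF subspace x y] combination_add[OF s(1) t(1)]])
    also have "(x + y) - (w + z) = (x - w) + (y - z)" by simp
    also have "N \<dots> \<le> N (x - w) + N (y - z)"
      using combination_mem s(1) t(1) x y by (intro norm_triangle subspace_diff subspace)
    finally have "interp F n (x + y) \<le> (1/2) ^ n * (s + t) + 2 ^ n * (N (x - w) + N (y - z))" by simp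
    then show "interp F n (x + y) \<le> interp F n x + interp F n y + e" using s(2) t(2) by (simp add: algebra_simps)
  qed
  have scale_le: "interp F n (c *\<^sub>R x) \<le> \<bar>c\<bar> * interp F n x" if x: "x \<in> V" and c: "c \<noteq> 0" for c x
  proof -
    have "interp F n (c *\<^sub>R x) / \<bar>c\<bar> \<le> interp F n x"
    proof (rule interp_greatest)
      fix s w assume w: "combination F s w"
      have "interp F n (c *\<^sub>R x) \<le> (1/2) ^ n * (\<bar>c\<bar> * s) + 2 ^ n * N (c *\<^sub>R x - c *\<^sub>R w)"
        by (rule interp_le[OF subspace_scale[OF subspace x] combination_scale[OF w]])
      also have "N (c *\<^sub>R x - c *\<^sub>R w) = \<bar>c\<bar> * N (x - w)"
        using norm_scaleR[OF subspace_diff[OF subspace x combination_mem[OF w]], of c] by (simp add: scaleR_diff_right)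
      finally show "interp F n (c *\<^sub>R x) / \<bar>c\<bar> \<le> (1/2) ^ n * s + 2 ^ n * N (x - w)"
        using c by (simp add: field_simps)
    qed
    then show ?thesis using c by (simp add: field_simps)
  qed
  have "interp F n 0 = 0"
    using interp_le[OF subspace_0[OF subspace] combination.zero, of n] nonneg[OF subspace_0[OF subspace]]
    by (simp add: norm_0)
  then show "interp F n (c *\<^sub>R x) = \<bar>c\<bar> * interp F n x" if "x \<in> V" for c x
    by (rule homogeneous_if_subhomogeneous[OF subspace that]) (rule scale_le)
  show "interp F n x \<le> 2 ^ n * N x" if "x \<in> V" for x
    using interp_le[OF that combination.zero, of n] by simp
  show "N x \<le> (M + 1) * interp F 0 x" if x: "x \<in> V" for x
  proof -
    have "N x / (M + 1) \<le> interp F 0 x"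
    proof (rule interp_greatest)
      fix s w assume w: "combination F s w"
      have s: "0 \<le> s" by (rule combination_nonneg[OF w])
      have d: "0 \<le> N (x - w)" by (rule norm_nonneg[OF subspace_diff[OF subspace x combination_mem[OF w]]])
      have "N x \<le> s * M + N (x - w)"
        using norm_triangle_sub[OF x combination_mem[OF w]] combination_norm[OF w] by linarith
      also have "\<dots> \<le> (M + 1) * (s + N (x - w))" using M0 s d by (simp add: algebra_simps)
      finally show "N x / (M + 1) \<le> (1/2) ^ 0 * s + 2 ^ 0 * N (x - w)" using M0 by (simp add: field_simps)
    qed
    then show ?thesis using M0 by (simp add: field_simps)
  qed
qed

interpretation G: seminormed_banach_on V N "interp F" "\<lambda>n. 2 ^ n" "M + 1"
  by (rule seminormed_interpolation)

lemma combination_in_null_space: "f \<in> F \<Longrightarrow> f \<in> G.null_space"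
proof -
  assume f: "f \<in> F"
  then have fV: "f \<in> V" using F by blast
  have "combination F (0 + \<bar>1\<bar>) (0 + 1 *\<^sub>R f)" by (rule combination.step[OF combination.zero f])
  then have "interp F n f \<le> (1/2) ^ n" for n
    using interp_le[OF fV, of 1 f n] norm_0 by simp
  then have "(\<lambda>n. interp F n f) \<longlonglongrightarrow> 0"
    using G.p_nonneg[OF fV] by (intro Lim_null_comparison[OF _ LIMSEQ_power_zero[of "1/2 :: real"]]) auto
  then show ?thesis using fV by (simp add: G.null_space_def)
qed

text \<open>
  A sequence bounded in the interpolation norm lies within \<open>2\<^bsup>-n\<^esup> (B + 1)\<close> of combinations with
  weight at most \<open>2\<^sup>n (B + 1)\<close>.  For large \<open>n\<close> this error is at most half the \<open>l1\<close> constant.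
\<close>

lemma l1_in_null_space_imp_l1_combinations:
  assumes "contains_isomorphic_copy G.null_space G.sup_norm l1 l1_norm"
  shows "\<exists>(w :: nat \<Rightarrow> 'v) s S \<delta>. 0 < \<delta> \<and> (\<forall>k. combination F (s k) (w k) \<and> s k \<le> S) \<and>
    (\<forall>n a. \<delta> * (\<Sum>k<n. \<bar>a k\<bar>) \<le> N (\<Sum>k<n. a k *\<^sub>R w k))"
proof -
  obtain v :: "nat \<Rightarrow> 'v" and B \<delta> where \<delta>: "0 < \<delta>"
    and v': "\<forall>k. v k \<in> G.null_space \<and> G.sup_norm (v k) \<le> B"
    and low: "\<forall>n a. \<delta> * (\<Sum>k<n. \<bar>a k\<bar>) \<le> N (\<Sum>k<n. a k *\<^sub>R v k)"
    using G.l1_in_null_space_imp_l1_in_base[OF assms] by (elim exE conjE)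
  have v: "v k \<in> G.null_space" "G.sup_norm (v k) \<le> B" for k using v' by auto
  have vV: "v k \<in> V" for k by (rule G.null_spaceD(1)[OF v(1)])
  have B: "0 \<le> B" using G.p_le_sup_norm[OF v(1), of 0 0] v(2)[of 0] G.p_nonneg[OF vV, of 0 0] by linarith
  have pos: "0 < \<delta> / 2 / (B + 1)" using \<delta> B by simp
  obtain n where "(1/2) ^ n < \<delta> / 2 / (B + 1)" using real_arch_pow_inv[OF pos, of "1/2"] by auto
  then have n: "(1/2) ^ n * (B + 1) < \<delta> / 2" using B by (simp add: pos_less_divide_eq algebra_simps)
  have "\<forall>k. \<exists>s w. combination F s w \<and> (1/2) ^ n * s + 2 ^ n * N (v k - w) < B + 1"
  proof
    fix k
    have "interp F n (v k) < B + 1" using G.p_le_sup_norm[OF v(1), of n k] v(2)[of k] by linarith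
    then show "\<exists>s w. combination F s w \<and> (1/2) ^ n * s + 2 ^ n * N (v k - w) < B + 1" by (rule interp_near)
  qed
  then obtain s w where w: "\<And>k. combination F (s k) (w k)" and b: "\<And>k. (1/2) ^ n * s k + 2 ^ n * N (v k - w k) < B + 1"
    by metis
  have wV: "w k \<in> V" for k by (rule combination_mem[OF w])
  have dn: "0 \<le> N (v k - w k)" for k by (rule norm_nonneg[OF subspace_diff[OF subspace vV wV]])
  have S: "s k \<le> 2 ^ n * (B + 1)" for k
  proof -
    have "0 \<le> 2 ^ n * N (v k - w k)" using dn by simp
    then have "(1/2) ^ n * s k \<le> B + 1" using b[of k] by linarith
    then show ?thesis by (simp add: field_simps)
  qed
  have close: "N (v k - w k) \<le> \<delta> / 2" for k
  proof -
    have "0 \<le> (1/2) ^ n * s k" using combination_nonneg[OF w] by simp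
    then have "2 ^ n * N (v k - w k) \<le> B + 1" using b[of k] by linarith
    then have "N (v k - w k) \<le> (1/2) ^ n * (B + 1)" by (simp add: field_simps)
    then show ?thesis using n by linarith
  qed
  have "\<delta> / 2 * (\<Sum>k<m. \<bar>a k\<bar>) \<le> N (\<Sum>k<m. a k *\<^sub>R w k)" for m a
  proof -
    have mem: "(\<Sum>k<m. a k *\<^sub>R v k) \<in> V" "(\<Sum>k<m. a k *\<^sub>R w k) \<in> V"
      using vV wV by (auto intro!: subspace_sum subspace_scale subspace)
    have "N ((\<Sum>k<m. a k *\<^sub>R v k) - (\<Sum>k<m. a k *\<^sub>R w k)) = N (\<Sum>k<m. a k *\<^sub>R (v k - w k))"
      by (simp add: scaleR_diff_right sum_subtractf)
    also have "\<dots> \<le> (\<Sum>k<m. N (a k *\<^sub>R (v k - w k)))"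
      using vV wV by (intro norm_sum_le subspace_scale subspace subspace_diff)
    also have "\<dots> \<le> (\<Sum>k<m. \<bar>a k\<bar> * (\<delta> / 2))"
      using vV wV close by (intro sum_mono) (simp add: norm_scaleR subspace_diff[OF subspace] mult_left_mono del: times_divide_eq_right)
    also have "\<dots> = \<delta> / 2 * (\<Sum>k<m. \<bar>a k\<bar>)" by (simp add: sum_distrib_left mult.commute)
    finally show ?thesis using low[rule_format, where n = m and a = a] norm_triangle_sub[OF mem] by linarith
  qed
  then show ?thesis using w S \<delta> by (intro exI[of _ w] exI[of _ s] exI[of _ "2 ^ n * (B + 1)"] exI[of _ "\<delta> / 2"]) auto
qed

end

end

section \<open>From a representation to a Rosenthal family\<close>

text \<open>
  The family consists of the evaluations at the unit ball of \<open>V\<close>; weak-star compactness of \<open>K\<close> makes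
  it bounded.
\<close>

lemma WRN_imp_rosenthal_family:
  fixes X :: "'a topology"
  assumes "WRN_in TYPE('v::real_vector) X"
  shows "\<exists>F. rosenthal_family X F \<and> separates_points X F"
proof -
  obtain V :: "'v set" and N K where rs: "rosenthal_space V N" and K: "compactin (weak_star V N) K"
    and hom: "X homeomorphic_space subtopology (weak_star V N) K"
    using assms unfolding WRN_in_def by blast
  interpret banach_on V N using rs by (simp add: rosenthal_space_def)
  obtain h where h: "homeomorphic_map X (subtopology (weak_star V N) K) h"
    using hom by (auto simp: homeomorphic_space)
  let ?T = "topspace X"
  have KT: "K \<subseteq> topspace (weak_star V N)" using K by (simp add: compactin_def)
  have hK: "h x \<in> K" if "x \<in> ?T" for x
    using homeomorphic_imp_surjective_map[OF h] that by auto
  have K_dual: "u \<in> dual V N" if "u \<in> K" for u using KT that by (auto simp: weak_star_def)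
  have lin: "linear_between V UNIV u" if "u \<in> K" for u using K_dual[OF that] by (simp add: dual_def)
  have eval: "continuous_map (weak_star V N) euclideanreal (\<lambda>u. u v)" if "v \<in> V" for v
    unfolding weak_star_def
    by (intro continuous_map_from_subtopology continuous_map_product_projection that)
  have "\<exists>B. \<forall>u\<in>K. \<bar>u v\<bar> \<le> B" if "v \<in> V" for v
  proof -
    have "bounded ((\<lambda>u. u v) ` K)" using image_compactin[OF K eval[OF that]] by (simp add: compact_imp_bounded)
    then show ?thesis unfolding bounded_iff by auto
  qed
  then obtain C where C: "\<And>u v. u \<in> K \<Longrightarrow> v \<in> V \<Longrightarrow> \<bar>u v\<bar> \<le> C * N v"
    using uniform_boundedness[of K] K_dual by blast
  define g where "g v = restrict (\<lambda>x. h x v) ?T" for v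
  define F where "F = g ` {v \<in> V. N v \<le> 1}"
  have FC: "F \<subseteq> C_space X"
  proof -
    have "continuous_map X euclideanreal (g v)" if "v \<in> V" for v
    proof (rule continuous_map_eq)
      have "continuous_map X (weak_star V N) h"
        using homeomorphic_imp_continuous_map[OF h] by (simp add: continuous_map_in_subtopology)
      then show "continuous_map X euclideanreal ((\<lambda>u. u v) \<circ> h)"
        using eval[OF that] by (rule continuous_map_compose)
    qed (simp add: g_def)
    then show ?thesis by (auto simp: F_def C_space_def g_def)
  qed
  have bound: "\<forall>f\<in>F. \<forall>x\<in>?T. \<bar>f x\<bar> \<le> \<bar>C\<bar>"
  proof (intro ballI)
    fix f x assume "f \<in> F" and x: "x \<in> ?T"
    then obtain v where v: "v \<in> V" "N v \<le> 1" "f = g v" by (auto simp: F_def)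
    have "\<bar>h x v\<bar> \<le> C * N v" by (rule C[OF hK[OF x] v(1)])
    also have "\<dots> \<le> \<bar>C\<bar> * 1" using v norm_nonneg by (intro mult_mono) auto
    finally show "\<bar>f x\<bar> \<le> \<bar>C\<bar>" using v x by (simp add: g_def)
  qed
  have "fragmented X f" if f: "f \<in> powertop_real ?T closure_of F" for f
  proof (rule ccontr)
    assume "\<not> fragmented X f"
    then obtain w a b where w: "\<And>k. w k \<in> F" and ab: "a < b" and ind: "independent_on ?T w a b"
      using not_fragmented_imp_independent[OF f _ bound] FC by (force simp: C_space_def)
    have "\<forall>k. \<exists>v. v \<in> V \<and> N v \<le> 1 \<and> w k = g v" using w by (auto simp: F_def)
    then obtain v where v: "\<And>k. v k \<in> V" "\<And>k. N (v k) \<le> 1" "\<And>k. w k = g (v k)" by metis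
    define c where "c = (b - a) / 2 / (\<bar>C\<bar> + 1)"
    have C1: "0 < \<bar>C\<bar> + 1" by linarith
    \<comment> \<open>The independent sequence satisfies a lower estimate in the supremum over \<open>K\<close>, which is at most
        \<open>C\<close> times the norm of \<open>V\<close>.\<close>
    have "c * (\<Sum>k<n. \<bar>d k\<bar>) \<le> N (\<Sum>k<n. d k *\<^sub>R v k)" for n d
    proof -
      let ?s = "\<Sum>k<n. d k *\<^sub>R v k"
      have sV: "?s \<in> V" using v by (intro subspace_sum subspace_scale subspace)
      obtain x where x: "x \<in> ?T" and le: "(b - a) / 2 * (\<Sum>k<n. \<bar>d k\<bar>) \<le> \<bar>\<Sum>k<n. d k * w k x\<bar>"
        using independent_lower_estimate[OF ab ind] by blast
      have "(\<Sum>k<n. d k * w k x) = h x ?s"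
        using linear_between_sum[OF lin[OF hK[OF x]] subspace finite_lessThan v(1)] x by (simp add: v(3) g_def)
      then have "(b - a) / 2 * (\<Sum>k<n. \<bar>d k\<bar>) \<le> C * N ?s" using le C[OF hK[OF x] sV] by simp
      also have "\<dots> \<le> (\<bar>C\<bar> + 1) * N ?s" using norm_nonneg[OF sV] by (intro mult_right_mono) auto
      finally show ?thesis using C1 by (simp add: c_def field_simps)
    qed
    moreover have "0 < c" using ab C1 by (simp add: c_def)
    ultimately have "contains_isomorphic_copy V N l1 l1_norm"
      using contains_l1_if_lower_estimate[of v 1 c] v by blast
    then show False using rs by (simp add: rosenthal_space_def)
  qed
  moreover have "f \<in> extensional ?T" if "f \<in> powertop_real ?T closure_of F" for f
    using subsetD[OF closure_of_subset_topspace that] by (simp add: PiE_iff)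
  ultimately have "powertop_real ?T closure_of F \<subseteq> fragmented_functions X"
    unfolding fragmented_functions_def by blast
  then have "rosenthal_family X F" using FC bound unfolding rosenthal_family_def by blast
  moreover have "separates_points X F"
    unfolding separates_points_def
  proof (intro ballI impI)
    fix x y assume x: "x \<in> ?T" and y: "y \<in> ?T" and "x \<noteq> y"
    then have "h x \<noteq> h y" using homeomorphic_imp_injective_map[OF h] by (auto simp: inj_on_def)
    moreover have "h x \<in> extensional V" "h y \<in> extensional V" using K_dual hK x y by (auto simp: dual_def)
    ultimately obtain v where v: "v \<in> V" "h x v \<noteq> h y v" by (meson extensionalityI)
    define r where "r = inverse (N v + 1)"
    have r: "0 < r" "N (r *\<^sub>R v) \<le> 1" using norm_nonneg[OF v(1)] v(1)
      by (auto simp: r_def norm_scaleR field_simps)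
    have "g (r *\<^sub>R v) \<in> F" using r v subspace_scale[OF subspace] by (auto simp: F_def)
    moreover have "g (r *\<^sub>R v) x \<noteq> g (r *\<^sub>R v) y"
      using x y r(1) v linear_betweenD(2)[OF lin[OF hK[OF x]] v(1)] linear_betweenD(2)[OF lin[OF hK[OF y]] v(1)]
      by (simp add: g_def)
    ultimately show "\<exists>f\<in>F. f x \<noteq> f y" by blast
  qed
  ultimately show ?thesis by blast
qed

section \<open>From a Rosenthal family to a representation\<close>

text \<open>
  The continuous functions on \<open>X\<close>, extended by \<open>0\<close> rather than by \<^const>\<open>undefined\<close> so that they form
  a linear subspace of the function type.
\<close>

definition zero_extended_continuous :: "'a topology \<Rightarrow> ('a \<Rightarrow> real) set"
  where "zero_extended_continuous X = {v. continuous_map X euclideanreal v \<and> (\<forall>x. x \<notin> topspace X \<longrightarrow> v x = 0)}"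

text \<open>
  The supremum ranges over the whole type, which is nonempty even if \<open>X\<close> is empty.
\<close>

definition uniform_norm :: "('a \<Rightarrow> real) \<Rightarrow> real"
  where "uniform_norm v = (SUP x. \<bar>v x\<bar>)"

lemma bdd_above_abs_zero_extended:
  assumes "compact_space X" "v \<in> zero_extended_continuous X"
  shows "bdd_above (range (\<lambda>x. \<bar>v x\<bar>))"
proof -
  have "compactin euclideanreal (v ` topspace X)"
  proof (rule image_compactin)
    show "compactin X (topspace X)" using assms(1) by (simp add: compact_space_def)
    show "continuous_map X euclideanreal v" using assms(2) by (simp add: zero_extended_continuous_def)
  qed
  then have "bounded (v ` topspace X)" by (simp add: compact_imp_bounded)
  then obtain B where B: "\<forall>x\<in>topspace X. \<bar>v x\<bar> \<le> B" unfolding bounded_iff by auto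
  have "\<bar>v x\<bar> \<le> max B 0" for x
    using assms(2) B by (cases "x \<in> topspace X") (auto simp: zero_extended_continuous_def le_max_iff_disj)
  then show ?thesis by (auto intro!: bdd_aboveI2)
qed

lemma abs_le_uniform_norm:
  assumes "compact_space X" "v \<in> zero_extended_continuous X"
  shows "\<bar>v x\<bar> \<le> uniform_norm v"
  unfolding uniform_norm_def by (rule cSUP_upper[OF _ bdd_above_abs_zero_extended[OF assms]]) simp

lemma uniform_norm_le: "(\<And>x. \<bar>v x\<bar> \<le> B) \<Longrightarrow> uniform_norm v \<le> B"
  unfolding uniform_norm_def by (rule cSUP_least) auto

lemma banach_on_zero_extended_continuous:
  assumes X: "compact_space X"
  shows "banach_on (zero_extended_continuous X) uniform_norm"
proof
  let ?E = "zero_extended_continuous X"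
  note le = abs_le_uniform_norm[OF X]
  show sub: "subspace ?E"
    unfolding subspace_def zero_extended_continuous_def plus_fun_def scaleR_fun_def zero_fun_def
    by (auto intro: continuous_map_add continuous_map_real_mult)
  show nonneg: "0 \<le> uniform_norm v" if "v \<in> ?E" for v
    using le[OF that, of undefined] abs_ge_zero order_trans by blast
  show "uniform_norm v = 0 \<longleftrightarrow> v = 0" if v: "v \<in> ?E" for v
  proof
    assume "uniform_norm v = 0"
    then have "\<bar>v x\<bar> \<le> 0" for x using le[OF v, of x] by simp
    then show "v = 0" by (auto simp: fun_eq_iff)
  qed (simp add: uniform_norm_def)
  show "uniform_norm (v + w) \<le> uniform_norm v + uniform_norm w" if "v \<in> ?E" "w \<in> ?E" for v w
  proof (rule uniform_norm_le)
    fix x show "\<bar>(v + w) x\<bar> \<le> uniform_norm v + uniform_norm w"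
      using le[OF that(1), of x] le[OF that(2), of x] by simp
  qed
  have scale_le: "uniform_norm (c *\<^sub>R v) \<le> \<bar>c\<bar> * uniform_norm v" if "v \<in> ?E" for c v
  proof (rule uniform_norm_le)
    fix x show "\<bar>(c *\<^sub>R v) x\<bar> \<le> \<bar>c\<bar> * uniform_norm v"
      using le[OF that, of x] by (simp add: scaleR_fun_def abs_mult mult_left_mono)
  qed
  show "uniform_norm (c *\<^sub>R v) = \<bar>c\<bar> * uniform_norm v" if "v \<in> ?E" for c v
    by (rule homogeneous_if_subhomogeneous[OF sub that]) (use scale_le in \<open>auto simp: uniform_norm_def\<close>)
  fix s :: "nat \<Rightarrow> 'a \<Rightarrow> real"
  assume s: "\<forall>n. s n \<in> ?E"
    and cau: "\<forall>e>0. \<exists>k. \<forall>m\<ge>k. \<forall>n\<ge>k. uniform_norm (s m - s n) < e"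
  have d: "s m - s n \<in> ?E" for m n using s subspace_diff[OF sub] by blast
  have pt: "\<bar>s m x - s n x\<bar> \<le> uniform_norm (s m - s n)" for m n x using le[OF d, of m n x] by simp
  have "Cauchy (\<lambda>n. s n x)" for x
    unfolding Cauchy_def dist_real_def using cau pt by (meson le_less_trans)
  then have "\<forall>x. \<exists>L. (\<lambda>n. s n x) \<longlonglongrightarrow> L" using Cauchy_convergent convergent_def by blast
  then have "\<exists>l. \<forall>x. (\<lambda>n. s n x) \<longlonglongrightarrow> l x" by (rule choice)
  then obtain l where l: "\<And>x. (\<lambda>n. s n x) \<longlonglongrightarrow> l x" by blast
  have unif: "\<exists>k. \<forall>m\<ge>k. \<forall>x. \<bar>s m x - l x\<bar> \<le> e" if e: "0 < e" for e
  proof -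
    obtain k where k: "\<forall>m\<ge>k. \<forall>n\<ge>k. uniform_norm (s m - s n) < e" using cau e by blast
    have "\<bar>s m x - l x\<bar> \<le> e" if "m \<ge> k" for m x
    proof (rule LIMSEQ_le_const2)
      show "(\<lambda>n. \<bar>s m x - s n x\<bar>) \<longlonglongrightarrow> \<bar>s m x - l x\<bar>" by (intro tendsto_intros l)
      have "\<bar>s m x - s n x\<bar> \<le> e" if "n \<ge> k" for n
        using pt[of m x n] k \<open>m \<ge> k\<close> that by fastforce
      then show "\<exists>k. \<forall>n\<ge>k. \<bar>s m x - s n x\<bar> \<le> e" by blast
    qed
    then show ?thesis by blast
  qed
  have "continuous_map X euclideanreal l"
  proof (rule Met_TC.continuous_map_uniform_limit[where F = sequentially and f = s, unfolded mtopology_is_euclidean])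
    show "\<forall>\<^sub>F n in sequentially. continuous_map X euclideanreal (s n)"
      using s by (simp add: zero_extended_continuous_def)
    show "\<forall>\<^sub>F n in sequentially. \<forall>x\<in>topspace X. l x \<in> UNIV \<and> dist (s n x) (l x) < e" if "0 < e" for e
    proof -
      obtain k where k: "\<forall>m\<ge>k. \<forall>x. \<bar>s m x - l x\<bar> \<le> e / 2" using unif[of "e / 2"] \<open>0 < e\<close> by auto
      have "dist (s n x) (l x) < e" if "n \<ge> k" for n x
        using k[rule_format, OF that, of x] \<open>0 < e\<close> by (simp add: dist_real_def)
      then show ?thesis unfolding eventually_sequentially by blast
    qed
  qed simp
  moreover have "l x = 0" if "x \<notin> topspace X" for x
  proof -
    have "(\<lambda>n. s n x) = (\<lambda>n. 0)" using s that by (auto simp: zero_extended_continuous_def)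
    then show ?thesis using l[of x] LIMSEQ_unique tendsto_const by metis
  qed
  ultimately have lE: "l \<in> ?E" by (simp add: zero_extended_continuous_def)
  have "(\<lambda>n. uniform_norm (s n - l)) \<longlonglongrightarrow> 0"
  proof (rule tendsto_0_if_uniformly_small)
    show "0 \<le> uniform_norm (s n - l)" for n using s lE subspace_diff[OF sub] by (blast intro: nonneg)
    show "\<exists>k. \<forall>m\<ge>k. uniform_norm (s m - l) \<le> e" if e: "0 < e" for e
      using unif[OF e] by (elim ex_forward) (auto intro!: uniform_norm_le)
  qed
  then show "\<exists>l\<in>?E. (\<lambda>n. uniform_norm (s n - l)) \<longlonglongrightarrow> 0" using lE by blast
qed

lemma sum_scaleR_apply: "(\<Sum>i\<in>A. c i *\<^sub>R f i) x = (\<Sum>i\<in>A. c i * (f i x :: real))"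
  by (induction A rule: infinite_finite_induct) (auto simp: scaleR_fun_def)

text \<open>
  The Banach space is the interpolation space of \<open>F\<close>, and \<open>X\<close> is embedded by the point evaluations.
\<close>

lemma rosenthal_family_imp_WRN:
  fixes X :: "'a topology"
  assumes X: "compact_space X" and F: "rosenthal_family X F" and sep: "separates_points X F"
  shows "WRN X"
proof -
  let ?T = "topspace X" and ?E = "zero_extended_continuous X"
  interpret E: banach_on ?E uniform_norm by (rule banach_on_zero_extended_continuous[OF X])
  obtain M0 where M0: "\<And>f x. f \<in> F \<Longrightarrow> x \<in> ?T \<Longrightarrow> \<bar>f x\<bar> \<le> M0"
    using F unfolding rosenthal_family_def by blast
  define M where "M = \<bar>M0\<bar>"
  define ze where "ze f x = (if x \<in> ?T then f x else 0)" for f :: "'a \<Rightarrow> real" and x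
  define F0 where "F0 = ze ` F"
  have cont: "continuous_map X euclideanreal (ze f)" if "f \<in> F" for f
  proof (rule continuous_map_eq)
    show "continuous_map X euclideanreal f" using F that by (auto simp: rosenthal_family_def C_space_def)
  qed (simp add: ze_def)
  have F0E: "F0 \<subseteq> ?E" using cont by (auto simp: F0_def zero_extended_continuous_def ze_def)
  have F0M: "\<bar>f x\<bar> \<le> M" if "f \<in> F0" for f x
    using that M0 unfolding F0_def M_def ze_def by fastforce
  have F0N: "uniform_norm f \<le> M" if "f \<in> F0" for f using F0M[OF that] by (rule uniform_norm_le)
  have M: "0 \<le> M" by (simp add: M_def)
  have osc: "small_oscillation_on ?T F0"
    unfolding small_oscillation_on_def
  proof (intro allI impI)
    fix f :: "nat \<Rightarrow> 'a \<Rightarrow> real" and e :: real assume e: "0 < e" and f: "\<forall>k. f k \<in> F0"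
    have "\<forall>k. \<exists>g. g \<in> F \<and> f k = ze g" using f by (auto simp: F0_def)
    then obtain g where g: "\<And>k. g k \<in> F" "\<And>k. f k = ze (g k)" by metis
    have "\<exists>r. strict_mono r \<and> (\<forall>x\<in>?T. \<forall>\<^sub>F k in sequentially. \<bar>g (r k) x - g (r (Suc k)) x\<bar> \<le> e)"
      by (rule rosenthal_family_small_oscillation[OF X F _ e]) (rule g(1))
    then show "\<exists>r. strict_mono r \<and> (\<forall>x\<in>?T. \<forall>\<^sub>F k in sequentially. \<bar>f (r k) x - f (r (Suc k)) x\<bar> \<le> e)"
      by (simp add: g(2) ze_def)
  qed
  interpret G: seminormed_banach_on ?E uniform_norm "E.interp F0" "\<lambda>n. 2 ^ n" "M + 1"
    by (rule E.seminormed_interpolation[OF F0E F0N M])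
  define V N where "V = G.null_space" and "N = G.sup_norm"
  have VE: "v \<in> ?E" if "v \<in> V" for v using that unfolding V_def by (rule G.null_spaceD(1))
  have dom: "\<bar>v x\<bar> \<le> (M + 1) * N v" if v: "v \<in> V" for v x
  proof -
    have "\<bar>v x\<bar> \<le> uniform_norm v" by (rule abs_le_uniform_norm[OF X VE[OF v]])
    also have "\<dots> \<le> (M + 1) * E.interp F0 0 v" by (rule G.p_lower[OF VE[OF v]])
    also have "\<dots> \<le> (M + 1) * N v" using G.p_le_sup_norm v M unfolding V_def N_def by (intro mult_left_mono) auto
    finally show ?thesis .
  qed
  have no_l1: "\<not> contains_isomorphic_copy V N l1 l1_norm"
  proof
    assume "contains_isomorphic_copy V N l1 l1_norm"
    then have "contains_isomorphic_copy G.null_space G.sup_norm l1 l1_norm" by (simp add: V_def N_def)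
    then have "\<exists>(w :: nat \<Rightarrow> 'a \<Rightarrow> real) s S \<delta>. 0 < \<delta> \<and> (\<forall>k. combination F0 (s k) (w k) \<and> s k \<le> S) \<and>
        (\<forall>n a. \<delta> * (\<Sum>k<n. \<bar>a k\<bar>) \<le> uniform_norm (\<Sum>k<n. a k *\<^sub>R w k))"
      by (rule E.l1_in_null_space_imp_l1_combinations[OF F0E _ M, rotated]) (rule F0N)
    then obtain w :: "nat \<Rightarrow> 'a \<Rightarrow> real" and s S \<delta> where \<delta>: "0 < \<delta>"
      and w: "\<forall>k. combination F0 (s k) (w k) \<and> s k \<le> S"
      and low: "\<forall>n a. \<delta> * (\<Sum>k<n. \<bar>a k\<bar>) \<le> uniform_norm (\<Sum>k<n. a k *\<^sub>R w k)" by (elim exE conjE)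
    have wE: "w k \<in> ?E" for k using w E.combination_mem[OF F0E F0N M] by blast
    have "\<exists>n c e. 0 < e \<and> (\<forall>x\<in>?T. \<bar>\<Sum>k<n. c k * w k x\<bar> \<le> \<delta> * (\<Sum>k<n. \<bar>c k\<bar>) - e)"
    proof (rule no_l1_sequence_of_combinations[OF X _ _ osc _ _ \<delta>])
      show "continuous_map X euclideanreal f" if "f \<in> F0" for f using that F0E by (auto simp: zero_extended_continuous_def)
      show "\<bar>f x\<bar> \<le> M" if "f \<in> F0" "x \<in> ?T" for f x using F0M[OF that(1)] .
      show "combination F0 (s k) (w k)" "s k \<le> S" for k using w by auto
    qed
    then obtain n :: nat and c e where e: "0 < e"
      and small: "\<And>x. x \<in> ?T \<Longrightarrow> \<bar>\<Sum>k<n. c k * w k x\<bar> \<le> \<delta> * (\<Sum>k<n. \<bar>c k\<bar>) - e" by blast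
    show False
    proof (cases "?T = {}")
      case True
      then have "w 0 = 0" using wE[of 0] by (auto simp: zero_extended_continuous_def fun_eq_iff)
      then show False using low[rule_format, where n = 1 and a = "\<lambda>_. 1"] \<delta> E.norm_0 by simp
    next
      case False
      then obtain y where "y \<in> ?T" by blast
      from small[OF this] have nn: "0 \<le> \<delta> * (\<Sum>k<n. \<bar>c k\<bar>) - e" by linarith
      have "uniform_norm (\<Sum>k<n. c k *\<^sub>R w k) \<le> \<delta> * (\<Sum>k<n. \<bar>c k\<bar>) - e"
      proof (rule uniform_norm_le)
        fix x
        show "\<bar>(\<Sum>k<n. c k *\<^sub>R w k) x\<bar> \<le> \<delta> * (\<Sum>k<n. \<bar>c k\<bar>) - e"
        proof (cases "x \<in> ?T")
          case True
          then show ?thesis using small by (simp add: sum_scaleR_apply)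
        next
          case False
          then have "w k x = 0" for k using wE[of k] by (simp add: zero_extended_continuous_def)
          then show ?thesis using nn by (simp add: sum_scaleR_apply)
        qed
      qed
      then show False using low[rule_format, where n = n and a = c] e by linarith
    qed
  qed
  have rs: "rosenthal_space V N"
    unfolding rosenthal_space_def using no_l1 G.banach_on_null_space by (simp add: V_def N_def)
  define ev where "ev x = restrict (\<lambda>v. v x) V" for x :: 'a
  have sub: "subspace V" unfolding V_def by (rule G.subspace_null_space)
  have dual: "ev x \<in> dual V N" for x
  proof -
    have "linear_between V UNIV (ev x)"
      using subspace_add[OF sub] subspace_scale[OF sub] unfolding linear_between_def ev_def
      by (simp, simp add: scaleR_fun_def)
    moreover have "\<forall>v\<in>V. \<bar>ev x v\<bar> \<le> (M + 1) * N v" using dom by (simp add: ev_def)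
    ultimately show ?thesis unfolding dual_def by (auto simp: ev_def)
  qed
  have cont_ev: "continuous_map X (weak_star V N) ev"
    unfolding weak_star_def continuous_map_in_subtopology continuous_map_componentwise
  proof (intro conjI ballI)
    show "ev ` ?T \<subseteq> extensional V" by (auto simp: ev_def)
    show "continuous_map X euclideanreal (\<lambda>x. ev x v)" if "v \<in> V" for v
      using VE[OF that] that by (simp add: ev_def zero_extended_continuous_def)
    show "ev \<in> ?T \<rightarrow> dual V N" using dual by auto
  qed
  have K: "compactin (weak_star V N) (ev ` ?T)"
    using X cont_ev by (auto simp: compact_space_def intro: image_compactin)
  have "homeomorphic_map X (subtopology (weak_star V N) (ev ` ?T)) ev"
  proof (rule continuous_imp_homeomorphic_map[OF _ X])
    show "continuous_map X (subtopology (weak_star V N) (ev ` ?T)) ev"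
      using cont_ev by (simp add: continuous_map_in_subtopology)
    show "Hausdorff_space (subtopology (weak_star V N) (ev ` ?T))"
      unfolding weak_star_def by (intro Hausdorff_space_subtopology) (simp add: Hausdorff_space_product_topology)
    show "ev ` ?T = topspace (subtopology (weak_star V N) (ev ` ?T))"
      using K by (auto simp: compactin_def)
    show "inj_on ev ?T"
    proof (rule inj_onI)
      fix x y assume x: "x \<in> ?T" and y: "y \<in> ?T" and eq: "ev x = ev y"
      show "x = y"
      proof (rule ccontr)
        assume "x \<noteq> y"
        then obtain f where f: "f \<in> F" "f x \<noteq> f y" using sep x y unfolding separates_points_def by blast
        have zf: "ze f \<in> F0" using f by (simp add: F0_def)
        have "ze f \<in> V" unfolding V_def
          by (rule E.combination_in_null_space[OF F0E _ M zf]) (rule F0N)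
        then have "ze f x = ze f y" using fun_cong[OF eq, of "ze f"] by (simp add: ev_def)
        then show False using f(2) x y by (simp add: ze_def)
      qed
    qed
  qed
  then have "X homeomorphic_space subtopology (weak_star V N) (ev ` ?T)"
    by (rule homeomorphic_map_imp_homeomorphic_space)
  then show ?thesis unfolding WRN_in_def using rs K by blast
qed

theorem theorem6p5:
  fixes X :: "'a topology"
  assumes "compact_space X" and "Hausdorff_space X"
  shows "(WRN X \<longleftrightarrow> (\<exists>F. rosenthal_family X F \<and> separates_points X F)) \<and>
    (WRN_in TYPE('v::real_vector) X \<longrightarrow>
      (\<exists>F. rosenthal_family X F \<and> separates_points X F))"
proof (intro conjI iffI impI)
  assume "WRN X"
  then show "\<exists>F. rosenthal_family X F \<and> separates_points X F" by (rule WRN_imp_rosenthal_family)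
next
  assume "\<exists>F. rosenthal_family X F \<and> separates_points X F"
  then show "WRN X" using rosenthal_family_imp_WRN[OF assms(1)] by (elim exE conjE)
next
  assume "WRN_in TYPE('v) X"
  then show "\<exists>F. rosenthal_family X F \<and> separates_points X F" by (rule WRN_imp_rosenthal_family)
qed

end
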